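(* Let $\mathcal N$ be an interval or a circle and let $f:\mathcal N\to\mathcal N$ be a $C^\infty$ map with all critical points non-flat. There exist a neighbourhood $\mathcal F$ of $f$ in $C^\infty(\mathcal N)$ and a function $\rho(\epsilon,N)$ such that the following holds. Let $g\in\mathcal F$ and let $J\subset T$ be intervals such that $g^m|_T$ is a diffeomorphism and the intersection multiplicity of the intervals $g^k(T)$, $k=0,\ldots,m-1$, is bounded by $N$. Then $$D(T,J)<\rho\big(D(g^m(T),g^m(J)),N\big).$$ Moreover, $\rho(\epsilon,N)$ tends to zero when $\epsilon$ goes to zero and $N$ is fixed.
   Context: $C^\infty(\mathcal N)$ is the space of $C^\infty$ maps $\mathcal N\to\mathcal N$ with the $C^\infty$ topology. A critical point $c$ of a $C^\infty$ map $f$ is non-flat if $D^df(c)\neq0$ for some $d\ge2$. For intervals $J\subset T$ with $L$ and $R$ the two connected components of $T\setminus J$, the cross-ratio is $D(T,J)=\frac{|T||J|}{|L||R|}$, where $|\cdot|$ denotes length. The intersection multiplicity of a finite collection of intervals is the maximal number of intervals in the collection with a non-empty common intersection. "$g^m|_T$ is a diffeomorphism" means $g^m:T\to g^m(T)$ is a diffeomorphism. *)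

theory Defs
  imports "HOL-Analysis.Analysis" "HOL-Library.FuncSet"
begin

text \<open>
  The one-dimensional manifolds are the compact intervals and the circle. So that both live in one
  type, points are complex numbers: an interval lies on the real axis and the circle is the unit
  circle. The map \<open>param N\<close> is an arc-length parametrisation (for the circle, the
  universal covering of \<open>\<real>/\<int>\<close>, normalised to total length 1); smoothness,
  derivatives and lengths are all taken in this parameter.
\<close>

datatype curve = Interval real real | Circle

fun pdom :: "curve \<Rightarrow> real set" where
  "pdom (Interval a b) = {a..b}"
| "pdom Circle = UNIV"

fun param :: "curve \<Rightarrow> real \<Rightarrow> complex" where
  "param (Interval a b) t = complex_of_real t"
| "param Circle t = cis (2 * pi * t)"

definition points :: "curve \<Rightarrow> complex set" where
  "points N = param N ` pdom N"

definition preim :: "curve \<Rightarrow> complex set \<Rightarrow> real set" where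
  "preim N S = {t \<in> pdom N. param N t \<in> S}"

text \<open>Iterated derivatives relative to a set, hence one-sided at the endpoints of an interval.\<close>

fun nderiv :: "real set \<Rightarrow> nat \<Rightarrow> (real \<Rightarrow> real) \<Rightarrow> real \<Rightarrow> real" where
  "nderiv U 0 F = F"
| "nderiv U (Suc k) F = (\<lambda>t. vector_derivative (nderiv U k F) (at t within U))"

definition smooth_real_on :: "real set \<Rightarrow> (real \<Rightarrow> real) \<Rightarrow> bool" where
  "smooth_real_on U F \<longleftrightarrow>
     (\<forall>k. \<forall>t\<in>U. nderiv U k F differentiable (at t within U))"

text \<open>
  \<open>F\<close> is a smooth expression in the parameter of the map \<open>f : S \<rightarrow> N\<close>. For
  an interval, \<open>F\<close> is \<open>f\<close> itself; for \<open>S = N = Circle\<close> it is a lift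
  of \<open>f\<close> to the universal covering, unique up to adding an integer.
\<close>

definition smooth_lift ::
  "curve \<Rightarrow> complex set \<Rightarrow> (complex \<Rightarrow> complex) \<Rightarrow> (real \<Rightarrow> real) \<Rightarrow> bool" where
  "smooth_lift N S f F \<longleftrightarrow>
     smooth_real_on (preim N S) F \<and>
     (\<forall>t\<in>preim N S. F t \<in> pdom N \<and> param N (F t) = f (param N t))"

definition smooth_on :: "curve \<Rightarrow> complex set \<Rightarrow> (complex \<Rightarrow> complex) \<Rightarrow> bool" where
  "smooth_on N S f \<longleftrightarrow> (\<exists>F. smooth_lift N S f F)"

definition diffeo_onto_image ::
  "curve \<Rightarrow> complex set \<Rightarrow> (complex \<Rightarrow> complex) \<Rightarrow> bool" where
  "diffeo_onto_image N T h \<longleftrightarrow>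
     inj_on h T \<and> smooth_on N T h \<and> smooth_on N (h ` T) (inv_into T h)"

definition Cinf :: "curve \<Rightarrow> (complex \<Rightarrow> complex) set" where
  "Cinf N = {f \<in> points N \<rightarrow>\<^sub>E points N. smooth_on N (points N) f}"

definition Cinf_ball ::
  "curve \<Rightarrow> (complex \<Rightarrow> complex) \<Rightarrow> nat \<Rightarrow> real \<Rightarrow> (complex \<Rightarrow> complex) set" where
  "Cinf_ball N f r e = {g \<in> Cinf N. \<exists>F G.
     smooth_lift N (points N) f F \<and> smooth_lift N (points N) g G \<and>
     (\<forall>k\<le>r. \<forall>t\<in>pdom N. \<bar>nderiv (pdom N) k F t - nderiv (pdom N) k G t\<bar> < e)}"

text \<open>Uniform convergence of all derivatives; the underlying space is \<open>Cinf N\<close>.\<close>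

definition Cinf_topology :: "curve \<Rightarrow> (complex \<Rightarrow> complex) topology" where
  "Cinf_topology N = topology_generated_by {Cinf_ball N f r e | f r e. f \<in> Cinf N \<and> e > 0}"

text \<open>
  The derivative \<open>D\<^sup>d f(c)\<close>. For \<open>d \<ge> 1\<close> it does not depend on the
  chosen lift and parameter value.
\<close>

definition Dn :: "curve \<Rightarrow> nat \<Rightarrow> (complex \<Rightarrow> complex) \<Rightarrow> complex \<Rightarrow> real" where
  "Dn N d f c =
     nderiv (pdom N) d (SOME F. smooth_lift N (points N) f F)
       (SOME t. t \<in> pdom N \<and> param N t = c)"

definition critical_point :: "curve \<Rightarrow> (complex \<Rightarrow> complex) \<Rightarrow> complex \<Rightarrow> bool" where
  "critical_point N f c \<longleftrightarrow> c \<in> points N \<and> Dn N 1 f c = 0"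

definition non_flat :: "curve \<Rightarrow> (complex \<Rightarrow> complex) \<Rightarrow> complex \<Rightarrow> bool" where
  "non_flat N f c \<longleftrightarrow> (\<exists>d\<ge>2. Dn N d f c \<noteq> 0)"

text \<open>
  Intervals are non-degenerate; they may be open, closed or half-open. The homeomorphism condition
  (rather than injectivity) prevents \<open>[0,1)\<close> from presenting the whole circle as an
  interval.
\<close>

definition interval_in :: "curve \<Rightarrow> complex set \<Rightarrow> bool" where
  "interval_in N S \<longleftrightarrow>
     (\<exists>I q. I \<subseteq> pdom N \<and> is_interval I \<and> interior I \<noteq> {} \<and> homeomorphism I S (param N) q)"

fun fund_dom :: "curve \<Rightarrow> real set" where
  "fund_dom (Interval a b) = {a..b}"
| "fund_dom Circle = {0..<1}"

definition len :: "curve \<Rightarrow> complex set \<Rightarrow> real" where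
  "len N S = measure lebesgue {t \<in> fund_dom N. param N t \<in> S}"

text \<open>
  The denominator is \<open>|L| |R|\<close> when \<open>L\<close> and \<open>R\<close> are the two
  components of \<open>T - J\<close>.
\<close>

definition cross_ratio :: "curve \<Rightarrow> complex set \<Rightarrow> complex set \<Rightarrow> real" where
  "cross_ratio N T J = len N T * len N J / (\<Prod>C\<in>components (T - J). len N C)"

text \<open>
  Intervals are counted with their indices, so equal members of the family count repeatedly.
\<close>

definition intersection_multiplicity :: "nat \<Rightarrow> (nat \<Rightarrow> 'a set) \<Rightarrow> nat" where
  "intersection_multiplicity m A = Max {card K | K. K \<subseteq> {..<m} \<and> (\<Inter>k\<in>K. A k) \<noteq> {}}"

end

theory Submission
  imports Defs
begin

text \<open>
  For \<open>T = [a, b]\<close> and \<open>J = [c, d]\<close> with cross-ratio \<open>D\<close>, the quantity \<open>ln (1 + 1 / D)\<close> is the integral of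
  \<open>dx dy / (y - x)\<^sup>2\<close> over the product of the two outer intervals. A map \<open>g\<close> transforms the kernel by the
  factor \<open>K(x, y) = g' x * g' y * (y - x)\<^sup>2 / (g y - g x)\<^sup>2\<close>. So \<open>K \<le> M\<close> on \<open>T\<close> implies that
  \<open>ln (1 + 1 / D)\<close> grows at most by the factor \<open>M\<close> (\<open>log_cr_step_increasing\<close>). Along an orbit
  the factors multiply, and the theorem follows once the suprema of \<open>K\<close> over
  \<open>T, g T, \<dots>\<close> have a product at most \<open>exp (C * n)\<close>, where \<open>n\<close> bounds the multiplicity and \<open>C\<close> is
  the same for all \<open>g\<close> near \<open>f\<close>: solving \<open>ln (1 + 1 / D\<^sub>1) \<le> exp (C * n) * ln (1 + 1 / D\<^sub>0)\<close> for
  \<open>D\<^sub>0\<close> gives a function of \<open>D\<^sub>1\<close> that tends to zero with \<open>D\<^sub>1\<close>.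

  Negative Schwarzian derivative cannot be used directly. Near \<open>x\<^sup>3\<close> there are maps such as
  \<open>x\<^sup>3 + \<delta> x\<close> whose Schwarzian derivative is positive and unbounded near 0, and \<open>K\<close> may exceed 1 by a fixed amount
  on arbitrarily short intervals. The point is that this happens for a bounded number of members of the family
  only. Let \<open>d\<close> be the order of the first nonvanishing derivative of \<open>f\<close> at a point, which exists at
  every point because the critical points are non-flat. Nearby, and for \<open>g\<close> near \<open>f\<close>, the \<open>d\<close>-th derivative
  of \<open>g\<close> is bounded away from 0, so \<open>g\<close> obeys Markov's inequality like a polynomial of degree \<open>d\<close>
  (\<open>markov_bound_exists\<close>). This alone gives a uniform bound for \<open>K\<close> (\<open>markov_distortion\<close>).

  For the finer bound let \<open>\<phi> = g'\<close> and \<open>W = \<phi> \<phi>'' - \<phi>'\<^sup>2\<close>. For \<open>d \<ge> 2\<close> the derivative of \<open>W\<close> of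
  order \<open>2 * d - 4\<close> at the point is a Catalan number times \<open>- (D\<^sup>d f)\<^sup>2\<close> (\<open>wronskian_nonzero\<close>); being nonzero,
  it stays so nearby and for nearby maps, and \<open>W\<close> has at most \<open>2 * d - 4\<close> zeros. The intervals that contain
  one of these zeros are few, by bounded multiplicity. Where \<open>W < 0\<close>, \<open>|\<phi>|\<close> is log-concave and
  \<open>K \<le> 1\<close> (\<open>log_concave_distortion\<close>). On a component \<open>U\<close> of \<open>W > 0\<close>, \<open>|\<phi>|\<close> is log-convex, and combined
  with Markov's inequality this gives \<open>|\<phi>'| \<le> C |\<phi>| / |U|\<close> (\<open>log_convex_derivative_bound\<close>), hence
  \<open>ln K \<le> C' |T| / |U|\<close>, and the sum of these bounds over the intervals inside \<open>U\<close> is at most \<open>C' * n\<close>.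
  Summing over the finitely many components (\<open>budget_critical\<close>) and over finitely many charts
  (\<open>uniform_distortion_budget\<close>) gives the constant \<open>C\<close>.

  The remaining work translates between the curve and the parameter line, where the orbit of \<open>T\<close>
  becomes a sequence of real intervals (\<open>orbit_distortion_budget\<close>) and the components of \<open>T - J\<close> become the
  two outer intervals (\<open>cross_ratio_coordinates\<close>).
\<close>

section \<open>Jets and inequalities of Markov type\<close>

text \<open>
  A jet is a function together with all its derivatives, relative to \<open>I\<close> and hence one-sided at
  endpoints. Carrying the whole sequence lets the same estimate be applied to a map, to its derivative
  and to polynomial expressions in its derivatives by shifting the index.
\<close>

definition jet_on :: "real set \<Rightarrow> (nat \<Rightarrow> real \<Rightarrow> real) \<Rightarrow> bool" where
  "jet_on I E \<longleftrightarrow> (\<forall>k. \<forall>t\<in>I. (E k has_real_derivative E (Suc k) t) (at t within I))"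

lemma jet_on_subset: "jet_on I E \<Longrightarrow> I' \<subseteq> I \<Longrightarrow> jet_on I' E"
  unfolding jet_on_def by (meson DERIV_subset subsetD)

lemma jet_on_shift: "jet_on I E \<Longrightarrow> jet_on I (\<lambda>k. E (Suc k))"
  unfolding jet_on_def by blast

lemma jet_continuous: "jet_on I E \<Longrightarrow> continuous_on I (E k)"
  unfolding jet_on_def by (intro DERIV_continuous_on[where D="E (Suc k)"]) auto

lemma jet_at: 
  assumes "jet_on {\<alpha>..\<beta>} E" "\<alpha> < t" "t < \<beta>"
  shows "(E k has_real_derivative E (Suc k) t) (at t)"
proof -
  have "(E k has_real_derivative E (Suc k) t) (at t within {\<alpha>..\<beta>})"
    using assms unfolding jet_on_def by auto
  then show ?thesis using assms by (simp add: at_within_Icc_at)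
qed

lemma jet_at_numerals:
  assumes "jet_on {\<alpha>..\<beta>} E" "\<alpha> < t" "t < \<beta>"
  shows "(E 0 has_real_derivative E 1 t) (at t)" "(E 1 has_real_derivative E 2 t) (at t)"
    "(E 2 has_real_derivative E 3 t) (at t)"
  using jet_at[OF assms, of 0] jet_at[OF assms, of 1] jet_at[OF assms, of 2]
  by (simp_all add: numeral_3_eq_3 numeral_2_eq_2)

lemma jet_mvt:
  assumes "jet_on {\<alpha>..\<beta>} E" "\<alpha> \<le> u" "u < v" "v \<le> \<beta>"
  shows "\<exists>\<xi>. u < \<xi> \<and> \<xi> < v \<and> E k v - E k u = (v - u) * E (Suc k) \<xi>"
proof -
  have "continuous_on {u..v} (E k)"
    by (rule continuous_on_subset[OF jet_continuous[OF assms(1)]]) (use assms in auto)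
  moreover have "E k differentiable (at x)" if "u < x" "x < v" for x
    using jet_at[OF assms(1), of x k] assms that real_differentiable_def by auto
  ultimately obtain l \<xi> where *: "u < \<xi>" "\<xi> < v" "DERIV (E k) \<xi> :> l" "E k v - E k u = (v - u) * l"
    using MVT[of u v "E k"] assms(3) by blast
  moreover have "l = E (Suc k) \<xi>"
    by (rule DERIV_unique[OF *(3) jet_at[OF assms(1)]]) (use * assms in auto)
  ultimately show ?thesis by blast
qed

lemma jet_mvt_abs:
  assumes j: "jet_on {\<alpha>..\<beta>} E" and u: "u \<in> {\<alpha>..\<beta>}" and v: "v \<in> {\<alpha>..\<beta>}"
  shows "\<exists>\<xi>\<in>{min u v..max u v}. \<bar>E k v - E k u\<bar> = \<bar>v - u\<bar> * \<bar>E (Suc k) \<xi>\<bar>"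
proof (cases u v rule: linorder_cases)
  case less
  then obtain \<xi> where "u < \<xi>" "\<xi> < v" "E k v - E k u = (v - u) * E (Suc k) \<xi>"
    using jet_mvt[OF j, of u v k] u v by auto
  then show ?thesis by (intro bexI[of _ \<xi>]) (auto simp: abs_mult)
next
  case equal
  then show ?thesis by auto
next
  case greater
  then obtain \<xi> where \<xi>: "v < \<xi>" "\<xi> < u" "E k u - E k v = (u - v) * E (Suc k) \<xi>"
    using jet_mvt[OF j, of v u k] u v by auto
  have "\<bar>E k v - E k u\<bar> = \<bar>v - u\<bar> * \<bar>E (Suc k) \<xi>\<bar>"
    by (subst (1 2) abs_minus_commute) (simp add: \<xi>(3) abs_mult)
  then show ?thesis using \<xi> by (intro bexI[of _ \<xi>]) auto
qed

text \<open>
  On an interval \<open>I\<close> where the \<open>n\<close>-th derivative is pinched between \<open>a\<close> and \<open>A\<close>, a function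
  obeys the inequalities of Markov and Remez for polynomials of degree \<open>n\<close>: all derivatives up to order
  \<open>n\<close>, in the scale of \<open>I\<close>, are controlled by the supremum on a subinterval of
  proportion at least \<open>\<theta>\<close>.
\<close>

definition markov_bound :: "real \<Rightarrow> real \<Rightarrow> real \<Rightarrow> nat \<Rightarrow> real \<Rightarrow> bool" where
  "markov_bound a A \<theta> n C \<longleftrightarrow> (\<forall>E \<alpha> \<beta> \<alpha>' \<beta>' s k t. \<alpha> \<le> \<alpha>' \<and> \<alpha>' < \<beta>' \<and> \<beta>' \<le> \<beta> \<and> \<theta> * (\<beta> - \<alpha>) \<le> \<beta>' - \<alpha>' \<and>
     jet_on {\<alpha>..\<beta>} E \<and> (\<forall>t\<in>{\<alpha>..\<beta>}. a \<le> \<bar>E n t\<bar> \<and> \<bar>E n t\<bar> \<le> A) \<and>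
     (\<forall>t\<in>{\<alpha>'..\<beta>'}. \<bar>E 0 t\<bar> \<le> s) \<and> k \<le> n \<and> t \<in> {\<alpha>..\<beta>} \<longrightarrow>
     (\<beta> - \<alpha>) ^ k * \<bar>E k t\<bar> \<le> C * s)"

lemma markov_boundD:
  assumes "markov_bound a A \<theta> n C" "\<alpha> \<le> \<alpha>'" "\<alpha>' < \<beta>'" "\<beta>' \<le> \<beta>" "\<theta> * (\<beta> - \<alpha>) \<le> \<beta>' - \<alpha>'" "jet_on {\<alpha>..\<beta>} E"
    "\<And>t. t \<in> {\<alpha>..\<beta>} \<Longrightarrow> a \<le> \<bar>E n t\<bar> \<and> \<bar>E n t\<bar> \<le> A" "\<And>t. t\<in>{\<alpha>'..\<beta>'} \<Longrightarrow> \<bar>E 0 t\<bar> \<le> s" "k \<le> n" "t \<in> {\<alpha>..\<beta>}"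
  shows "(\<beta> - \<alpha>) ^ k * \<bar>E k t\<bar> \<le> C * s"
  using assms(1)[unfolded markov_bound_def, rule_format, of \<alpha> \<alpha>' \<beta>' \<beta> E s k t] assms(2-) by blast

text \<open>
  Induction on \<open>n\<close>. The induction hypothesis for the derivative bounds all higher derivatives by
  \<open>B = max |E 1|\<close> over the subinterval. So \<open>|E 1| \<ge> B / 2\<close> on a definite proportion of the interval
  next to a point of maximum, which forces \<open>E 0\<close> to vary there by a definite multiple of
  \<open>B\<close> times the length. Hence \<open>B\<close> is controlled by the supremum of \<open>E 0\<close>.
\<close>

lemma markov_bound_exists:
  assumes "0 < a" "0 < \<theta>"
  shows "\<exists>C\<ge>1. markov_bound a A \<theta> n C"
proof (induction n)
  case 0
  show ?case
  proof (intro exI[of _ "max 1 (A / a)"] conjI)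
    show "markov_bound a A \<theta> 0 (max 1 (A / a))"
      unfolding markov_bound_def
    proof (intro allI impI, elim conjE)
    fix E \<alpha> \<beta> \<alpha>' \<beta>' s k and t :: real
    assume *: "\<alpha> \<le> \<alpha>'" "\<alpha>' < \<beta>'" "\<beta>' \<le> \<beta>" "\<forall>t\<in>{\<alpha>..\<beta>}. a \<le> \<bar>E 0 t\<bar> \<and> \<bar>E 0 t\<bar> \<le> A"
      "\<forall>t\<in>{\<alpha>'..\<beta>'}. \<bar>E (0::nat) t\<bar> \<le> s" "k \<le> (0::nat)" "t \<in> {\<alpha>..\<beta>}"
    have "a \<le> \<bar>E 0 \<alpha>'\<bar>" "\<bar>E 0 \<alpha>'\<bar> \<le> s" using * by auto
    then have "a \<le> s" by simp
    have "\<bar>E 0 t\<bar> \<le> A" using * by auto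
    also have "A = A / a * a" using assms by simp
    also have "\<dots> \<le> max 1 (A / a) * s"
      using \<open>a \<le> s\<close> assms by (intro mult_mono) auto
    finally show "(\<beta> - \<alpha>) ^ k * \<bar>E k t\<bar> \<le> max 1 (A / a) * s" using * by simp
    qed
  qed simp
next
  case (Suc n)
  then obtain C where C: "C \<ge> 1" and IH: "markov_bound a A \<theta> n C" by blast
  define \<kappa> where "\<kappa> = min (\<theta>/2) (min (1 / (2*C)) (min (a*\<theta> / (max A 1)) 1))"
  have \<kappa>: "\<kappa> > 0" "\<kappa> \<le> \<theta>/2" "\<kappa> \<le> 1/(2*C)" "\<kappa> \<le> a*\<theta> / (max A 1)"
    unfolding \<kappa>_def using assms C by (simp_all only: min.coboundedI1 min.coboundedI2 min.cobounded1 min_less_iff_conj order_refl) auto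
  show ?case
  proof (intro exI[of _ "1 + 4*C/\<kappa>"] conjI)
    show "1 \<le> 1 + 4*C/\<kappa>" using C \<kappa> by simp
    show "markov_bound a A \<theta> (Suc n) (1 + 4*C/\<kappa>)"
      unfolding markov_bound_def
    proof (intro allI impI, elim conjE)
    fix E \<alpha> \<beta> \<alpha>' \<beta>' s k and t :: real
    assume *: "\<alpha> \<le> \<alpha>'" "\<alpha>' < \<beta>'" "\<beta>' \<le> \<beta>" and I': "\<theta> * (\<beta> - \<alpha>) \<le> \<beta>' - \<alpha>'" and j: "jet_on {\<alpha>..\<beta>} E"
      and aA: "\<forall>t\<in>{\<alpha>..\<beta>}. a \<le> \<bar>E (Suc n) t\<bar> \<and> \<bar>E (Suc n) t\<bar> \<le> A"
      and s: "\<forall>t\<in>{\<alpha>'..\<beta>'}. \<bar>E 0 t\<bar> \<le> s" and k: "k \<le> Suc n" and t: "t \<in> {\<alpha>..\<beta>}"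
    define h where "h = \<beta> - \<alpha>"
    have h: "h > 0" using * by (simp add: h_def)
    have "s \<ge> 0" using s[rule_format, of \<alpha>'] * by auto
    have "continuous_on {\<alpha>'..\<beta>'} (\<lambda>t. \<bar>E 1 t\<bar>)"
      using jet_continuous[OF j, of 1] * by (intro continuous_on_rabs) (auto elim: continuous_on_subset)
    then obtain t0 where t0: "t0 \<in> {\<alpha>'..\<beta>'}" and t0max: "\<And>t. t \<in> {\<alpha>'..\<beta>'} \<Longrightarrow> \<bar>E 1 t\<bar> \<le> \<bar>E 1 t0\<bar>"
      using continuous_attains_sup[of "{\<alpha>'..\<beta>'}" "\<lambda>t. \<bar>E 1 t\<bar>"] * by force
    define B where "B = \<bar>E 1 t0\<bar>"
    have bd: "h ^ j * \<bar>E (Suc j) t\<bar> \<le> C * B" if "j \<le> n" "t \<in> {\<alpha>..\<beta>}" for j t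
      unfolding h_def B_def
      by (rule markov_boundD[OF IH, where E="\<lambda>k. E (Suc k)" and \<alpha>'=\<alpha>' and \<beta>'=\<beta>'])
         (use * I' aA t0max that in \<open>auto intro: jet_on_shift[OF j]\<close>)
    have Bh: "B * h \<le> 4 * s / \<kappa>"
    \<comment> \<open>for \<open>n = 0\<close> the second derivative is uncontrolled, but \<open>|E 1| \<ge> a\<close> holds everywhere\<close>
    proof (cases n)
      case 0
      obtain \<xi> where \<xi>: "\<alpha>' < \<xi>" "\<xi> < \<beta>'" "E 0 \<beta>' - E 0 \<alpha>' = (\<beta>' - \<alpha>') * E (Suc 0) \<xi>"
        using jet_mvt[OF j *(1) *(2) *(3), of 0] by blast
      have "abs (E 0 \<beta>' - E 0 \<alpha>') \<le> 2 * s" using s[rule_format, of \<alpha>'] s[rule_format, of \<beta>'] * by auto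
      then have "(\<beta>' - \<alpha>') * \<bar>E (Suc 0) \<xi>\<bar> \<le> 2 * s" using \<xi> * by (simp add: abs_mult)
      moreover have "\<theta> * h * a \<le> (\<beta>' - \<alpha>') * \<bar>E (Suc 0) \<xi>\<bar>"
        using I' aA[rule_format, of \<xi>] * \<xi> assms 0 by (intro mult_mono) (auto simp: h_def)
      ultimately have 1: "h * (a * \<theta>) \<le> 2 * s" by (simp add: mult.commute mult.left_commute)
      have "B \<le> max A 1" using aA[rule_format, of t0] t0 * 0 by (auto simp: B_def)
      then have "B * h * \<kappa> \<le> max A 1 * h * (a*\<theta> / (max A 1))"
        using \<kappa> h by (intro mult_mono) (auto simp: B_def)
      also have "\<dots> = h * (a*\<theta>)" by (simp add: max_def)
      finally show ?thesis using 1 \<open>s \<ge> 0\<close> \<kappa> by (simp add: field_simps)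
    next
      case (Suc n')
      \<comment> \<open>a neighbour of \<open>t0\<close> inside the subinterval, so close that \<open>E 1\<close> cannot fall below half its size in between\<close>
      have "\<exists>t1\<in>{\<alpha>'..\<beta>'}. \<bar>t1 - t0\<bar> = \<kappa> * h"
      proof (cases "t0 + \<kappa> * h \<le> \<beta>'")
        case True
        then show ?thesis using t0 \<kappa> h by (intro bexI[of _ "t0 + \<kappa> * h"]) (auto simp: abs_of_nonneg add_increasing2)
      next
        case False
        have "2 * (\<kappa> * h) \<le> \<theta> * h" using mult_right_mono[OF \<kappa>(2), of h] h by simp
        also have "\<dots> \<le> \<beta>' - \<alpha>'" using I' by (simp add: h_def)
        finally show ?thesis using False t0 \<kappa> h by (intro bexI[of _ "t0 - \<kappa> * h"]) (auto simp: abs_if)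
      qed
      then obtain t1 where t1: "t1 \<in> {\<alpha>'..\<beta>'}" "\<bar>t1 - t0\<bar> = \<kappa> * h" by blast
      have kh: "\<kappa> * h > 0" using \<kappa> h by simp
      have E1: "\<bar>E 1 \<xi>\<bar> \<ge> B / 2" if x: "\<xi> \<in> {min t0 t1..max t0 t1}" for \<xi>
      proof -
        have xI: "\<xi> \<in> {\<alpha>..\<beta>}" using x t0 t1 * by auto
        have "\<bar>E 1 \<xi> - E 1 t0\<bar> \<le> B / 2"
        proof -
          obtain \<eta> where "\<eta> \<in> {min t0 \<xi>..max t0 \<xi>}" "\<bar>E 1 \<xi> - E 1 t0\<bar> = \<bar>\<xi> - t0\<bar> * \<bar>E (Suc 1) \<eta>\<bar>"
            using jet_mvt_abs[OF j, of t0 \<xi> 1] xI t0 * by auto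
          then have \<eta>: "\<eta> \<in> {\<alpha>..\<beta>}" "\<bar>E 1 \<xi> - E 1 t0\<bar> = \<bar>\<xi> - t0\<bar> * \<bar>E 2 \<eta>\<bar>"
            using xI t0 * by (auto simp: numeral_2_eq_2)
          have "h * \<bar>E 2 \<eta>\<bar> \<le> C * B" using bd[of 1 \<eta>] \<eta> Suc by (simp add: numeral_2_eq_2)
          moreover have "\<bar>\<xi> - t0\<bar> \<le> \<kappa> * h" using x t1 by auto
          ultimately have "\<bar>E 1 \<xi> - E 1 t0\<bar> \<le> \<kappa> * (C * B)"
            using \<eta>(2) \<kappa>(1) mult_right_mono[of "\<bar>\<xi> - t0\<bar>" "\<kappa>*h" "\<bar>E 2 \<eta>\<bar>"] mult_left_mono[of "h * \<bar>E 2 \<eta>\<bar>" "C*B" \<kappa>]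
            by (simp add: mult.assoc) (use mult_left_mono[of "h * \<bar>E 2 \<eta>\<bar>" "C*B" \<kappa>] \<kappa>(1) in linarith)
          also have "\<dots> \<le> 1/(2*C) * (C * B)" using \<kappa> C by (intro mult_right_mono) (auto simp: B_def)
          also have "\<dots> = B/2" using C by simp
          finally show ?thesis .
        qed
        then show ?thesis unfolding B_def by linarith
      qed
      obtain \<xi> where \<xi>: "\<xi> \<in> {min t0 t1..max t0 t1}" "\<bar>E 0 t1 - E 0 t0\<bar> = \<bar>t1 - t0\<bar> * \<bar>E 1 \<xi>\<bar>"
        using jet_mvt_abs[OF j, of t0 t1 0] t0 t1 * by auto
      have "\<bar>E 0 t1 - E 0 t0\<bar> = \<kappa> * h * \<bar>E 1 \<xi>\<bar>"
        unfolding \<xi>(2) using t1(2) by simp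
      moreover have "\<bar>E 0 t1 - E 0 t0\<bar> \<le> 2 * s"
        using s[rule_format, of t0] s[rule_format, of t1] t0 t1 by linarith
      moreover have "\<kappa> * h * (B/2) \<le> \<kappa> * h * \<bar>E 1 \<xi>\<bar>" using E1[OF \<xi>(1)] kh by (intro mult_left_mono) auto
      ultimately have "\<kappa> * h * (B/2) \<le> 2 * s" by linarith
      then show ?thesis using \<kappa> by (simp add: field_simps)
    qed
    have CBh: "C * B * h \<le> 4 * C / \<kappa> * s" using mult_left_mono[OF Bh, of C] C by (simp add: mult_ac)
    show "(\<beta> - \<alpha>) ^ k * \<bar>E k t\<bar> \<le> (1 + 4*C/\<kappa>) * s"
    proof (cases k)
      case (Suc k')
      have "h ^ k' * \<bar>E k t\<bar> * h \<le> C * B * h" using bd[of k' t] Suc k t h by (intro mult_right_mono) auto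
      also note CBh
      finally show ?thesis using Suc \<open>s \<ge> 0\<close> by (simp add: h_def[symmetric] algebra_simps)
    next
      case 0
      have "\<bar>E 0 t - E 0 \<alpha>'\<bar> \<le> h * (C * B)"
      proof -
        obtain \<eta> where "\<eta> \<in> {min \<alpha>' t..max \<alpha>' t}" "\<bar>E 0 t - E 0 \<alpha>'\<bar> = \<bar>t - \<alpha>'\<bar> * \<bar>E (Suc 0) \<eta>\<bar>"
          using jet_mvt_abs[OF j, of \<alpha>' t 0] t * by auto
        then have \<eta>: "\<eta> \<in> {\<alpha>..\<beta>}" "\<bar>E 0 t - E 0 \<alpha>'\<bar> = \<bar>t - \<alpha>'\<bar> * \<bar>E 1 \<eta>\<bar>"
          using t * by auto
        have "\<bar>E 1 \<eta>\<bar> \<le> C * B" using bd[of 0 \<eta>] \<eta> by simp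
        then show ?thesis unfolding \<eta>(2) using t * h by (intro mult_mono) (auto simp: h_def)
      qed
      then have "\<bar>E 0 t\<bar> \<le> s + C * B * h" using s[rule_format, of \<alpha>'] * by (auto simp: mult_ac)
      also have "\<dots> \<le> (1 + 4*C/\<kappa>) * s" using CBh by (simp add: algebra_simps)
      finally show ?thesis using 0 by simp
    qed
  qed
  qed
qed

section \<open>Cross-ratios and distortion\<close>

text \<open>
  The kernel \<open>dx dy / (y - x)\<^sup>2\<close> pulls back under \<open>g\<close> to
  \<open>g' x * g' y dx dy / (g y - g x)\<^sup>2\<close>; the number \<open>M\<close> bounds the density of the pulled back kernel
  with respect to the original one, for pairs of points of the open interval.
\<close>

definition distortion_le :: "(real \<Rightarrow> real) \<Rightarrow> (real \<Rightarrow> real) \<Rightarrow> real \<Rightarrow> real \<Rightarrow> real \<Rightarrow> bool" where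
  "distortion_le g g' x y M \<longleftrightarrow>
     (\<forall>s t. x < s \<and> s < t \<and> t < y \<longrightarrow> g' s * g' t * (t - s)\<^sup>2 \<le> M * (g t - g s)\<^sup>2)"

lemma distortion_leD:
  "distortion_le g g' x y M \<Longrightarrow> x < s \<Longrightarrow> s < t \<Longrightarrow> t < y \<Longrightarrow> g' s * g' t * (t - s)\<^sup>2 \<le> M * (g t - g s)\<^sup>2"
  unfolding distortion_le_def by blast

lemma distortion_le_mono:
  assumes "distortion_le g g' x y M" "M \<le> M'" shows "distortion_le g g' x y M'"
  unfolding distortion_le_def
proof (intro allI impI)
  fix s t assume "x < s \<and> s < t \<and> t < y"
  then have "g' s * g' t * (t - s)\<^sup>2 \<le> M * (g t - g s)\<^sup>2" using assms(1) distortion_leD by blast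
  also have "\<dots> \<le> M' * (g t - g s)\<^sup>2" using assms(2) by (intro mult_right_mono) auto
  finally show "g' s * g' t * (t - s)\<^sup>2 \<le> M' * (g t - g s)\<^sup>2" .
qed

text \<open>
  For \<open>a < c < d < b\<close> this is the integral of \<open>dx dy / (y - x)\<^sup>2\<close> over
  \<open>[a, c] \<times> [d, b]\<close>. In terms of \<open>D = (b - a) (d - c) / ((c - a) (b - d))\<close> it equals \<open>ln (1 + 1 / D)\<close>.
\<close>

definition log_cr :: "real \<Rightarrow> real \<Rightarrow> real \<Rightarrow> real \<Rightarrow> real" where
  "log_cr a c d b = ln ((d - a) * (b - c) / ((b - a) * (d - c)))"

lemma log_cr_uminus: "log_cr (-a) (-c) (-d) (-b) = log_cr a c d b"
proof -
  have "(- d - - a) * (- b - - c) / ((- b - - a) * (- d - - c)) = (d - a) * (b - c) / ((b - a) * (d - c))"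
    using minus_mult_minus[of "d - a" "b - c"] minus_mult_minus[of "b - a" "d - c"] by (simp del: minus_mult_minus)
  then show ?thesis unfolding log_cr_def by (rule arg_cong)
qed

lemma log_cr_swap: "log_cr b d c a = log_cr a c d b"
  unfolding log_cr_def
  by (rule arg_cong[where f=ln]) (simp add: divide_simps, simp add: algebra_simps)

lemma log_cr_split:
  assumes "a < c" "c < d" "d < b"
  shows "log_cr a c d b = ln (d - a) + ln (b - c) - ln (b - a) - ln (d - c)"
  unfolding log_cr_def using assms by (simp add: ln_mult ln_div)

text \<open>
  By the integral representation, a density at most \<open>M\<close> multiplies the integral by at most \<open>M\<close>. The
  difference of the two sides vanishes if \<open>a = c\<close>, its derivative in \<open>a\<close> vanishes if \<open>b = d\<close>, and
  its mixed derivative in \<open>a\<close> and \<open>b\<close> is the difference of the two densities; two monotonicity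
  arguments therefore replace the double integral.
\<close>

lemma log_cr_step_increasing:
  assumes ord: "a < c" "c < d" "d < b"
    and cont: "continuous_on {a..b} g" and mono: "strict_mono_on {a..b} g"
    and der: "\<And>t. a < t \<Longrightarrow> t < b \<Longrightarrow> (g has_real_derivative g' t) (at t)"
    and dist: "distortion_le g g' a b M"
  shows "log_cr (g a) (g c) (g d) (g b) \<le> M * log_cr a c d b"
proof -
  have less: "g s < g t" if "a \<le> s" "s < t" "t \<le> b" for s t
    using mono that by (auto simp: strict_mono_on_def)
  \<comment> \<open>derivative in \<open>x\<close> of the difference of both sides, as a function of the outer endpoints \<open>x\<close> and \<open>y\<close>\<close>
  define P where "P = (\<lambda>x y. M * (1 / (y - x) - 1 / (d - x)) - g' x * (1 / (g y - g x) - 1 / (g d - g x)))"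
  have Pneg: "P x b \<le> 0" if x: "a < x" "x < c" for x
  proof -
    have "P x b \<le> P x d"
    proof (rule DERIV_nonpos_imp_decreasing_open[where f = "P x"])
      show "d \<le> b" using ord by simp
      show "continuous_on {d..b} (P x)"
        unfolding P_def using x ord less[of x]
        by (intro continuous_intros continuous_on_subset[OF cont]) (auto simp: less_imp_neq order_less_imp_not_eq2 dest!: less[of x])
      fix y assume y: "d < y" "y < b"
      have "(P x has_real_derivative (- M / (y - x)\<^sup>2 + g' x * g' y / (g y - g x)\<^sup>2)) (at y)"
      proof -
        have dg: "(g has_real_derivative g' y) (at y)" using der x y ord by simp
        have ne: "y - x \<noteq> 0" "g y - g x \<noteq> 0" using less[of x y] x y ord by auto
        show ?thesis unfolding P_def
          by (rule derivative_eq_intros refl dg ne)+ (use ne in \<open>simp add: divide_simps power2_eq_square\<close>)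
      qed
      moreover have "- M / (y - x)\<^sup>2 + g' x * g' y / (g y - g x)\<^sup>2 \<le> 0"
        using distortion_leD[OF dist, of x y] less[of x y] x y ord by (simp add: divide_simps mult_ac)
      ultimately show "\<exists>D. (P x has_real_derivative D) (at y) \<and> D \<le> 0" by blast
    qed
    also have "P x d = 0" by (simp add: P_def)
    finally show ?thesis .
  qed
  define Q where "Q = (\<lambda>x. M * (ln (d - x) + ln (b - c) - ln (b - x) - ln (d - c))
      - (ln (g d - g x) + ln (g b - g c) - ln (g b - g x) - ln (g d - g c)))"
  have "Q c \<le> Q a"
  proof (rule DERIV_nonpos_imp_decreasing_open[where f = Q])
    show "a \<le> c" using ord by simp
    show "continuous_on {a..c} Q"
      unfolding Q_def using ord less
      by (intro continuous_intros continuous_on_subset[OF cont]) (auto simp: order_less_imp_not_eq2)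
    fix x assume x: "a < x" "x < c"
    have "(Q has_real_derivative P x b) (at x)"
    proof -
      have dg: "(g has_real_derivative g' x) (at x)" using der x ord by simp
      have pos: "0 < d - x" "0 < b - x" "0 < g d - g x" "0 < g b - g x" using less[of x d] less[of x b] x ord by auto
      show ?thesis unfolding Q_def P_def
        by (rule derivative_eq_intros refl dg pos)+ (use pos in \<open>simp add: divide_simps\<close>, simp add: algebra_simps)
    qed
    then show "\<exists>D. (Q has_real_derivative D) (at x) \<and> D \<le> 0" using Pneg[OF x] by blast
  qed
  moreover have "Q c = 0" by (simp add: Q_def)
  moreover have "Q a = M * log_cr a c d b - log_cr (g a) (g c) (g d) (g b)"
    unfolding Q_def using ord less[of a c] less[of c d] less[of d b] by (simp add: log_cr_split)
  ultimately show ?thesis by simp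
qed

lemma log_cr_step_decreasing:
  assumes ord: "a < c" "c < d" "d < b"
    and cont: "continuous_on {a..b} g" and mono: "strict_antimono_on {a..b} g"
    and der: "\<And>t. a < t \<Longrightarrow> t < b \<Longrightarrow> (g has_real_derivative g' t) (at t)"
    and dist: "distortion_le g g' a b M"
  shows "log_cr (g a) (g c) (g d) (g b) \<le> M * log_cr a c d b"
proof -
  have "log_cr (- g a) (- g c) (- g d) (- g b) \<le> M * log_cr a c d b"
  proof (rule log_cr_step_increasing[where g = "\<lambda>x. - g x" and g' = "\<lambda>x. - g' x", OF ord])
    show "strict_mono_on {a..b} (\<lambda>x. - g x)" using mono by (auto simp: monotone_on_def)
    show "distortion_le (\<lambda>x. - g x) (\<lambda>x. - g' x) a b M"
      using dist unfolding distortion_le_def by (simp add: power2_commute)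
  qed (use cont der in \<open>auto intro!: continuous_intros derivative_intros\<close>)
  then show ?thesis by (simp only: log_cr_uminus)
qed

section \<open>Families of bounded multiplicity and zeros of jets\<close>

text \<open>
  Intersection multiplicity at most \<open>n\<close>, counted with indices, for open intervals.
\<close>

definition overlap_le :: "'i set \<Rightarrow> ('i \<Rightarrow> real) \<Rightarrow> ('i \<Rightarrow> real) \<Rightarrow> nat \<Rightarrow> bool" where
  "overlap_le S X Y n \<longleftrightarrow> (\<forall>z. card {i\<in>S. X i < z \<and> z < Y i} \<le> n)"

lemma overlap_le_subset:
  assumes "finite S" "overlap_le S X Y n" "S' \<subseteq> S" shows "overlap_le S' X Y n"
  unfolding overlap_le_def
proof
  fix z
  have "card {i \<in> S'. X i < z \<and> z < Y i} \<le> card {i \<in> S. X i < z \<and> z < Y i}"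
    using assms by (intro card_mono) auto
  then show "card {i \<in> S'. X i < z \<and> z < Y i} \<le> n"
    using assms(2) unfolding overlap_le_def by (meson le_trans)
qed

text \<open>
  Integrate the number of intervals containing \<open>z\<close> over \<open>z\<close>.
\<close>

lemma overlap_length:
  assumes S: "finite S" and ov: "overlap_le S X Y n" and ab: "\<alpha> \<le> \<beta>"
    and I: "\<And>i. i \<in> S \<Longrightarrow> \<alpha> \<le> X i \<and> X i \<le> Y i \<and> Y i \<le> \<beta>"
  shows "(\<Sum>i\<in>S. Y i - X i) \<le> real n * (\<beta> - \<alpha>)"
proof -
  have int: "integrable lborel (indicator {u<..<v} :: real \<Rightarrow> real)" for u v :: real
    by (rule integrable_real_indicator) (simp_all add: emeasure_bounded_finite[unfolded infinity_ennreal_def])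
  have int': "integrable lborel (indicator {u..v} :: real \<Rightarrow> real)" for u v :: real
    by (rule integrable_real_indicator) (simp_all add: emeasure_bounded_finite[unfolded infinity_ennreal_def])
  have "(\<Sum>i\<in>S. Y i - X i) = (\<Sum>i\<in>S. \<integral>z. indicator {X i<..<Y i} z \<partial>lborel)"
    using I by (intro sum.cong) auto
  also have "\<dots> = (\<integral>z. (\<Sum>i\<in>S. indicator {X i<..<Y i} z) \<partial>lborel)"
    by (rule Bochner_Integration.integral_sum[symmetric]) (rule int)
  also have "\<dots> \<le> (\<integral>z. real n * indicator {\<alpha>..\<beta>} z \<partial>lborel)"
  proof (rule integral_mono)
    fix z
    have "(\<Sum>i\<in>S. indicator {X i<..<Y i} z :: real) = real (card {i\<in>S. X i < z \<and> z < Y i})"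
      using S by (simp add: indicator_def sum.If_cases Int_def)
    also have "\<dots> \<le> real n * indicator {\<alpha>..\<beta>} z"
    proof (cases "z \<in> {\<alpha>..\<beta>}")
      case True
      then show ?thesis using ov by (simp add: overlap_le_def)
    next
      case False
      then have "{i\<in>S. X i < z \<and> z < Y i} = {}" using I by force
      then have "card {i\<in>S. X i < z \<and> z < Y i} = 0" by (simp only: card.empty)
      then show ?thesis by simp
    qed
    finally show "(\<Sum>i\<in>S. indicator {X i<..<Y i} z :: real) \<le> real n * indicator {\<alpha>..\<beta>} z" .
  qed (use int int' in auto)
  also have "\<dots> = real n * (\<beta> - \<alpha>)" using ab by simp
  finally show ?thesis .
qed

text \<open>
  Rolle: between consecutive zeros of a function lies a zero of its derivative.
\<close>

lemma jet_zeros: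
  assumes "jet_on {\<alpha>..\<beta>} w" "\<And>t. t \<in> {\<alpha>..\<beta>} \<Longrightarrow> w p t \<noteq> 0"
  shows "finite {t\<in>{\<alpha>..\<beta>}. w 0 t = 0} \<and> card {t\<in>{\<alpha>..\<beta>}. w 0 t = 0} \<le> p"
  using assms
proof (induction p arbitrary: w)
  case 0
  then have "{t\<in>{\<alpha>..\<beta>}. w 0 t = 0} = {}" by blast
  then have "finite {t\<in>{\<alpha>..\<beta>}. w 0 t = 0}" "card {t\<in>{\<alpha>..\<beta>}. w 0 t = 0} = 0" by (simp_all only: card.empty finite.emptyI)
  then show ?case by simp
next
  case (Suc p)
  define Z where "Z = {t\<in>{\<alpha>..\<beta>}. w (Suc 0) t = 0}"
  have Z: "finite Z" "card Z \<le> p"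
    using Suc.IH[OF jet_on_shift[OF Suc.prems(1)]] Suc.prems(2) by (auto simp: Z_def)
  have bound: "card S \<le> Suc p" if S: "finite S" "S \<subseteq> {t\<in>{\<alpha>..\<beta>}. w 0 t = 0}" for S
  proof (cases "S = {}")
    case False
    \<comment> \<open>successor of a zero in \<open>S\<close>\<close>
    define nx where "nx = (\<lambda>x. Min {y\<in>S. x < y})"
    define S' where "S' = S - {Max S}"
    have nx: "nx x \<in> S" "x < nx x" "\<And>y. y \<in> S \<Longrightarrow> x < y \<Longrightarrow> nx x \<le> y" if "x \<in> S'" for x
    proof -
      have "Max S \<in> S" "x < Max S" using that S(1) False by (auto simp: S'_def order_less_le)
      then have "{y\<in>S. x < y} \<noteq> {}" by blast
      then have "nx x \<in> {y\<in>S. x < y}" unfolding nx_def using S(1) by (intro Min_in) auto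
      then show "nx x \<in> S" "x < nx x" by auto
      show "\<And>y. y \<in> S \<Longrightarrow> x < y \<Longrightarrow> nx x \<le> y" unfolding nx_def using S(1) by (intro Min_le) auto
    qed
    have "\<exists>z. x < z \<and> z < nx x \<and> w (Suc 0) z = 0" if x: "x \<in> S'" for x
    proof -
      have "x \<in> S" using x by (simp add: S'_def)
      then have "\<exists>\<xi>>x. \<xi> < nx x \<and> w 0 (nx x) - w 0 x = (nx x - x) * w (Suc 0) \<xi>"
        using S(2) nx[OF x] by (intro jet_mvt[OF Suc.prems(1)]) auto
      moreover have "w 0 (nx x) = 0" "w 0 x = 0" using S(2) nx(1)[OF x] \<open>x \<in> S\<close> by auto
      ultimately show ?thesis using nx(2)[OF x] by auto
    qed
    then obtain \<zeta> where \<zeta>: "\<And>x. x \<in> S' \<Longrightarrow> x < \<zeta> x \<and> \<zeta> x < nx x \<and> w (Suc 0) (\<zeta> x) = 0" by metis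
    have "x = y" if "x \<in> S'" "y \<in> S'" "\<zeta> x = \<zeta> y" for x y
    proof (rule ccontr)
      assume "x \<noteq> y"
      then consider "x < y" | "y < x" by linarith
      then show False
      proof cases
        case 1
        then have "nx x \<le> y" using nx(3)[OF that(1)] that by (auto simp: S'_def)
        then show False using \<zeta>[OF that(1)] \<zeta>[OF that(2)] that(3) by linarith
      next
        case 2
        then have "nx y \<le> x" using nx(3)[OF that(2)] that by (auto simp: S'_def)
        then show False using \<zeta>[OF that(1)] \<zeta>[OF that(2)] that(3) by linarith
      qed
    qed
    then have "inj_on \<zeta> S'" by (auto simp: inj_on_def)
    moreover have "\<zeta> ` S' \<subseteq> Z"
    proof
      fix z assume "z \<in> \<zeta> ` S'"
      then obtain x where x: "x \<in> S'" "z = \<zeta> x" by auto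
      have "x \<in> {\<alpha>..\<beta>}" "nx x \<in> {\<alpha>..\<beta>}" using x S(2) nx(1)[OF x(1)] by (auto simp: S'_def)
      then show "z \<in> Z" using \<zeta>[OF x(1)] x(2) by (auto simp: Z_def)
    qed
    ultimately have "card S' \<le> p" using Z card_inj_on_le le_trans by blast
    then show ?thesis using S(1) False by (simp add: S'_def)
  qed simp
  have "finite {t\<in>{\<alpha>..\<beta>}. w 0 t = 0}"
  proof (rule ccontr)
    assume "infinite {t\<in>{\<alpha>..\<beta>}. w 0 t = 0}"
    then obtain S where "S \<subseteq> {t\<in>{\<alpha>..\<beta>}. w 0 t = 0}" "finite S" "card S = Suc (Suc p)"
      by (meson infinite_arbitrarily_large)
    then show False using bound[of S] by simp
  qed
  then show ?case using bound by blast
qed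

section \<open>Distortion of log-concave and log-convex derivatives\<close>

lemma nonzero_same_sign:
  fixes f :: "real \<Rightarrow> real"
  assumes "continuous_on {x<..<y} f" "\<And>t. x < t \<Longrightarrow> t < y \<Longrightarrow> f t \<noteq> 0" "s \<in> {x<..<y}" "t \<in> {x<..<y}"
  shows "0 < f s * f t"
proof (rule ccontr)
  assume "\<not> 0 < f s * f t"
  moreover have "f s \<noteq> 0" "f t \<noteq> 0" using assms by auto
  ultimately have "(f s \<le> 0 \<and> 0 \<le> f t) \<or> (f t \<le> 0 \<and> 0 \<le> f s)"
    by (auto simp: zero_less_mult_iff)
  moreover have "connected (f ` {x<..<y})" using assms(1) by (intro connected_continuous_image) auto
  ultimately have "0 \<in> f ` {x<..<y}"
    using connectedD_interval[of "f ` {x<..<y}" "f s" "f t" 0] connectedD_interval[of "f ` {x<..<y}" "f t" "f s" 0] assms(3,4)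
    by blast
  then show False using assms(2) by auto
qed

text \<open>
  The derivative of \<open>\<phi>' / \<phi>\<close> is \<open>(\<phi> \<phi>'' - \<phi>'\<^sup>2) / \<phi>\<^sup>2\<close>. The factor \<open>\<epsilon>\<close> treats the
  log-concave case (\<open>\<epsilon> = 1\<close>) and the log-convex case (\<open>\<epsilon> = -1\<close>) at once.
\<close>

lemma log_derivative_monotone_sign: 
  fixes \<phi> \<phi>' \<phi>'' :: "real \<Rightarrow> real"
  assumes d1: "\<And>t. x < t \<Longrightarrow> t < y \<Longrightarrow> (\<phi> has_real_derivative \<phi>' t) (at t)"
    and d2: "\<And>t. x < t \<Longrightarrow> t < y \<Longrightarrow> (\<phi>' has_real_derivative \<phi>'' t) (at t)"
    and nz: "\<And>t. x < t \<Longrightarrow> t < y \<Longrightarrow> \<phi> t \<noteq> 0"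
    and W: "\<And>t. x < t \<Longrightarrow> t < y \<Longrightarrow> \<epsilon> * (\<phi> t * \<phi>'' t - (\<phi>' t)\<^sup>2) \<le> 0"
    and tt: "x < t" "t < y"
  shows "\<exists>D. ((\<lambda>t. \<epsilon> * (\<phi>' t / \<phi> t)) has_real_derivative D) (at t) \<and> D \<le> 0"
proof -
    have a: "((\<lambda>t. \<epsilon> * (\<phi>' t / \<phi> t)) has_real_derivative \<epsilon> * ((\<phi>'' t * \<phi> t - \<phi>' t * \<phi>' t) / (\<phi> t * \<phi> t))) (at t)"
      by (rule DERIV_cmult[OF DERIV_divide[OF d2[OF tt] d1[OF tt] nz[OF tt]]])
    have eq: "\<epsilon> * ((\<phi>'' t * \<phi> t - \<phi>' t * \<phi>' t) / (\<phi> t * \<phi> t)) = (\<epsilon> * (\<phi> t * \<phi>'' t - (\<phi>' t)\<^sup>2)) / (\<phi> t)\<^sup>2"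
      by (simp add: power2_eq_square mult.commute)
    have n: "(\<epsilon> * (\<phi> t * \<phi>'' t - (\<phi>' t)\<^sup>2)) / (\<phi> t)\<^sup>2 \<le> 0"
      by (rule divide_nonpos_nonneg[OF W[OF tt] zero_le_power2])
    show ?thesis using a n unfolding eq by (intro exI conjI)
qed
text \<open>
  The logarithmic derivative in \<open>r\<close> of \<open>\<phi> (m + r) \<phi> (m - r)\<close> is
  \<open>(\<phi>' / \<phi>) (m + r) - (\<phi>' / \<phi>) (m - r)\<close>, whose sign is known because \<open>\<phi>' / \<phi>\<close> is monotone.
\<close>

lemma symmetric_product_mono:
  fixes \<phi> :: "real \<Rightarrow> real"
  assumes d1: "\<And>t. x < t \<Longrightarrow> t < y \<Longrightarrow> (\<phi> has_real_derivative \<phi>' t) (at t)"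
    and d2: "\<And>t. x < t \<Longrightarrow> t < y \<Longrightarrow> (\<phi>' has_real_derivative \<phi>'' t) (at t)"
    and nz: "\<And>t. x < t \<Longrightarrow> t < y \<Longrightarrow> \<phi> t \<noteq> 0"
    and W: "\<And>t. x < t \<Longrightarrow> t < y \<Longrightarrow> \<epsilon> * (\<phi> t * \<phi>'' t - (\<phi>' t)\<^sup>2) \<le> 0"
    and r: "0 \<le> r" "r \<le> h" and I: "x < m - h" "m + h < y"
  shows "\<epsilon> * (\<phi> (m + h) * \<phi> (m - h)) \<le> \<epsilon> * (\<phi> (m + r) * \<phi> (m - r))"
proof -
  have D: "\<exists>D. ((\<lambda>r. \<epsilon> * (\<phi> (m + r) * \<phi> (m - r))) has_real_derivative D) (at s) \<and> D \<le> 0"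
    if s: "r \<le> s" "s \<le> h" for s
  proof -
    have ms: "x < m - s" "m - s < y" "x < m + s" "m + s < y" "m - s \<le> m + s" using s r I by auto
    have du: "\<exists>D. ((\<lambda>t. \<epsilon> * (\<phi>' t / \<phi> t)) has_real_derivative D) (at t) \<and> D \<le> 0" if t: "m - s \<le> t" "t \<le> m + s" for t
      by (rule log_derivative_monotone_sign[OF d1 d2 nz W]) (use t ms in auto)
    have "\<epsilon> * (\<phi>' (m + s) / \<phi> (m + s)) \<le> \<epsilon> * (\<phi>' (m - s) / \<phi> (m - s))"
      by (rule DERIV_nonpos_imp_nonincreasing[where f = "(\<lambda>t. \<epsilon> * (\<phi>' t / \<phi> t))", OF ms(5)]) (rule du)
    moreover have "continuous_on {x<..<y} \<phi>"
      by (rule DERIV_continuous_on[where D = \<phi>']) (auto intro: has_field_derivative_at_within d1)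
    then have "0 < \<phi> (m + s) * \<phi> (m - s)" using ms by (intro nonzero_same_sign[OF _ nz]) auto
    ultimately have "(\<phi> (m + s) * \<phi> (m - s)) * (\<epsilon> * (\<phi>' (m + s) / \<phi> (m + s)) - \<epsilon> * (\<phi>' (m - s) / \<phi> (m - s))) \<le> 0"
      by (intro mult_nonneg_nonpos) auto
    also have "(\<phi> (m + s) * \<phi> (m - s)) * (\<epsilon> * (\<phi>' (m + s) / \<phi> (m + s)) - \<epsilon> * (\<phi>' (m - s) / \<phi> (m - s))) = \<epsilon> * (\<phi>' (m + s) * \<phi> (m - s) - \<phi> (m + s) * \<phi>' (m - s))"
      using nz[OF ms(1,2)] nz[OF ms(3,4)] by (simp add: field_simps)
    finally have neg: "\<epsilon> * (\<phi>' (m + s) * \<phi> (m - s) - \<phi> (m + s) * \<phi>' (m - s)) \<le> 0" .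
    have dp: "((\<lambda>r. \<phi> (m + r)) has_real_derivative \<phi>' (m + s) * 1) (at s)"
      by (rule DERIV_chain2[OF d1]) (use ms in \<open>auto intro!: derivative_eq_intros\<close>)
    have dm: "((\<lambda>r. \<phi> (m - r)) has_real_derivative \<phi>' (m - s) * (- 1)) (at s)"
      by (rule DERIV_chain2[OF d1]) (use ms in \<open>auto intro!: derivative_eq_intros\<close>)
    have "((\<lambda>r. \<epsilon> * (\<phi> (m + r) * \<phi> (m - r))) has_real_derivative
        \<epsilon> * (\<phi>' (m + s) * \<phi> (m - s) - \<phi> (m + s) * \<phi>' (m - s))) (at s)"
      by (rule DERIV_cong[OF DERIV_cmult[OF DERIV_mult[OF dp dm]]]) (simp add: algebra_simps)
    then show ?thesis using neg by blast
  qed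
  show ?thesis
    by (rule DERIV_nonpos_imp_nonincreasing[where f = "\<lambda>r. \<epsilon> * (\<phi> (m + r) * \<phi> (m - r))", OF r(2)]) (rule D)
qed

text \<open>
  For log-concave \<open>\<phi> = E 1\<close> the average of \<open>\<phi>\<close> over \<open>[s, t]\<close> is at least the geometric mean
  of its end values: by symmetry about the midpoint \<open>m\<close>, the average is an average of
  \<open>(\<phi> (m + z) + \<phi> (m - z)) / 2\<close>, which is at least the root of \<open>\<phi> (m + z) \<phi> (m - z)\<close>, and this
  product decreases in \<open>z\<close>. Such steps do not increase \<^const>\<open>log_cr\<close>.
\<close>

lemma log_concave_distortion:
  assumes j: "jet_on {x..y} E" and nz: "\<And>t. x < t \<Longrightarrow> t < y \<Longrightarrow> E 1 t \<noteq> 0"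
    and W: "\<And>t. x < t \<Longrightarrow> t < y \<Longrightarrow> E 1 t * E 3 t \<le> (E 2 t)\<^sup>2"
  shows "distortion_le (E 0) (E 1) x y 1"
  unfolding distortion_le_def
proof (intro allI impI, elim conjE)
  fix s t assume st: "x < s" "s < t" "t < y"
  define m h where "m = (s + t) / 2" and "h = (t - s) / 2"
  have mh: "m + h = t" "m - h = s" "0 < h" using st by (auto simp: m_def h_def field_simps)
  note d0 = jet_at_numerals(1)[OF j] and d1 = jet_at_numerals(2)[OF j] and d2 = jet_at_numerals(3)[OF j]
  have "\<exists>z. 0 < z \<and> z < h \<and> (E 0 (m + h) - E 0 (m - h)) - (E 0 (m + 0) - E 0 (m - 0)) = (h - 0) * (E 1 (m + z) + E 1 (m - z))"
  proof (rule MVT2[OF mh(3), where f = "\<lambda>r. E 0 (m + r) - E 0 (m - r)"])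
    fix r assume r: "0 \<le> r" "r \<le> h"
    have "((\<lambda>r. E 0 (m + r)) has_real_derivative E 1 (m + r) * 1) (at r)"
      by (rule DERIV_chain2[OF d0]) (use r mh st in \<open>auto intro!: derivative_eq_intros\<close>)
    moreover have "((\<lambda>r. E 0 (m - r)) has_real_derivative E 1 (m - r) * (- 1)) (at r)"
      by (rule DERIV_chain2[OF d0]) (use r mh st in \<open>auto intro!: derivative_eq_intros\<close>)
    ultimately show "((\<lambda>r. E 0 (m + r) - E 0 (m - r)) has_real_derivative (E 1 (m + r) + E 1 (m - r))) (at r)"
      by (auto intro!: derivative_eq_intros)
  qed
  then obtain z where z: "0 < z" "z < h" and eq: "E 0 t - E 0 s = h * (E 1 (m + z) + E 1 (m - z))"
    using mh by auto
  have "1 * (E 1 (m + h) * E 1 (m - h)) \<le> 1 * (E 1 (m + z) * E 1 (m - z))"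
    by (rule symmetric_product_mono[OF d1 d2 nz]) (use W z mh st in auto)
  then have "4 * (E 1 s * E 1 t) \<le> 4 * (E 1 (m + z) * E 1 (m - z))" using mh by (simp add: mult_ac)
  also have "\<dots> \<le> (E 1 (m + z) + E 1 (m - z))\<^sup>2"
    using zero_le_power2[of "E 1 (m + z) - E 1 (m - z)"] by (simp add: power2_eq_square algebra_simps)
  finally have "h\<^sup>2 * (4 * (E 1 s * E 1 t)) \<le> h\<^sup>2 * (E 1 (m + z) + E 1 (m - z))\<^sup>2"
    by (intro mult_left_mono) auto
  moreover have "(t - s)\<^sup>2 = 4 * h\<^sup>2" by (simp add: h_def power_divide)
  ultimately show "E 1 s * E 1 t * (t - s)\<^sup>2 \<le> 1 * (E 0 t - E 0 s)\<^sup>2"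
    unfolding eq by (simp add: power_mult_distrib mult_ac)
qed

text \<open>
  A log-convex function that is tiny at \<open>t\<close> compared with its maximum \<open>B\<close> is also tiny, by the
  midpoint inequality at most \<open>sqrt (\<phi> t * B)\<close>, on a whole subinterval of definite proportion next to
  \<open>t\<close>. A function of polynomial type cannot be tiny on such a subinterval. Therefore \<open>\<phi> t\<close> is
  comparable with \<open>B\<close>, and the Markov inequality bounds \<open>\<phi>'\<close> by \<open>\<phi> t\<close> divided by the length.
\<close>

lemma log_convex_derivative_bound:
  assumes mk: "markov_bound a A (1/4) n C" and C: "C \<ge> 1" and n: "n \<ge> 1"
    and j: "jet_on {\<alpha>..\<beta>} E" and aA: "\<And>t. t \<in> {\<alpha>..\<beta>} \<Longrightarrow> a \<le> \<bar>E n t\<bar> \<and> \<bar>E n t\<bar> \<le> A"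
    and nz: "\<And>t. \<alpha> < t \<Longrightarrow> t < \<beta> \<Longrightarrow> E 0 t \<noteq> 0"
    and W: "\<And>t. \<alpha> < t \<Longrightarrow> t < \<beta> \<Longrightarrow> (E 1 t)\<^sup>2 \<le> E 0 t * E 2 t"
    and t: "\<alpha> < t" "t < \<beta>"
  shows "\<bar>E 1 t\<bar> * (\<beta> - \<alpha>) \<le> 2 * C\<^sup>2 * \<bar>E 0 t\<bar>"
proof -
  \<comment> \<open>retreat from the endpoints, where log-convexity is not assumed; this costs the factor 2\<close>
  define \<alpha>1 \<beta>1 where "\<alpha>1 = (\<alpha> + t) / 2" and "\<beta>1 = (t + \<beta>) / 2"
  have ord: "\<alpha> < \<alpha>1" "\<alpha>1 < t" "t < \<beta>1" "\<beta>1 < \<beta>" using t by (auto simp: \<alpha>1_def \<beta>1_def)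
  have j1: "jet_on {\<alpha>1..\<beta>1} E" by (rule jet_on_subset[OF j]) (use ord in auto)
  have "continuous_on {\<alpha>1..\<beta>1} (\<lambda>s. \<bar>E 0 s\<bar>)" by (intro continuous_on_rabs jet_continuous[OF j1])
  then obtain t1 where t1: "t1 \<in> {\<alpha>1..\<beta>1}" and t1max: "\<And>s. s \<in> {\<alpha>1..\<beta>1} \<Longrightarrow> \<bar>E 0 s\<bar> \<le> \<bar>E 0 t1\<bar>"
    using continuous_attains_sup[of "{\<alpha>1..\<beta>1}" "\<lambda>s. \<bar>E 0 s\<bar>"] ord by force
  define B where "B = \<bar>E 0 t1\<bar>"
  note d0 = jet_at_numerals(1)[OF j] and d1 = jet_at_numerals(2)[OF j]
  have mid: "\<bar>E 0 s\<bar> \<le> sqrt (\<bar>E 0 t\<bar> * B)" if s: "s \<in> {\<alpha>1..\<beta>1}" "2 * s - t \<in> {\<alpha>1..\<beta>1}" for s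
  proof -
    define h where "h = \<bar>s - t\<bar>"
    have st: "(s + h = t \<and> s - h = 2 * s - t) \<or> (s - h = t \<and> s + h = 2 * s - t)" by (auto simp: h_def abs_if)
    have "(-1) * (E 0 (s + h) * E 0 (s - h)) \<le> (-1) * (E 0 (s + 0) * E 0 (s - 0))"
      by (rule symmetric_product_mono[OF d0 d1 nz]) (use W s st ord in \<open>auto simp: h_def\<close>)
    then have "(E 0 s)\<^sup>2 \<le> E 0 t * E 0 (2 * s - t)" using st by (auto simp: power2_eq_square mult.commute)
    also have "\<dots> \<le> \<bar>E 0 t\<bar> * \<bar>E 0 (2 * s - t)\<bar>" by (metis abs_ge_self abs_mult)
    also have "\<dots> \<le> \<bar>E 0 t\<bar> * B" unfolding B_def using t1max[OF s(2)] by (intro mult_left_mono) auto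
    finally show ?thesis by (metis real_sqrt_abs real_sqrt_le_iff)
  qed
  have "\<exists>\<alpha>' \<beta>'. \<alpha>1 \<le> \<alpha>' \<and> \<alpha>' < \<beta>' \<and> \<beta>' \<le> \<beta>1 \<and> 1/4 * (\<beta>1 - \<alpha>1) \<le> \<beta>' - \<alpha>' \<and> (\<forall>s\<in>{\<alpha>'..\<beta>'}. \<bar>E 0 s\<bar> \<le> sqrt (\<bar>E 0 t\<bar> * B))"
  proof (cases "\<beta>1 - t \<ge> t - \<alpha>1")
    case True
    show ?thesis by (rule exI[of _ t], rule exI[of _ "(t + \<beta>1) / 2"]) (use True ord in \<open>auto intro!: mid\<close>)
  next
    case False
    show ?thesis by (rule exI[of _ "(\<alpha>1 + t) / 2"], rule exI[of _ t]) (use False ord in \<open>auto intro!: mid simp: add_divide_distrib\<close>)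
  qed
  then obtain \<alpha>' \<beta>' where I': "\<alpha>1 \<le> \<alpha>'" "\<alpha>' < \<beta>'" "\<beta>' \<le> \<beta>1" "1/4 * (\<beta>1 - \<alpha>1) \<le> \<beta>' - \<alpha>'"
      and small: "\<And>s. s\<in>{\<alpha>'..\<beta>'} \<Longrightarrow> \<bar>E 0 s\<bar> \<le> sqrt (\<bar>E 0 t\<bar> * B)" by blast
  have M: "(\<beta>1 - \<alpha>1) ^ k * \<bar>E k s\<bar> \<le> C * sqrt (\<bar>E 0 t\<bar> * B)" if "k \<le> n" "s \<in> {\<alpha>1..\<beta>1}" for k s
  proof (rule markov_boundD[OF mk, where E = E and \<alpha>' = \<alpha>' and \<beta>' = \<beta>'])
    show "\<And>s. s \<in> {\<alpha>1..\<beta>1} \<Longrightarrow> a \<le> \<bar>E n s\<bar> \<and> \<bar>E n s\<bar> \<le> A" using aA ord by auto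
  qed (fact I' j1 small that)+
  have "B \<le> C * sqrt (\<bar>E 0 t\<bar> * B)" using M[of 0 t1] t1 by (simp add: B_def)
  then have "B\<^sup>2 \<le> (C * sqrt (\<bar>E 0 t\<bar> * B))\<^sup>2" by (intro power_mono) (auto simp: B_def)
  also have "\<dots> = (C\<^sup>2 * \<bar>E 0 t\<bar>) * B" by (simp add: power_mult_distrib B_def)
  finally have "B * B \<le> (C\<^sup>2 * \<bar>E 0 t\<bar>) * B" by (simp add: power2_eq_square)
  moreover have "B > 0" using t1max[of t] nz[OF t] ord by (simp add: B_def)
  ultimately have B: "B \<le> C\<^sup>2 * \<bar>E 0 t\<bar>" by simp
  have "(\<beta>1 - \<alpha>1) * \<bar>E 1 t\<bar> \<le> C * sqrt (\<bar>E 0 t\<bar> * B)" using M[of 1 t] ord n by simp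
  also have "\<dots> \<le> C * sqrt (\<bar>E 0 t\<bar> * (C\<^sup>2 * \<bar>E 0 t\<bar>))"
    using B C by (intro mult_left_mono real_sqrt_le_mono) auto
  also have "\<bar>E 0 t\<bar> * (C\<^sup>2 * \<bar>E 0 t\<bar>) = (C * \<bar>E 0 t\<bar>)\<^sup>2" by (simp add: power2_eq_square)
  also have "C * sqrt ((C * \<bar>E 0 t\<bar>)\<^sup>2) = C\<^sup>2 * \<bar>E 0 t\<bar>" using C by (simp add: power2_eq_square abs_mult)
  also have "\<beta>1 - \<alpha>1 = (\<beta> - \<alpha>) / 2" by (simp add: \<alpha>1_def \<beta>1_def field_simps)
  finally show ?thesis by (simp add: mult_ac)
qed

text \<open>
  Since \<open>ln |E 1|\<close> is \<open>L\<close>-Lipschitz, its end values exceed its value at the mean value point by at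
  most \<open>L\<close> times the length each.
\<close>

lemma log_derivative_distortion:
  assumes j: "jet_on {x..y} E" and L: "L \<ge> 0"
    and nz: "\<And>t. x < t \<Longrightarrow> t < y \<Longrightarrow> E 1 t \<noteq> 0"
    and b: "\<And>t. x < t \<Longrightarrow> t < y \<Longrightarrow> \<bar>E 2 t\<bar> \<le> L * \<bar>E 1 t\<bar>"
  shows "distortion_le (E 0) (E 1) x y (exp (2 * L * (y - x)))"
  unfolding distortion_le_def
proof (intro allI impI, elim conjE)
  fix s t assume st: "x < s" "s < t" "t < y"
  note d1 = jet_at_numerals(2)[OF j]
  obtain \<xi> where \<xi>: "s < \<xi>" "\<xi> < t" "E 0 t - E 0 s = (t - s) * E 1 \<xi>"
    using jet_mvt[OF j, of s t 0] st by auto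
  have "continuous_on {x<..<y} (E 1)"
    by (rule DERIV_continuous_on[where D = "E 2"]) (auto intro: has_field_derivative_at_within d1[unfolded One_nat_def])
  then have same: "0 < E 1 \<xi> * E 1 w" if "x < w" "w < y" for w
    using that \<xi> st by (intro nonzero_same_sign[OF _ nz]) auto
  \<comment> \<open>the factor \<open>E 1 \<xi>\<close> only makes the argument positive\<close>
  define f where "f = (\<lambda>w. ln (E 1 \<xi> * E 1 w))"
  have lip: "\<bar>f v - f u\<bar> \<le> L * (y - x)" if uv: "x < u" "u < v" "v < y" for u v
  proof -
    have "\<exists>z. u < z \<and> z < v \<and> f v - f u = (v - u) * (E 2 z / E 1 z)"
    proof (rule MVT2[OF uv(2), where f = f and f' = "\<lambda>z. E 2 z / E 1 z"])
      fix z assume "u \<le> z" "z \<le> v"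
      then have z: "x < z" "z < y" using uv by auto
      show "(f has_real_derivative E 2 z / E 1 z) (at z)"
        unfolding f_def using same[OF z] nz[OF z] nz[of \<xi>] \<xi> st
        by (auto intro!: derivative_eq_intros d1[unfolded One_nat_def] z simp: field_simps)
    qed
    then obtain z where z: "u < z" "z < v" "f v - f u = (v - u) * (E 2 z / E 1 z)" by blast
    have "\<bar>E 2 z / E 1 z\<bar> \<le> L" using b[of z] nz[of z] z uv by (simp add: divide_simps)
    then have "\<bar>f v - f u\<bar> \<le> (v - u) * L" unfolding z(3) abs_mult[of "v - u"] using uv
      by (metis abs_of_pos diff_gt_0_iff_gt less_imp_le mult_left_mono)
    also have "\<dots> \<le> (y - x) * L" using uv L by (intro mult_right_mono) auto
    finally show ?thesis by (simp add: mult.commute)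
  qed
  have "f s \<le> f \<xi> + L * (y - x)" "f t \<le> f \<xi> + L * (y - x)" using lip[of s \<xi>] lip[of \<xi> t] st \<xi> by auto
  then have "f s + f t \<le> 2 * L * (y - x) + (f \<xi> + f \<xi>)" by simp
  then have "exp (f s + f t) \<le> exp (2 * L * (y - x) + (f \<xi> + f \<xi>))" by simp
  moreover have "exp (f w) = E 1 \<xi> * E 1 w" if "x < w" "w < y" for w using same[OF that] by (simp add: f_def)
  ultimately have "(E 1 \<xi> * E 1 s) * (E 1 \<xi> * E 1 t) \<le> exp (2 * L * (y - x)) * ((E 1 \<xi> * E 1 \<xi>) * (E 1 \<xi> * E 1 \<xi>))"
    using st \<xi> by (simp add: exp_add exp_double power2_eq_square)
  then have "(E 1 s * E 1 t) * (E 1 \<xi>)\<^sup>2 \<le> (exp (2 * L * (y - x)) * (E 1 \<xi>)\<^sup>2) * (E 1 \<xi>)\<^sup>2"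
    by (simp add: power2_eq_square mult_ac)
  then have *: "E 1 s * E 1 t \<le> exp (2 * L * (y - x)) * (E 1 \<xi>)\<^sup>2"
    using nz[of \<xi>] \<xi> st by simp
  show "E 1 s * E 1 t * (t - s)\<^sup>2 \<le> exp (2 * L * (y - x)) * (E 0 t - E 0 s)\<^sup>2"
    unfolding \<xi>(3) power_mult_distrib using mult_right_mono[OF *, of "(t - s)\<^sup>2"] by (simp add: mult_ac)
qed

lemma jet_monotone_bound:
  assumes j: "jet_on {x..y} E" and nz: "\<And>t. x < t \<Longrightarrow> t < y \<Longrightarrow> E 1 t \<noteq> 0" and t: "t \<in> {x..y}"
  shows "\<bar>E 0 t - E 0 x\<bar> \<le> \<bar>E 0 y - E 0 x\<bar>"
proof -
  have "continuous_on {x<..<y} (E 1)" using jet_continuous[OF j, of 1] by (rule continuous_on_subset) auto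
  then have same: "0 < E 1 u * E 1 w" if "u \<in> {x<..<y}" "w \<in> {x<..<y}" for u w
    using that by (intro nonzero_same_sign[OF _ nz]) auto
  consider "t = x" | "t = y" | "x < t" "t < y" using t by force
  then show ?thesis
  proof cases
    case 3
    obtain \<xi> where \<xi>: "x < \<xi>" "\<xi> < t" "E 0 t - E 0 x = (t - x) * E 1 \<xi>"
      using jet_mvt[OF j, of x t 0] 3 by auto
    obtain \<eta> where \<eta>: "t < \<eta>" "\<eta> < y" "E 0 y - E 0 t = (y - t) * E 1 \<eta>"
      using jet_mvt[OF j, of t y 0] 3 by auto
    have "0 < ((t - x) * (y - t)) * (E 1 \<xi> * E 1 \<eta>)"
      using same[of \<xi> \<eta>] 3 \<xi> \<eta> by (intro mult_pos_pos[of _ "E 1 \<xi> * E 1 \<eta>"]) auto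
    then have "0 < (E 0 t - E 0 x) * (E 0 y - E 0 t)" unfolding \<xi>(3) \<eta>(3) by (simp add: mult_ac)
    then show ?thesis by (auto simp: zero_less_mult_iff)
  qed auto
qed

text \<open>
  The Markov bound for \<open>E 0 - E 0 s\<close> on \<open>[s, t]\<close>: by monotonicity the supremum there is the total
  increment, so the first derivative is at most \<open>C\<close> times the average slope. The bound on the \<open>d\<close>-th
  derivative gives the lower bound for the increment.
\<close>

lemma markov_distortion:
  assumes mk: "markov_bound a A 1 d C" and C: "C \<ge> 1" and d: "d \<ge> 1"
    and j: "jet_on {x..y} E" and aA: "\<And>t. t \<in> {x..y} \<Longrightarrow> a \<le> \<bar>E d t\<bar> \<and> \<bar>E d t\<bar> \<le> A"
    and nz: "\<And>t. x < t \<Longrightarrow> t < y \<Longrightarrow> E 1 t \<noteq> 0" and xy: "x < y"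
  shows "a / C * (y - x) ^ d \<le> \<bar>E 0 y - E 0 x\<bar>" "distortion_le (E 0) (E 1) x y (C\<^sup>2)"
proof -
  have key: "(t - s) ^ k * \<bar>E k u\<bar> \<le> C * \<bar>E 0 t - E 0 s\<bar>"
    if st: "x \<le> s" "s < t" "t \<le> y" and k: "1 \<le> k" "k \<le> d" and u: "u \<in> {s..t}" for s t k u
  proof -
    define F where "F = (\<lambda>k z. if k = 0 then E 0 z - E 0 s else E k z)"
    have js: "jet_on {s..t} E" by (rule jet_on_subset[OF j]) (use st in auto)
    have "jet_on {s..t} F"
      unfolding jet_on_def
    proof (intro allI ballI)
      fix i z assume z: "z \<in> {s..t}"
      have "(E i has_real_derivative E (Suc i) z) (at z within {s..t})" using js z unfolding jet_on_def by blast
      then show "(F i has_real_derivative F (Suc i) z) (at z within {s..t})"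
        unfolding F_def by (cases "i = 0") (auto intro!: derivative_eq_intros)
    qed
    moreover have "\<And>z. z \<in> {s..t} \<Longrightarrow> \<bar>F 0 z\<bar> \<le> \<bar>E 0 t - E 0 s\<bar>"
      unfolding F_def using jet_monotone_bound[OF js] nz st by simp
    ultimately have "(t - s) ^ k * \<bar>F k u\<bar> \<le> C * \<bar>E 0 t - E 0 s\<bar>"
      using st k u d aA by (intro markov_boundD[OF mk, where \<alpha>' = s and \<beta>' = t]) (auto simp: F_def)
    then show ?thesis using k by (simp add: F_def)
  qed
  have "a * (y - x) ^ d \<le> (y - x) ^ d * \<bar>E d x\<bar>"
    using aA[of x] xy by (subst mult.commute) (intro mult_left_mono, auto)
  also have "\<dots> \<le> C * \<bar>E 0 y - E 0 x\<bar>" using key[of x y d x] xy d by simp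
  finally show "a / C * (y - x) ^ d \<le> \<bar>E 0 y - E 0 x\<bar>" using C by (simp add: field_simps)
  show "distortion_le (E 0) (E 1) x y (C\<^sup>2)"
    unfolding distortion_le_def
  proof (intro allI impI, elim conjE)
    fix s t assume st: "x < s" "s < t" "t < y"
    have "(t - s) * \<bar>E 1 s\<bar> \<le> C * \<bar>E 0 t - E 0 s\<bar>" "(t - s) * \<bar>E 1 t\<bar> \<le> C * \<bar>E 0 t - E 0 s\<bar>"
      using key[of s t 1 s] key[of s t 1 t] st d by auto
    then have "((t - s) * \<bar>E 1 s\<bar>) * ((t - s) * \<bar>E 1 t\<bar>) \<le> (C * \<bar>E 0 t - E 0 s\<bar>) * (C * \<bar>E 0 t - E 0 s\<bar>)"
      using st C by (intro mult_mono[of "(t - s) * \<bar>E 1 s\<bar>"]) auto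
    moreover have "E 1 s * E 1 t * (t - s)\<^sup>2 \<le> ((t - s) * \<bar>E 1 s\<bar>) * ((t - s) * \<bar>E 1 t\<bar>)"
      using mult_right_mono[OF abs_ge_self[of "E 1 s * E 1 t"], of "(t - s)\<^sup>2"]
      by (simp add: abs_mult power2_eq_square mult_ac)
    moreover have "(C * \<bar>E 0 t - E 0 s\<bar>) * (C * \<bar>E 0 t - E 0 s\<bar>) = C\<^sup>2 * (E 0 t - E 0 s)\<^sup>2"
      by (simp add: power2_eq_square mult_ac flip: abs_mult)
    ultimately show "E 1 s * E 1 t * (t - s)\<^sup>2 \<le> C\<^sup>2 * (E 0 t - E 0 s)\<^sup>2" by linarith
  qed
qed

section \<open>The Wronskian of the first two derivatives\<close>

text \<open>
  Leibniz rule for all orders.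
\<close>

lemma jet_product:
  assumes "jet_on I F" "jet_on I G"
  shows "jet_on I (\<lambda>q t. \<Sum>i\<le>q. real (q choose i) * (F i t * G (q - i) t))"
  unfolding jet_on_def
proof (intro allI ballI)
  fix q t assume t: "t \<in> I"
  have dF: "(F i has_real_derivative F (Suc i) t) (at t within I)" for i using assms(1) t unfolding jet_on_def by blast
  have dG: "(G i has_real_derivative G (Suc i) t) (at t within I)" for i using assms(2) t unfolding jet_on_def by blast
  have "((\<lambda>t. \<Sum>i\<le>q. real (q choose i) * (F i t * G (q - i) t)) has_real_derivative
     (\<Sum>i\<le>q. real (q choose i) * (F (Suc i) t * G (q - i) t + G (Suc (q - i)) t * F i t))) (at t within I)"
    by (intro DERIV_sum DERIV_cmult DERIV_mult dF dG)
  moreover have "(\<Sum>i\<le>q. real (q choose i) * (F (Suc i) t * G (q - i) t + G (Suc (q - i)) t * F i t))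
     = (\<Sum>i\<le>Suc q. real (Suc q choose i) * (F i t * G (Suc q - i) t))"
  proof -
    have "(\<Sum>i\<le>q. real (q choose i) * (G (Suc (q - i)) t * F i t)) = (\<Sum>i\<le>Suc q. real (q choose i) * (F i t * G (Suc q - i) t))"
      by (auto simp: Suc_diff_le mult_ac intro!: sum.cong)
    also have "\<dots> = F 0 t * G (Suc q) t + (\<Sum>i\<le>q. real (q choose Suc i) * (F (Suc i) t * G (q - i) t))"
      by (subst sum.atMost_Suc_shift) simp
    finally show ?thesis
      unfolding sum.atMost_Suc_shift[of "\<lambda>i. real (Suc q choose i) * (F i t * G (Suc q - i) t)"]
      by (simp add: sum.distrib algebra_simps)
  qed
  ultimately show "((\<lambda>t. \<Sum>i\<le>q. real (q choose i) * (F i t * G (q - i) t)) has_real_derivative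
      (\<Sum>i\<le>Suc q. real (Suc q choose i) * (F i t * G (Suc q - i) t))) (at t within I)" by simp
qed

text \<open>
  For the jet \<open>u\<close> of \<open>g\<close> at a point and \<open>\<phi> = g'\<close>, this is the \<open>q\<close>-th derivative of
  \<open>W = \<phi> \<phi>'' - \<phi>'\<^sup>2\<close>, expanded by the Leibniz rule; \<open>W\<close> is the Wronskian of \<open>\<phi>\<close> and
  \<open>\<phi>'\<close>, and its sign decides whether \<open>|\<phi>|\<close> is log-concave or log-convex.
\<close>

definition wronskian :: "nat \<Rightarrow> (nat \<Rightarrow> real) \<Rightarrow> real" where
  "wronskian q u = (\<Sum>i\<le>q. real (q choose i) * (u (Suc i) * u (Suc (Suc (Suc (q - i))))))
     - (\<Sum>i\<le>q. real (q choose i) * (u (Suc (Suc i)) * u (Suc (Suc (q - i)))))"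

lemma jet_wronskian:
  assumes "jet_on I E" shows "jet_on I (\<lambda>q t. wronskian q (\<lambda>k. E k t))"
proof -
  note j1 = jet_on_shift[OF assms] and j2 = jet_on_shift[OF jet_on_shift[OF assms]]
  note j3 = jet_on_shift[OF j2]
  note p = jet_product[OF j1 j3] jet_product[OF j2 j2]
  show ?thesis
    unfolding jet_on_def wronskian_def
    by (intro allI ballI DERIV_diff) (use p in \<open>simp_all only: jet_on_def\<close>)
qed

lemma wronskian_0: "wronskian 0 u = u 1 * u 3 - (u 2)\<^sup>2"
  by (simp add: wronskian_def numeral_3_eq_3 numeral_2_eq_2 power2_eq_square)

text \<open>
  The orders of the two factors of each term add up to \<open>2 * d\<close>, so only the term with both orders equal
  to \<open>d\<close> survives.
\<close>

lemma leibniz_sum_single_term: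
  fixes u :: "nat \<Rightarrow> real"
  assumes z: "\<And>k. 1 \<le> k \<Longrightarrow> k < d \<Longrightarrow> u k = 0" and ab: "1 \<le> a" "a \<le> d" "1 \<le> b" "a + b + q = 2 * d"
  shows "(\<Sum>i\<le>q. real (q choose i) * (u (a + i) * u (b + (q - i)))) = real (q choose (d - a)) * (u d)\<^sup>2"
proof -
  have "(\<Sum>i\<le>q. real (q choose i) * (u (a + i) * u (b + (q - i))))
     = (\<Sum>i\<le>q. if i = d - a then real (q choose (d - a)) * (u d)\<^sup>2 else 0)"
  proof (intro sum.cong refl)
    fix i assume i: "i \<in> {..q}"
    consider "i = d - a" | "a + i < d" | "b + (q - i) < d" "i \<noteq> d - a" using i ab by force
    then show "real (q choose i) * (u (a + i) * u (b + (q - i))) = (if i = d - a then real (q choose (d - a)) * (u d)\<^sup>2 else 0)"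
    proof cases
      case 1
      then have "a + i = d" "b + (q - i) = d" using i ab by auto
      then show ?thesis using 1 by (simp add: power2_eq_square)
    next
      case 2
      then show ?thesis using z[of "a + i"] ab by auto
    next
      case 3
      then show ?thesis using z[of "b + (q - i)"] ab by auto
    qed
  qed
  also have "\<dots> = real (q choose (d - a)) * (u d)\<^sup>2" by (auto simp: binomial_eq_0)
  finally show ?thesis .
qed

text \<open>
  With \<open>k = d - 2\<close> the coefficient of \<open>(u d)\<^sup>2\<close> is \<open>(2k choose (k + 1)) - (2k choose k)\<close>, minus the
  \<open>k\<close>-th Catalan number.
\<close>

lemma wronskian_nonzero:
  assumes "d \<ge> 2" "u d \<noteq> 0" "\<And>k. 1 \<le> k \<Longrightarrow> k < d \<Longrightarrow> u k = 0"
  shows "wronskian (2 * (d - 2)) u \<noteq> 0"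
proof -
  define k where "k = d - 2"
  have d: "d - 1 = Suc k" "d - 2 = k" using assms(1) by (auto simp: k_def)
  have "wronskian (2 * k) u = (real (2 * k choose Suc k) - real (2 * k choose k)) * (u d)\<^sup>2"
    using leibniz_sum_single_term[where d = d and u = u and a = 1 and b = 3 and q = "2 * k", OF assms(3)]
      leibniz_sum_single_term[where d = d and u = u and a = 2 and b = 2 and q = "2 * k", OF assms(3)] assms(1) d k_def
    by (simp add: wronskian_def numeral_3_eq_3 numeral_2_eq_2 algebra_simps)
  moreover have "2 * k choose Suc k < 2 * k choose k"
  proof (cases "k = 0")
    case False
    then show ?thesis by (intro binomial_strict_antimono) auto
  qed simp
  ultimately show ?thesis using assms(2) by (simp add: d)
qed

lemma wronskian_continuous:
  assumes "wronskian q v \<noteq> 0"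
  shows "\<exists>e>0. \<forall>u. (\<forall>k. 1 \<le> k \<and> k \<le> q + 3 \<longrightarrow> \<bar>u k - v k\<bar> < e) \<longrightarrow> wronskian q u \<noteq> 0"
proof (rule ccontr)
  assume "\<not> ?thesis"
  then have "\<forall>j. \<exists>u. (\<forall>k. 1 \<le> k \<and> k \<le> q + 3 \<longrightarrow> \<bar>u k - v k\<bar> < inverse (real (Suc j))) \<and> wronskian q u = 0"
    by (metis inverse_positive_iff_positive of_nat_0_less_iff zero_less_Suc)
  then obtain u where u: "\<And>j k. 1 \<le> k \<Longrightarrow> k \<le> q + 3 \<Longrightarrow> \<bar>u j k - v k\<bar> < inverse (real (Suc j))"
    and u0: "\<And>j. wronskian q (u j) = 0" by metis
  have lim: "(\<lambda>j. u j k) \<longlonglongrightarrow> v k" if "1 \<le> k" "k \<le> q + 3" for k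
  proof (rule LIM_zero_cancel, rule tendsto_rabs_zero_cancel, rule tendsto_sandwich[OF _ _ tendsto_const LIMSEQ_inverse_real_of_nat])
    show "\<forall>\<^sub>F j in sequentially. \<bar>u j k - v k\<bar> \<le> inverse (real (Suc j))" using u[OF that] by (auto intro!: always_eventually less_imp_le)
  qed simp
  have "(\<lambda>j. wronskian q (u j)) \<longlonglongrightarrow> wronskian q v"
    unfolding wronskian_def by (intro tendsto_intros lim) auto
  then have "wronskian q v = 0" unfolding u0 by (simp add: LIMSEQ_const_iff)
  then show False using assms by simp
qed

section \<open>Distortion near a point\<close>

text \<open>
  The crude bound: one constant for every single interval inside which the derivative
  does not vanish, and a lower bound for the length of its image.
\<close>

definition uniform_distortion :: "(nat \<Rightarrow> real \<Rightarrow> real) \<Rightarrow> real \<Rightarrow> real \<Rightarrow> nat \<Rightarrow> real \<Rightarrow> real \<Rightarrow> bool" where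
  "uniform_distortion E \<alpha> \<beta> d \<kappa> C \<longleftrightarrow>
     (\<forall>x y. \<alpha> \<le> x \<and> x < y \<and> y \<le> \<beta> \<and> (\<forall>t. x < t \<and> t < y \<longrightarrow> E 1 t \<noteq> 0) \<longrightarrow>
        \<kappa> * (y - x) ^ d \<le> \<bar>E 0 y - E 0 x\<bar> \<and> distortion_le (E 0) (E 1) x y (exp C))"

text \<open>
  The bound that can be multiplied along an orbit: for a family of intervals the logarithms \<open>c\<close> of the
  distortions add up to at most a constant times the multiplicity \<open>n\<close>, no matter how many intervals there
  are.
\<close>

definition distortion_budget :: "(nat \<Rightarrow> real \<Rightarrow> real) \<Rightarrow> real \<Rightarrow> real \<Rightarrow> real \<Rightarrow> bool" where
  "distortion_budget E \<alpha> \<beta> C \<longleftrightarrow>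
     (\<forall>(S :: nat set) X Y n. finite S \<and> overlap_le S X Y n \<and>
        (\<forall>i\<in>S. \<alpha> \<le> X i \<and> X i < Y i \<and> Y i \<le> \<beta> \<and> (\<forall>t. X i < t \<and> t < Y i \<longrightarrow> E 1 t \<noteq> 0)) \<longrightarrow>
        (\<exists>c. (\<forall>i\<in>S. 0 \<le> c i \<and> distortion_le (E 0) (E 1) (X i) (Y i) (exp (c i))) \<and> sum c S \<le> C * real n))"

lemma distortion_budget_mono:
  assumes "distortion_budget E \<alpha> \<beta> C" "C \<le> C'"
  shows "distortion_budget E \<alpha> \<beta> C'"
  unfolding distortion_budget_def
proof (intro allI impI)
  fix S :: "nat set" and X Y n
  assume "finite S \<and> overlap_le S X Y n \<and>
    (\<forall>i\<in>S. \<alpha> \<le> X i \<and> X i < Y i \<and> Y i \<le> \<beta> \<and> (\<forall>t. X i < t \<and> t < Y i \<longrightarrow> E 1 t \<noteq> 0))"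
  then obtain c where c: "\<forall>i\<in>S. 0 \<le> c i \<and> distortion_le (E 0) (E 1) (X i) (Y i) (exp (c i))" "sum c S \<le> C * real n"
    using assms(1) unfolding distortion_budget_def by blast
  have "C * real n \<le> C' * real n" using assms(2) by (intro mult_right_mono) auto
  with c show "\<exists>c. (\<forall>i\<in>S. 0 \<le> c i \<and> distortion_le (E 0) (E 1) (X i) (Y i) (exp (c i))) \<and> sum c S \<le> C' * real n"
    by (intro exI[of _ c]) auto
qed

lemma uniform_distortion_mono:
  assumes "uniform_distortion E \<alpha> \<beta> d \<kappa> C" "C \<le> C'"
  shows "uniform_distortion E \<alpha> \<beta> d \<kappa> C'"
  using assms distortion_le_mono[of _ _ _ _ "exp C" "exp C'"] unfolding uniform_distortion_def by simp

lemma budget_noncritical: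
  assumes j: "jet_on {\<alpha>..\<beta>} E" and len: "\<beta> - \<alpha> \<le> 1" "\<alpha> \<le> \<beta>" and a: "0 < a" and B: "0 \<le> B"
    and E1: "\<And>t. t \<in> {\<alpha>..\<beta>} \<Longrightarrow> a \<le> \<bar>E 1 t\<bar>" and E2: "\<And>t. t \<in> {\<alpha>..\<beta>} \<Longrightarrow> \<bar>E 2 t\<bar> \<le> B"
  shows "distortion_budget E \<alpha> \<beta> (2 * (B / a))"
  unfolding distortion_budget_def
proof (intro allI impI, elim conjE)
  fix S :: "nat set" and X Y n
  assume S: "finite S" "overlap_le S X Y n"
    and I: "\<forall>i\<in>S. \<alpha> \<le> X i \<and> X i < Y i \<and> Y i \<le> \<beta> \<and> (\<forall>t. X i < t \<and> t < Y i \<longrightarrow> E 1 t \<noteq> 0)"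
  define c where "c = (\<lambda>i. 2 * (B / a) * (Y i - X i))"
  have "0 \<le> c i \<and> distortion_le (E 0) (E 1) (X i) (Y i) (exp (c i))" if i: "i \<in> S" for i
  proof
    show "0 \<le> c i" using I i a B by (auto simp: c_def)
    show "distortion_le (E 0) (E 1) (X i) (Y i) (exp (c i))"
      unfolding c_def
    proof (rule log_derivative_distortion)
      show "jet_on {X i..Y i} E" by (rule jet_on_subset[OF j]) (use I i in auto)
      show "0 \<le> B / a" using a B by simp
      fix t assume t: "X i < t" "t < Y i"
      show "E 1 t \<noteq> 0" using I i t by blast
      have tI: "t \<in> {\<alpha>..\<beta>}" using I i t by force
      have "\<bar>E 2 t\<bar> \<le> B / a * a" using E2[OF tI] a by simp
      also have "\<dots> \<le> B / a * \<bar>E 1 t\<bar>" using E1[OF tI] a B by (intro mult_left_mono) auto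
      finally show "\<bar>E 2 t\<bar> \<le> B / a * \<bar>E 1 t\<bar>" .
    qed
  qed
  moreover have "sum c S \<le> 2 * (B / a) * real n"
  proof -
    have "(\<Sum>i\<in>S. Y i - X i) \<le> real n * (\<beta> - \<alpha>)" using I by (intro overlap_length[OF S len(2)]) force
    also have "\<dots> \<le> real n * 1" using len by (intro mult_left_mono) auto
    finally have "2 * (B / a) * (\<Sum>i\<in>S. Y i - X i) \<le> 2 * (B / a) * real n"
      using a B by (intro mult_left_mono) auto
    then show ?thesis by (simp add: c_def sum_distrib_left)
  qed
  ultimately show "\<exists>c. (\<forall>i\<in>S. 0 \<le> c i \<and> distortion_le (E 0) (E 1) (X i) (Y i) (exp (c i))) \<and> sum c S \<le> 2 * (B / a) * real n"
    by blast
qed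

text \<open>
  On an interval free of zeros of \<open>W\<close>, either \<open>|\<phi>|\<close> is log-concave and the distortion is at
  most 1, or it is log-convex and \<open>|\<phi>'|\<close> is at most a constant times \<open>|\<phi>| / (r - l)\<close>.
\<close>

lemma wronskian_component_distortion:
  assumes j: "jet_on {l..r} E" and lr: "l < r"
    and mk: "markov_bound a A (1/4) n C" and C: "C \<ge> 1" and n: "n \<ge> 1"
    and aA: "\<And>t. t \<in> {l..r} \<Longrightarrow> a \<le> \<bar>E (Suc n) t\<bar> \<and> \<bar>E (Suc n) t\<bar> \<le> A"
    and W: "\<And>t. l < t \<Longrightarrow> t < r \<Longrightarrow> wronskian 0 (\<lambda>k. E k t) \<noteq> 0"
    and xy: "l \<le> x" "x < y" "y \<le> r" and nz: "\<And>t. x < t \<Longrightarrow> t < y \<Longrightarrow> E 1 t \<noteq> 0"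
  shows "distortion_le (E 0) (E 1) x y (exp (4 * C\<^sup>2 * (y - x) / (r - l)))"
proof -
  define w where "w = (\<lambda>t. E 1 t * E 3 t - (E 2 t)\<^sup>2)"
  have jxy: "jet_on {x..y} E" by (rule jet_on_subset[OF j]) (use xy in auto)
  have wnz: "w t \<noteq> 0" if "l < t" "t < r" for t using W[OF that] by (simp add: w_def wronskian_0)
  have "continuous_on {l<..<r} w"
    unfolding w_def by (intro continuous_intros continuous_on_subset[OF jet_continuous[OF j]]) auto
  then have same: "0 < w s * w t" if "s \<in> {l<..<r}" "t \<in> {l<..<r}" for s t
    using that by (intro nonzero_same_sign[OF _ wnz]) auto
  define z where "z = (l + r) / 2"
  have z: "z \<in> {l<..<r}" using lr by (auto simp: z_def)
  show ?thesis
  proof (cases "w z < 0")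
    case True
    have "distortion_le (E 0) (E 1) x y 1"
    proof (rule log_concave_distortion[OF jxy nz])
      fix t assume "x < t" "t < y"
      then have "0 < w z * w t" using same[OF z] xy by auto
      then show "E 1 t * E 3 t \<le> (E 2 t)\<^sup>2" using True by (auto simp: zero_less_mult_iff w_def)
    qed
    then show ?thesis
      by (rule distortion_le_mono) (use xy lr in auto)
  next
    case False
    have pos: "0 < w t" if "t \<in> {l<..<r}" for t
      using same[OF z that] False by (auto simp: zero_less_mult_iff)
    have "distortion_le (E 0) (E 1) x y (exp (2 * (2 * C\<^sup>2 / (r - l)) * (y - x)))"
    proof (rule log_derivative_distortion[OF jxy _ nz])
      show "0 \<le> 2 * C\<^sup>2 / (r - l)" using lr by simp
      fix t assume t: "x < t" "t < y"
      have "\<bar>E (Suc 1) t\<bar> * (r - l) \<le> 2 * C\<^sup>2 * \<bar>E (Suc 0) t\<bar>"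
      proof (rule log_convex_derivative_bound[where E = "\<lambda>k. E (Suc k)", OF mk C n jet_on_shift[OF j] aA])
        fix u assume u: "l < u" "u < r"
        \<comment> \<open>\<open>W > 0\<close> excludes zeros of \<open>E 1\<close>\<close>
        then have *: "(E 2 u)\<^sup>2 < E 1 u * E 3 u" using pos[of u] by (simp add: w_def)
        then show "E (Suc 0) u \<noteq> 0" by (auto simp: not_less)
        show "(E (Suc 1) u)\<^sup>2 \<le> E (Suc 0) u * E (Suc 2) u"
          using * by (simp add: numeral_3_eq_3 numeral_2_eq_2)
      qed (use t xy in auto)
      then show "\<bar>E 2 t\<bar> \<le> 2 * C\<^sup>2 / (r - l) * \<bar>E 1 t\<bar>"
        using lr by (simp add: numeral_2_eq_2 field_simps)
    qed
    then show ?thesis by simp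
  qed
qed

text \<open>
  The function \<open>W\<close> has at most \<open>p\<close> zeros. At most \<open>p * n\<close> intervals contain one of them, and each
  of these costs \<open>D\<close>. The others lie in one of at most \<open>p + 1\<close> complementary components, where an
  interval costs at most a constant times its proportion of the component, in total at most a
  constant times \<open>n\<close> per component.
\<close>

lemma budget_critical:
  assumes j: "jet_on {\<alpha>..\<beta>} E" and ab: "\<alpha> < \<beta>"
    and mk: "markov_bound a A (1/4) n C" and C: "C \<ge> 1" and n: "n \<ge> 1"
    and aA: "\<And>t. t \<in> {\<alpha>..\<beta>} \<Longrightarrow> a \<le> \<bar>E (Suc n) t\<bar> \<and> \<bar>E (Suc n) t\<bar> \<le> A"
    and W: "\<And>t. t \<in> {\<alpha>..\<beta>} \<Longrightarrow> wronskian p (\<lambda>k. E k t) \<noteq> 0"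
    and D: "0 \<le> D" "uniform_distortion E \<alpha> \<beta> d \<kappa> D"
  shows "distortion_budget E \<alpha> \<beta> (real p * D + real (p + 2) * (4 * C\<^sup>2))"
  unfolding distortion_budget_def
proof (intro allI impI, elim conjE)
  fix S :: "nat set" and X Y N
  assume S: "finite S" "overlap_le S X Y N"
    and I: "\<forall>i\<in>S. \<alpha> \<le> X i \<and> X i < Y i \<and> Y i \<le> \<beta> \<and> (\<forall>t. X i < t \<and> t < Y i \<longrightarrow> E 1 t \<noteq> 0)"
  define Z where "Z = {t\<in>{\<alpha>..\<beta>}. wronskian 0 (\<lambda>k. E k t) = 0}"
  have Z: "finite Z" "card Z \<le> p"
    using jet_zeros[OF jet_wronskian[OF j], of p] W by (auto simp: Z_def)
  \<comment> \<open>components are indexed by their left endpoint \<open>lo i\<close>, and \<open>nx\<close> gives the right endpoint\<close>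
  define Z' where "Z' = insert \<alpha> (insert \<beta> Z)"
  have Z': "finite Z'" "card Z' \<le> p + 2" using Z card_insert_le_m1 by (auto simp: Z'_def card_insert_if)
  define nx where "nx = (\<lambda>l. Min {z\<in>Z'. l < z})"
  have nx: "nx l \<in> Z'" "l < nx l" "\<And>z. z \<in> Z' \<Longrightarrow> l < z \<Longrightarrow> nx l \<le> z" if "l < \<beta>" for l
  proof -
    have "nx l \<in> {z\<in>Z'. l < z}" unfolding nx_def using Z'(1) that by (intro Min_in) (auto simp: Z'_def)
    then show "nx l \<in> Z'" "l < nx l" by auto
    show "\<And>z. z \<in> Z' \<Longrightarrow> l < z \<Longrightarrow> nx l \<le> z" unfolding nx_def using Z'(1) by (intro Min_le) auto
  qed
  define lo where "lo = (\<lambda>i. Max {z\<in>Z'. z \<le> X i})"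
  have lo: "lo i \<in> Z'" "lo i \<le> X i" "\<And>z. z \<in> Z' \<Longrightarrow> z \<le> X i \<Longrightarrow> z \<le> lo i" if "i \<in> S" for i
  proof -
    have "lo i \<in> {z\<in>Z'. z \<le> X i}" unfolding lo_def using Z'(1) that I by (intro Max_in) (auto simp: Z'_def)
    then show "lo i \<in> Z'" "lo i \<le> X i" by auto
    show "\<And>z. z \<in> Z' \<Longrightarrow> z \<le> X i \<Longrightarrow> z \<le> lo i" unfolding lo_def using Z'(1) by (intro Max_ge) auto
  qed
  have ZI: "Z' \<subseteq> {\<alpha>..\<beta>}" using ab by (auto simp: Z'_def Z_def)
  define S1 where "S1 = {i\<in>S. \<exists>z\<in>Z. X i < z \<and> z < Y i}"
  have comp: "Y i \<le> nx (lo i)" "lo i < \<beta>" if i: "i \<in> S - S1" for i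
  proof -
    show lb: "lo i < \<beta>" using lo(2)[of i] I i by force
    show "Y i \<le> nx (lo i)"
    proof (rule ccontr)
      assume "\<not> Y i \<le> nx (lo i)"
      then have 1: "nx (lo i) < Y i" by simp
      have 2: "X i < nx (lo i)"
        using lo(3)[of i "nx (lo i)"] nx(1,2)[OF lb] i by force
      have "nx (lo i) \<in> Z" using nx(1)[OF lb] 1 2 I i by (force simp: Z'_def)
      then show False using 1 2 i by (auto simp: S1_def)
    qed
  qed
  define c where "c = (\<lambda>i. if i \<in> S1 then D else 4 * C\<^sup>2 * (Y i - X i) / (nx (lo i) - lo i))"
  have "0 \<le> c i \<and> distortion_le (E 0) (E 1) (X i) (Y i) (exp (c i))" if i: "i \<in> S" for i
  proof (cases "i \<in> S1")
    case True
    then show ?thesis using D I i by (simp add: c_def uniform_distortion_def)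
  next
    case False
    then have lb: "lo i < \<beta>" "Y i \<le> nx (lo i)" using comp i by auto
    note nxl = nx[OF lb(1)]
    have sub: "{lo i..nx (lo i)} \<subseteq> {\<alpha>..\<beta>}" using lo(1)[OF i] nxl(1) ZI by auto
    have "distortion_le (E 0) (E 1) (X i) (Y i) (exp (4 * C\<^sup>2 * (Y i - X i) / (nx (lo i) - lo i)))"
    proof (rule wronskian_component_distortion[OF jet_on_subset[OF j sub] nxl(2) mk C n])
      fix t assume t: "lo i < t" "t < nx (lo i)"
      then have "t \<notin> Z" using nxl(3)[of t] by (auto simp: Z'_def)
      then show "wronskian 0 (\<lambda>k. E k t) \<noteq> 0" using t sub by (auto simp: Z_def)
    qed (use aA sub I i lb lo(2)[OF i] in auto)
    moreover have "0 \<le> c i" using False nxl(2) I i by (simp add: c_def less_imp_le)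
    ultimately show ?thesis using False by (simp add: c_def)
  qed
  moreover have "sum c S \<le> (real p * D + real (p + 2) * (4 * C\<^sup>2)) * real N"
  proof -
    have S1: "S1 \<subseteq> S" "finite S1" using S by (auto simp: S1_def)
    have "S1 \<subseteq> (\<Union>z\<in>Z. {i\<in>S. X i < z \<and> z < Y i})" by (auto simp: S1_def)
    then have "card S1 \<le> card (\<Union>z\<in>Z. {i\<in>S. X i < z \<and> z < Y i})" using Z S by (intro card_mono) auto
    also have "\<dots> \<le> (\<Sum>z\<in>Z. card {i\<in>S. X i < z \<and> z < Y i})" using Z by (intro card_UN_le)
    also have "\<dots> \<le> (\<Sum>z\<in>Z. N)" using S by (intro sum_mono) (simp add: overlap_le_def)
    also have "\<dots> \<le> p * N" using Z by simp
    finally have "card S1 \<le> p * N" .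
    then have "real (card S1) * D \<le> real (p * N) * D" using D by (intro mult_right_mono of_nat_mono) auto
    moreover have "sum c S1 = real (card S1) * D" by (simp add: c_def)
    ultimately have A: "sum c S1 \<le> real p * D * real N" by (simp add: mult_ac)
    have fib: "sum c {i\<in>S - S1. lo i = l} \<le> 4 * C\<^sup>2 * real N" if l: "l \<in> Z'" for l
    proof (cases "{i\<in>S - S1. lo i = l} = {}")
      case False
      then have lb: "l < \<beta>" using comp by auto
      have "(\<Sum>i\<in>{i\<in>S - S1. lo i = l}. Y i - X i) \<le> real N * (nx l - l)"
        using S nx(2)[OF lb] I lo comp
        by (intro overlap_length overlap_le_subset[OF S]) (auto intro: less_imp_le)
      then have "4 * C\<^sup>2 / (nx l - l) * (\<Sum>i\<in>{i\<in>S - S1. lo i = l}. Y i - X i) \<le> 4 * C\<^sup>2 / (nx l - l) * (real N * (nx l - l))"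
        using nx(2)[OF lb] by (intro mult_left_mono) auto
      also have "\<dots> = 4 * C\<^sup>2 * real N" using nx(2)[OF lb] by simp
      also have "4 * C\<^sup>2 / (nx l - l) * (\<Sum>i\<in>{i\<in>S - S1. lo i = l}. Y i - X i) = sum c {i\<in>S - S1. lo i = l}"
        unfolding sum_distrib_left by (intro sum.cong refl) (auto simp: c_def)
      finally show ?thesis .
    next
      case True
      then show ?thesis by (simp only: sum.empty) simp
    qed
    have "sum c (S - S1) = (\<Sum>l\<in>Z'. sum c {i\<in>S - S1. lo i = l})"
      using S Z' lo(1) by (intro sum.group[symmetric]) auto
    also have "\<dots> \<le> (\<Sum>l\<in>Z'. 4 * C\<^sup>2 * real N)" using fib by (intro sum_mono) auto
    also have "\<dots> = real (card Z') * (4 * C\<^sup>2 * real N)" by simp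
    also have "\<dots> \<le> real (p + 2) * (4 * C\<^sup>2 * real N)" using Z'(2) by (intro mult_right_mono) auto
    finally have "sum c (S - S1) \<le> real (p + 2) * (4 * C\<^sup>2 * real N)" .
    moreover have "sum c S = sum c (S - S1) + sum c S1" using S1 S by (intro sum.subset_diff) auto
    ultimately show ?thesis using A by (simp add: algebra_simps)
  qed
  ultimately show "\<exists>c. (\<forall>i\<in>S. 0 \<le> c i \<and> distortion_le (E 0) (E 1) (X i) (Y i) (exp (c i))) \<and>
       sum c S \<le> (real p * D + real (p + 2) * (4 * C\<^sup>2)) * real N"
    by blast
qed

text \<open>
  Here \<open>v\<close> is the jet of \<open>f\<close> at a point, and \<open>d\<close> is the order of its first nonvanishing
  derivative. All constants depend on \<open>v\<close> only, and only the derivatives up to order \<open>r\<close> of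
  \<open>E\<close> have to be near those of \<open>v\<close>: this is what makes the estimate uniform both near the
  point and near the map.
\<close>

lemma local_distortion:
  fixes v :: "nat \<Rightarrow> real"
  assumes d: "d \<ge> 1" "v d \<noteq> 0" "\<And>k. 1 \<le> k \<Longrightarrow> k < d \<Longrightarrow> v k = 0"
  shows "\<exists>e r C \<kappa>. 0 < e \<and> 0 \<le> C \<and> 0 < \<kappa> \<and>
    (\<forall>\<alpha> \<beta> E. \<alpha> < \<beta> \<and> \<beta> - \<alpha> \<le> 1 \<and> jet_on {\<alpha>..\<beta>} E \<and>
        (\<forall>t\<in>{\<alpha>..\<beta>}. \<forall>k. 1 \<le> k \<and> k \<le> r \<longrightarrow> \<bar>E k t - v k\<bar> < e) \<longrightarrow>
      uniform_distortion E \<alpha> \<beta> d \<kappa> C \<and> distortion_budget E \<alpha> \<beta> C)"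
proof -
  define a A where "a = \<bar>v d\<bar> / 2" and "A = 2 * \<bar>v d\<bar>"
  have a: "0 < a" using d by (simp add: a_def)
  obtain C1 where C1: "C1 \<ge> 1" "markov_bound a A 1 d C1" using markov_bound_exists[of a 1 A d] a by auto
  define C where "C = 2 * ln C1"
  have C: "0 \<le> C" "exp C = C1\<^sup>2" using C1 by (auto simp: C_def exp_double)
  define \<kappa> where "\<kappa> = a / C1"
  have \<kappa>: "0 < \<kappa>" using a C1 by (simp add: \<kappa>_def)
  have close: "a \<le> \<bar>z\<bar> \<and> \<bar>z\<bar> \<le> A" if "\<bar>z - v d\<bar> < a" for z
    using that by (auto simp: a_def A_def abs_if split: if_splits)
  have unif: "uniform_distortion E \<alpha> \<beta> d \<kappa> C"
    if j: "jet_on {\<alpha>..\<beta>} E" and E: "\<And>t. t \<in> {\<alpha>..\<beta>} \<Longrightarrow> \<bar>E d t - v d\<bar> < a" for E \<alpha> \<beta>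
    unfolding uniform_distortion_def
  proof (intro allI impI, elim conjE)
    fix x y assume *: "\<alpha> \<le> x" "x < y" "y \<le> \<beta>" and nz: "\<forall>t. x < t \<and> t < y \<longrightarrow> E 1 t \<noteq> 0"
    have jxy: "jet_on {x..y} E" by (rule jet_on_subset[OF j]) (use * in auto)
    show "\<kappa> * (y - x) ^ d \<le> \<bar>E 0 y - E 0 x\<bar> \<and> distortion_le (E 0) (E 1) x y (exp C)"
      unfolding \<kappa>_def C(2)
      using markov_distortion[OF C1(2,1) d(1) jxy, OF _ _ *(2)] close E nz * by auto
  qed
  show ?thesis
  \<comment> \<open>at a regular point \<open>ln |E 1|\<close> is Lipschitz; the case \<open>d \<ge> 2\<close> includes the turning points \<open>d = 2\<close>, where \<open>W < 0\<close>\<close>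
  proof (cases "d = 1")
    case True
    define B where "B = \<bar>v 2\<bar> + a"
    define C' where "C' = max C (2 * (B / a))"
    show ?thesis
    proof (rule exI[of _ a], rule exI[of _ 2], rule exI[of _ C'], rule exI[of _ \<kappa>], intro conjI allI impI)
      show "0 < a" "0 < \<kappa>" by fact+
      show "0 \<le> C'" using C by (simp add: C'_def)
      fix \<alpha> \<beta> E
      assume *: "\<alpha> < \<beta> \<and> \<beta> - \<alpha> \<le> 1 \<and> jet_on {\<alpha>..\<beta>} E \<and>
        (\<forall>t\<in>{\<alpha>..\<beta>}. \<forall>k. 1 \<le> k \<and> k \<le> 2 \<longrightarrow> \<bar>E k t - v k\<bar> < a)"
      have "uniform_distortion E \<alpha> \<beta> d \<kappa> C" using * True by (intro unif) auto
      then show "uniform_distortion E \<alpha> \<beta> d \<kappa> C'" by (rule uniform_distortion_mono) (simp add: C'_def)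
      have "distortion_budget E \<alpha> \<beta> (2 * (B / a))"
      proof (rule budget_noncritical)
        show "0 \<le> B" using a by (simp add: B_def)
        fix t assume t: "t \<in> {\<alpha>..\<beta>}"
        have e: "\<bar>E 1 t - v 1\<bar> < a" "\<bar>E 2 t - v 2\<bar> < a" using * t by auto
        show "a \<le> \<bar>E 1 t\<bar>" using close e True by simp
        show "\<bar>E 2 t\<bar> \<le> B" unfolding B_def using e(2) by linarith
      qed (use * a in auto)
      then show "distortion_budget E \<alpha> \<beta> C'" by (rule distortion_budget_mono) (simp add: C'_def)
    qed
  next
    case False
    then have d2: "d \<ge> 2" using d by simp
    define p n where "p = 2 * (d - 2)" and "n = d - 1"
    have n: "n \<ge> 1" "Suc n = d" using d2 by (auto simp: n_def)
    obtain C2 where C2: "C2 \<ge> 1" "markov_bound a A (1/4) n C2" using markov_bound_exists[of a "1/4" A n] a by auto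
    have "wronskian p v \<noteq> 0" using wronskian_nonzero[of d v] d2 d by (simp add: p_def)
    then obtain e1 where e1: "e1 > 0" "\<And>u. (\<And>k. 1 \<le> k \<Longrightarrow> k \<le> p + 3 \<Longrightarrow> \<bar>u k - v k\<bar> < e1) \<Longrightarrow> wronskian p u \<noteq> 0"
      using wronskian_continuous by metis
    define e where "e = min a e1"
    define r where "r = p + 3 + d"
    define C' where "C' = max C (real p * C + real (p + 2) * (4 * C2\<^sup>2))"
    show ?thesis
    proof (rule exI[of _ e], rule exI[of _ r], rule exI[of _ C'], rule exI[of _ \<kappa>], intro conjI allI impI)
      show "0 < e" "0 < \<kappa>" using a e1 \<kappa> by (auto simp: e_def)
      show "0 \<le> C'" using C by (simp add: C'_def)
      fix \<alpha> \<beta> E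
      assume *: "\<alpha> < \<beta> \<and> \<beta> - \<alpha> \<le> 1 \<and> jet_on {\<alpha>..\<beta>} E \<and>
        (\<forall>t\<in>{\<alpha>..\<beta>}. \<forall>k. 1 \<le> k \<and> k \<le> r \<longrightarrow> \<bar>E k t - v k\<bar> < e)"
      have Ed: "\<bar>E d t - v d\<bar> < a" if "t \<in> {\<alpha>..\<beta>}" for t using * that d by (auto simp: e_def r_def)
      have U: "uniform_distortion E \<alpha> \<beta> d \<kappa> C" using * Ed by (intro unif) auto
      then show "uniform_distortion E \<alpha> \<beta> d \<kappa> C'" by (rule uniform_distortion_mono) (simp add: C'_def)
      have "distortion_budget E \<alpha> \<beta> (real p * C + real (p + 2) * (4 * C2\<^sup>2))"
      proof (rule budget_critical[OF _ _ C2(2,1) n(1) _ _ C(1) U])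
        fix t assume t: "t \<in> {\<alpha>..\<beta>}"
        show "a \<le> \<bar>E (Suc n) t\<bar> \<and> \<bar>E (Suc n) t\<bar> \<le> A" unfolding n(2) using close Ed t by blast
        show "wronskian p (\<lambda>k. E k t) \<noteq> 0" using * t by (intro e1(2)) (auto simp: e_def r_def)
      qed (use * in auto)
      then show "distortion_budget E \<alpha> \<beta> C'" by (rule distortion_budget_mono) (simp add: C'_def)
    qed
  qed
qed

section \<open>Distortion on a compact interval\<close>

text \<open>
  Continuity of finitely many derivatives spreads the local estimate to a neighbourhood of \<open>t\<close>.
\<close>

lemma chart_distortion:
  assumes j: "jet_on {A..B} D" and AB: "A < B" and t: "t \<in> {A..B}" and nz: "\<exists>d\<ge>1. D d t \<noteq> 0"
  shows "\<exists>d \<rho> r e C \<kappa>. 0 < \<rho> \<and> 0 < e \<and> 0 \<le> C \<and> 0 < \<kappa> \<and>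
    (\<forall>E. jet_on {A..B} E \<and> (\<forall>s\<in>{A..B}. \<forall>k. 1 \<le> k \<and> k \<le> r \<longrightarrow> \<bar>E k s - D k s\<bar> < e) \<longrightarrow>
      uniform_distortion E (max A (t - \<rho>)) (min B (t + \<rho>)) d \<kappa> C \<and>
      distortion_budget E (max A (t - \<rho>)) (min B (t + \<rho>)) C)"
proof -
  define d where "d = (LEAST d. d \<ge> 1 \<and> D d t \<noteq> 0)"
  have d: "d \<ge> 1" "D d t \<noteq> 0"
    using LeastI_ex[of "\<lambda>d. d \<ge> 1 \<and> D d t \<noteq> 0"] nz by (auto simp: d_def)
  have dl: "D k t = 0" if "1 \<le> k" "k < d" for k
    using not_less_Least[of k "\<lambda>d. d \<ge> 1 \<and> D d t \<noteq> 0"] that by (auto simp: d_def)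
  have "\<exists>e r C \<kappa>. 0 < e \<and> 0 \<le> C \<and> 0 < \<kappa> \<and> (\<forall>\<alpha> \<beta> E. \<alpha> < \<beta> \<and> \<beta> - \<alpha> \<le> 1 \<and> jet_on {\<alpha>..\<beta>} E \<and>
        (\<forall>s\<in>{\<alpha>..\<beta>}. \<forall>k. 1 \<le> k \<and> k \<le> r \<longrightarrow> \<bar>E k s - D k t\<bar> < e) \<longrightarrow>
      uniform_distortion E \<alpha> \<beta> d \<kappa> C \<and> distortion_budget E \<alpha> \<beta> C)"
    by (rule local_distortion[of d "\<lambda>k. D k t", OF d]) (rule dl)
  then obtain e r C \<kappa> where loc: "0 < e" "0 \<le> C" "0 < \<kappa>" "(\<forall>\<alpha> \<beta> E. \<alpha> < \<beta> \<and> \<beta> - \<alpha> \<le> 1 \<and> jet_on {\<alpha>..\<beta>} E \<and>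
        (\<forall>s\<in>{\<alpha>..\<beta>}. \<forall>k. 1 \<le> k \<and> k \<le> r \<longrightarrow> \<bar>E k s - D k t\<bar> < e) \<longrightarrow>
      uniform_distortion E \<alpha> \<beta> d \<kappa> C \<and> distortion_budget E \<alpha> \<beta> C)"
    by (elim exE conjE) (rule that)
  have "eventually (\<lambda>s. \<forall>k\<in>{..r}. \<bar>D k s - D k t\<bar> < e / 2) (at t within {A..B})"
  proof (rule eventually_ball_finite)
    show "\<forall>k\<in>{..r}. eventually (\<lambda>s. \<bar>D k s - D k t\<bar> < e / 2) (at t within {A..B})"
    proof
      fix k
      have "(D k \<longlongrightarrow> D k t) (at t within {A..B})"
        using jet_continuous[OF j, of k] t by (auto simp: continuous_on_def)
      from tendstoD[OF this, of "e / 2"] show "eventually (\<lambda>s. \<bar>D k s - D k t\<bar> < e / 2) (at t within {A..B})"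
        using loc(1) by (simp add: dist_real_def)
    qed
  qed simp
  then obtain \<delta> where \<delta>: "\<delta> > 0" "\<And>s. s \<in> {A..B} \<Longrightarrow> s \<noteq> t \<Longrightarrow> \<bar>s - t\<bar> < \<delta> \<Longrightarrow> \<forall>k\<in>{..r}. \<bar>D k s - D k t\<bar> < e / 2"
    unfolding eventually_at dist_real_def by blast
  define \<rho> where "\<rho> = min (1/2) (\<delta> / 2)"
  have \<rho>: "0 < \<rho>" "\<rho> \<le> 1/2" "\<rho> < \<delta>" using \<delta>(1) by (auto simp: \<rho>_def)
  have "uniform_distortion E (max A (t - \<rho>)) (min B (t + \<rho>)) d \<kappa> C \<and> distortion_budget E (max A (t - \<rho>)) (min B (t + \<rho>)) C"
    if E: "jet_on {A..B} E" "\<forall>s\<in>{A..B}. \<forall>k. 1 \<le> k \<and> k \<le> r \<longrightarrow> \<bar>E k s - D k s\<bar> < e / 2" for E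
  proof (rule loc(4)[rule_format], intro conjI ballI allI impI; (elim conjE)?)
    show "max A (t - \<rho>) < min B (t + \<rho>)" "min B (t + \<rho>) - max A (t - \<rho>) \<le> 1" using t \<rho> AB by auto
    show "jet_on {max A (t - \<rho>)..min B (t + \<rho>)} E" by (rule jet_on_subset[OF E(1)]) auto
    fix s k assume s: "s \<in> {max A (t - \<rho>)..min B (t + \<rho>)}" and k: "1 \<le> k" "k \<le> r"
    have "\<bar>D k s - D k t\<bar> < e / 2"
    proof (cases "s = t")
      case False
      have "\<bar>s - t\<bar> < \<delta>" using s \<rho> by (auto simp: abs_if)
      then show ?thesis using \<delta>(2)[of s] False s k by auto
    qed (use loc(1) in simp)
    moreover have "\<bar>E k s - D k s\<bar> < e / 2" using E(2) s k by auto
    ultimately show "\<bar>E k s - D k t\<bar> < e" by linarith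
  qed
  then show ?thesis
    using \<rho>(1) loc(1-3)
    by - (rule exI[of _ d], rule exI[of _ \<rho>], rule exI[of _ r], rule exI[of _ "e / 2"], rule exI[of _ C], rule exI[of _ \<kappa>], simp)
qed

text \<open>
  Compactness: finitely many charts cover \<open>[A, B]\<close>, and intervals shorter than a number \<open>\<eta>\<close> lie in
  one of them. An interval longer than \<open>\<eta>\<close> has bounded distortion, because the increment of the map
  over length \<open>\<eta> / 2\<close> is bounded below; there are few such intervals, which is expressed by
  charging \<open>M * (Y i - X i) / \<eta>\<close> for each.
\<close>

lemma uniform_distortion_budget:
  assumes j: "jet_on {A..B} D" and AB: "A < B" and nz: "\<And>t. t \<in> {A..B} \<Longrightarrow> \<exists>d\<ge>1. D d t \<noteq> 0"
  shows "\<exists>r e C. 0 < e \<and>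
    (\<forall>E. jet_on {A..B} E \<and> (\<forall>s\<in>{A..B}. \<forall>k. 1 \<le> k \<and> k \<le> r \<longrightarrow> \<bar>E k s - D k s\<bar> < e) \<longrightarrow>
      distortion_budget E A B C)"
proof -
  define chart where "chart = (\<lambda>t d \<rho> r e C \<kappa>. 0 < \<rho> \<and> 0 < e \<and> 0 \<le> C \<and> 0 < \<kappa> \<and>
    (\<forall>E. jet_on {A..B} E \<and> (\<forall>s\<in>{A..B}. \<forall>k. 1 \<le> k \<and> k \<le> r \<longrightarrow> \<bar>E k s - D k s\<bar> < e) \<longrightarrow>
      uniform_distortion E (max A (t - \<rho>)) (min B (t + \<rho>)) d \<kappa> C \<and>
      distortion_budget E (max A (t - \<rho>)) (min B (t + \<rho>)) C))"
  have "\<forall>t\<in>{A..B}. \<exists>d \<rho> r e C \<kappa>. chart t d \<rho> r e C \<kappa>"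
    unfolding chart_def using chart_distortion[OF j AB _ nz] by blast
  then obtain d \<rho> r e C \<kappa> where ch: "\<And>t. t \<in> {A..B} \<Longrightarrow> chart t (d t) (\<rho> t) (r t) (e t) (C t) (\<kappa> t)"
    by metis
  have pos: "0 < \<rho> t" "0 < e t" "0 \<le> C t" "0 < \<kappa> t" if "t \<in> {A..B}" for t
    using ch[OF that] by (auto simp: chart_def)
  obtain F where F: "F \<subseteq> {A..B}" "finite F" and cover: "{A..B} \<subseteq> (\<Union>t\<in>F. ball t (\<rho> t / 2))"
  proof (rule compactE_image[of "{A..B}" "{A..B}" "\<lambda>t. ball t (\<rho> t / 2)"])
    show "{A..B} \<subseteq> (\<Union>t\<in>{A..B}. ball t (\<rho> t / 2))" using pos(1) by force
  qed auto
  have F0: "F \<noteq> {}" using cover AB by force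
  have posF: "0 < \<rho> t" "0 < e t" "0 \<le> C t" "0 < \<kappa> t" if "t \<in> F" for t using pos[of t] F that by auto
  define \<eta> where "\<eta> = Min (\<rho> ` F) / 2"
  have \<eta>: "0 < \<eta>" "\<And>t. t \<in> F \<Longrightarrow> \<eta> \<le> \<rho> t / 2" using F F0 posF by (auto simp: \<eta>_def)
  define R where "R = max 1 (Max (r ` F))"
  have R: "1 \<le> R" "\<And>t. t \<in> F \<Longrightarrow> r t \<le> R" using F by (auto simp: R_def max.coboundedI2)
  define e0 where "e0 = Min (e ` F)"
  have e0: "0 < e0" "\<And>t. t \<in> F \<Longrightarrow> e0 \<le> e t" using F F0 posF by (auto simp: e0_def)
  \<comment> \<open>lower bound for the increment over length \<open>\<eta> / 2\<close>\<close>
  define m0 where "m0 = Min ((\<lambda>t. \<kappa> t * (\<eta> / 2) ^ d t) ` F)"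
  have m0: "0 < m0" "\<And>t. t \<in> F \<Longrightarrow> m0 \<le> \<kappa> t * (\<eta> / 2) ^ d t" using F F0 posF \<eta>(1) by (auto simp: m0_def)
  have "\<forall>x\<in>{A..B}. \<exists>t\<in>F. x \<in> ball t (\<rho> t / 2)" using cover by blast
  then obtain ix where ix: "\<And>x. x \<in> {A..B} \<Longrightarrow> ix x \<in> F \<and> x \<in> ball (ix x) (\<rho> (ix x) / 2)" by metis
  have inside: "max A (ix x - \<rho> (ix x)) \<le> x" "y \<le> min B (ix x + \<rho> (ix x))" if "A \<le> x" "x \<le> y" "y \<le> B" "y - x \<le> \<eta>" for x y
    using ix[of x] \<eta>(2)[of "ix x"] that by (auto simp: dist_real_def abs_if split: if_splits)
  have "compact (D 1 ` {A..B})" using jet_continuous[OF j, of 1] by (intro compact_continuous_image) auto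
  then obtain K0 where K0: "\<And>t. t \<in> {A..B} \<Longrightarrow> \<bar>D 1 t\<bar> \<le> K0"
    using compact_imp_bounded[of "D 1 ` {A..B}"] unfolding bounded_iff
    by (metis imageI real_norm_def)
  define CS where "CS = sum C F"
  have CS: "0 \<le> CS" "\<And>t. t \<in> F \<Longrightarrow> C t \<le> CS"
    unfolding CS_def using F posF by (auto intro!: sum_nonneg member_le_sum)
  define Q where "Q = ((K0 + e0) * (B - A) / m0)\<^sup>2 + 1"
  have Q: "1 \<le> Q" by (simp add: Q_def)
  define M where "M = CS + ln Q"
  have M: "0 \<le> M" "CS \<le> M" "Q \<le> exp M" using CS Q by (auto simp: M_def exp_add)
  have "distortion_budget E A B (CS + M * (B - A) / \<eta>)"
    if E: "jet_on {A..B} E" and Ec: "\<forall>s\<in>{A..B}. \<forall>k. 1 \<le> k \<and> k \<le> R \<longrightarrow> \<bar>E k s - D k s\<bar> < e0" for E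
  proof -
    have chE: "uniform_distortion E (max A (t - \<rho> t)) (min B (t + \<rho> t)) (d t) (\<kappa> t) (C t) \<and>
      distortion_budget E (max A (t - \<rho> t)) (min B (t + \<rho> t)) (C t)" if t: "t \<in> F" for t
    proof -
      have "\<forall>s\<in>{A..B}. \<forall>k. 1 \<le> k \<and> k \<le> r t \<longrightarrow> \<bar>E k s - D k s\<bar> < e t"
        using Ec R(2)[OF t] e0(2)[OF t] by force
      then show ?thesis using ch[of t] t F E by (auto simp: chart_def)
    qed
    have small: "\<kappa> (ix x) * (y - x) ^ d (ix x) \<le> \<bar>E 0 y - E 0 x\<bar>" "distortion_le (E 0) (E 1) x y (exp M)"
      if xy: "A \<le> x" "x < y" "y \<le> B" "y - x \<le> \<eta>" and nzE: "\<And>t. x < t \<Longrightarrow> t < y \<Longrightarrow> E 1 t \<noteq> 0" for x y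
    proof -
      have ixF: "ix x \<in> F" using ix[of x] xy by auto
      have "\<kappa> (ix x) * (y - x) ^ d (ix x) \<le> \<bar>E 0 y - E 0 x\<bar> \<and> distortion_le (E 0) (E 1) x y (exp (C (ix x)))"
        using chE[OF ixF] inside[of x y] xy nzE unfolding uniform_distortion_def by auto
      moreover have "exp (C (ix x)) \<le> exp M" using CS(2)[OF ixF] M(2) by simp
      ultimately show "\<kappa> (ix x) * (y - x) ^ d (ix x) \<le> \<bar>E 0 y - E 0 x\<bar>" "distortion_le (E 0) (E 1) x y (exp M)"
        using distortion_le_mono by blast+
    qed
    have all: "distortion_le (E 0) (E 1) x y (exp M)"
      if xy: "A \<le> x" "y \<le> B" and nzE: "\<And>t. x < t \<Longrightarrow> t < y \<Longrightarrow> E 1 t \<noteq> 0" for x y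
      unfolding distortion_le_def
    proof (intro allI impI, elim conjE)
      fix s t assume st: "x < s" "s < t" "t < y"
      show "E 1 s * E 1 t * (t - s)\<^sup>2 \<le> exp M * (E 0 t - E 0 s)\<^sup>2"
      proof (cases "t - s \<le> \<eta> / 2")
        case True
        \<comment> \<open>the distortion bound concerns open intervals, so \<open>[s, t]\<close> is enlarged a little\<close>
        define \<delta> where "\<delta> = min (\<eta> / 4) (min ((s - x) / 2) ((y - t) / 2))"
        have \<delta>: "0 < \<delta>" "\<delta> \<le> \<eta> / 4" "\<delta> \<le> (s - x) / 2" "\<delta> \<le> (y - t) / 2"
          unfolding \<delta>_def using st \<eta>(1)
          by (simp_all only: min.coboundedI1 min.coboundedI2 min.cobounded1 min_less_iff_conj order_refl) auto
        have \<delta>': "x < s - \<delta>" "t + \<delta> < y" using \<delta> st by (auto simp: field_simps)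
        have "distortion_le (E 0) (E 1) (s - \<delta>) (t + \<delta>) (exp M)"
          by (rule small(2)) (use True \<delta> \<delta>' st xy nzE in auto)
        then show ?thesis using \<delta>(1) st by (intro distortion_leD[of _ _ "s - \<delta>" "t + \<delta>"]) auto
      next
        case False
        have sI: "s \<in> {A..B}" "t \<in> {A..B}" using st xy by auto
        have "m0 \<le> \<kappa> (ix s) * (\<eta> / 2) ^ d (ix s)" using m0(2) ix[OF sI(1)] by blast
        also have "\<dots> \<le> \<bar>E 0 (s + \<eta> / 2) - E 0 s\<bar>"
          using small(1)[of s "s + \<eta> / 2"] False \<eta>(1) st xy nzE by auto
        also have "\<dots> \<le> \<bar>E 0 t - E 0 s\<bar>"
          by (rule jet_monotone_bound[OF jet_on_subset[OF E]]) (use False \<eta>(1) st xy nzE in auto)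
        finally have m: "m0 \<le> \<bar>E 0 t - E 0 s\<bar>" .
        have E1: "\<bar>E 1 u\<bar> \<le> K0 + e0" if "u \<in> {A..B}" for u
        proof -
          have "\<bar>E 1 u - D 1 u\<bar> < e0" using Ec that R(1) by auto
          then show ?thesis using K0[OF that] by linarith
        qed
        have K: "0 \<le> K0 + e0" using E1[OF sI(1)] by linarith
        have "E 1 s * E 1 t * (t - s)\<^sup>2 \<le> \<bar>E 1 s\<bar> * \<bar>E 1 t\<bar> * (t - s)\<^sup>2"
          by (intro mult_right_mono) (auto simp flip: abs_mult)
        also have "\<dots> \<le> (K0 + e0) * (K0 + e0) * (B - A)\<^sup>2"
          using E1[OF sI(1)] E1[OF sI(2)] st xy K by (intro mult_mono power_mono) auto
        also have "\<dots> = ((K0 + e0) * (B - A) / m0)\<^sup>2 * m0\<^sup>2"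
          using m0(1) by (simp add: power2_eq_square)
        also have "\<dots> \<le> Q * m0\<^sup>2" by (intro mult_right_mono) (auto simp: Q_def)
        also have "\<dots> \<le> exp M * \<bar>E 0 t - E 0 s\<bar>\<^sup>2" using M m m0(1) by (intro mult_mono power_mono) auto
        finally show ?thesis by simp
      qed
    qed
    show ?thesis
      unfolding distortion_budget_def
    proof (intro allI impI, elim conjE)
      fix S :: "nat set" and X Y n
      assume S: "finite S" "overlap_le S X Y n"
        and I: "\<forall>i\<in>S. A \<le> X i \<and> X i < Y i \<and> Y i \<le> B \<and> (\<forall>t. X i < t \<and> t < Y i \<longrightarrow> E 1 t \<noteq> 0)"
      define Sm where "Sm = {i\<in>S. Y i - X i \<le> \<eta>}"
      define St where "St = (\<lambda>t. {i\<in>Sm. ix (X i) = t})"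
      have "\<exists>c. (\<forall>i\<in>St t. 0 \<le> c i \<and> distortion_le (E 0) (E 1) (X i) (Y i) (exp (c i))) \<and> sum c (St t) \<le> C t * real n" if t: "t \<in> F" for t
      proof -
        have sub: "St t \<subseteq> S" by (auto simp: St_def Sm_def)
        have "finite (St t)" "overlap_le (St t) X Y n" using sub S by (auto intro: finite_subset overlap_le_subset)
        moreover have "max A (t - \<rho> t) \<le> X i \<and> X i < Y i \<and> Y i \<le> min B (t + \<rho> t) \<and> (\<forall>u. X i < u \<and> u < Y i \<longrightarrow> E 1 u \<noteq> 0)"
          if i: "i \<in> St t" for i
        proof -
          have "A \<le> X i" "X i < Y i" "Y i \<le> B" "Y i - X i \<le> \<eta>" "ix (X i) = t"
            using i I by (auto simp: St_def Sm_def)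
          then show ?thesis using inside[of "X i" "Y i"] i I sub by auto
        qed
        ultimately show ?thesis using chE[OF t] unfolding distortion_budget_def by blast
      qed
      then obtain c where c: "\<And>t i. t \<in> F \<Longrightarrow> i \<in> St t \<Longrightarrow> 0 \<le> c t i \<and> distortion_le (E 0) (E 1) (X i) (Y i) (exp (c t i))"
        "\<And>t. t \<in> F \<Longrightarrow> sum (c t) (St t) \<le> C t * real n" by metis
      define b where "b = (\<lambda>i. if i \<in> Sm then c (ix (X i)) i else M * (Y i - X i) / \<eta>)"
      have ixF: "ix (X i) \<in> F" if "i \<in> S" for i using ix[of "X i"] I that by auto
      have "0 \<le> b i \<and> distortion_le (E 0) (E 1) (X i) (Y i) (exp (b i))" if i: "i \<in> S" for i
      proof (cases "i \<in> Sm")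
        case True
        then show ?thesis using c(1)[OF ixF[OF i], of i] by (auto simp: b_def St_def)
      next
        case False
        then have "\<eta> \<le> Y i - X i" using i by (auto simp: Sm_def)
        then have "M * \<eta> \<le> M * (Y i - X i)" using M(1) by (intro mult_left_mono)
        then have "M \<le> M * (Y i - X i) / \<eta>" using \<eta>(1) by (simp add: pos_le_divide_eq)
        then have "M \<le> b i" using False by (simp add: b_def)
        moreover have "distortion_le (E 0) (E 1) (X i) (Y i) (exp M)" by (rule all) (use I i in auto)
        ultimately show ?thesis using M(1) distortion_le_mono[of _ _ _ _ "exp M" "exp (b i)"] by auto
      qed
      moreover have "sum b S \<le> (CS + M * (B - A) / \<eta>) * real n"
      proof -
        have Sm: "Sm \<subseteq> S" "finite Sm" using S by (auto simp: Sm_def)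
        have "sum b Sm = (\<Sum>t\<in>F. sum b {i\<in>Sm. ix (X i) = t})"
          using Sm F ixF by (intro sum.group[symmetric]) auto
        also have "\<dots> = (\<Sum>t\<in>F. sum (c t) (St t))"
          by (intro sum.cong refl) (auto simp: b_def St_def)
        also have "\<dots> \<le> (\<Sum>t\<in>F. C t * real n)" using c(2) by (intro sum_mono)
        also have "\<dots> = CS * real n" by (simp add: CS_def sum_distrib_right)
        finally have 1: "sum b Sm \<le> CS * real n" .
        have "(\<Sum>i\<in>S - Sm. Y i - X i) \<le> real n * (B - A)"
          using S I AB by (intro overlap_length overlap_le_subset[OF S]) (auto intro: less_imp_le)
        then have "M / \<eta> * (\<Sum>i\<in>S - Sm. Y i - X i) \<le> M / \<eta> * (real n * (B - A))"
          using M(1) \<eta>(1) by (intro mult_left_mono) auto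
        also have "M / \<eta> * (\<Sum>i\<in>S - Sm. Y i - X i) = sum b (S - Sm)"
          unfolding sum_distrib_left by (intro sum.cong refl) (auto simp: b_def)
        finally have 2: "sum b (S - Sm) \<le> M / \<eta> * (real n * (B - A))" .
        have "sum b S = sum b (S - Sm) + sum b Sm" using Sm S by (intro sum.subset_diff) auto
        moreover have "(CS + M * (B - A) / \<eta>) * real n = CS * real n + M / \<eta> * (real n * (B - A))"
          by (subst distrib_right) simp
        ultimately show ?thesis using 1 2 by linarith
      qed
      ultimately show "\<exists>b. (\<forall>i\<in>S. 0 \<le> b i \<and> distortion_le (E 0) (E 1) (X i) (Y i) (exp (b i))) \<and> sum b S \<le> (CS + M * (B - A) / \<eta>) * real n"
        by blast
    qed
  qed
  then show ?thesis using e0(1) by - (rule exI[of _ R], rule exI[of _ e0], rule exI[of _ "CS + M * (B - A) / \<eta>"], blast)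
qed

section \<open>Intervals, lengths and components on the curve\<close>

text \<open>
  An interval with these endpoints: open, closed or half-open.
\<close>

definition endpoints :: "real set \<Rightarrow> real \<Rightarrow> real \<Rightarrow> bool" where
  "endpoints S a b \<longleftrightarrow> a < b \<and> {a<..<b} \<subseteq> S \<and> S \<subseteq> {a..b}"

lemma endpoints_exist:
  assumes I: "is_interval S" and bd: "S \<subseteq> {l..u}" and st: "s \<in> S" "t \<in> S" "s < t"
  shows "\<exists>a b. endpoints S a b"
proof (intro exI)
  have bdd: "bdd_above S" "bdd_below S" using bdd_above_mono[OF bdd_above_Icc bd] bdd_below_mono[OF bdd_below_Icc bd] by auto
  have "Inf S \<le> s" "t \<le> Sup S" using st bdd by (auto intro: cInf_lower cSup_upper)
  moreover have "{Inf S<..<Sup S} \<subseteq> S"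
  proof
    fix z assume "z \<in> {Inf S<..<Sup S}"
    then obtain p q where "p \<in> S" "p < z" "q \<in> S" "z < q"
      using bdd st by (metis cInf_less_iff less_cSup_iff empty_iff greaterThanLessThan_iff)
    then show "z \<in> S" using I by (meson less_imp_le mem_is_interval_1_I)
  qed
  moreover have "S \<subseteq> {Inf S..Sup S}" using bdd by (auto intro: cInf_lower cSup_upper)
  ultimately show "endpoints S (Inf S) (Sup S)" using st(3) by (auto simp: endpoints_def)
qed

lemma param_eq_int:
  assumes "param N s = param N t" shows "\<exists>j::int. s = t + of_int j"
proof (cases N)
  case (Interval a b)
  then show ?thesis using assms by (intro exI[of _ 0]) simp
next
  case Circle
  then have "sin (2 * pi * s) = sin (2 * pi * t)" "cos (2 * pi * s) = cos (2 * pi * t)"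
    using assms by (auto simp: complex_eq_iff)
  then obtain n :: int where "2 * pi * s = 2 * pi * t + 2 * pi * n" using sin_cos_eq_iff by blast
  then have "2 * pi * s = 2 * pi * (t + n)" by (simp add: distrib_left)
  then show ?thesis by (intro exI[of _ n]) simp
qed

lemma param_circle_shift: "param Circle (t + of_int j) = param Circle t"
proof -
  have "sin (2 * pi * (t + of_int j)) = sin (2 * pi * t) \<and> cos (2 * pi * (t + of_int j)) = cos (2 * pi * t)"
    unfolding sin_cos_eq_iff by (intro exI[of _ j]) (simp add: distrib_left)
  then show ?thesis by (simp add: complex_eq_iff)
qed

lemma param_continuous: "continuous_on A (param N)"
  by (cases N) (auto intro!: continuous_intros)

text \<open>
  The arc length parametrisation has period 1.
\<close>

lemma circle_injective_width:
  assumes "inj_on (param Circle) {a<..<b}" shows "b - a \<le> 1"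
proof (rule ccontr)
  assume "\<not> b - a \<le> 1"
  then have ba: "b - a > 1" by simp
  define s where "s = a + (b - a - 1) / 2"
  have s: "s \<in> {a<..<b}" "s + 1 \<in> {a<..<b}" using ba by (auto simp: s_def field_simps)
  moreover have "param Circle (s + 1) = param Circle s" using param_circle_shift[of s 1] by simp
  ultimately have "s + 1 = s" using inj_onD[OF assms] by blast
  then show False by simp
qed

lemma param_injective_bounded:
  assumes I: "is_interval I" "I \<subseteq> pdom N" and inj: "inj_on (param N) I"
  shows "\<exists>l u. I \<subseteq> {l..u}"
proof (cases N)
  case (Interval a b)
  then show ?thesis using I by auto
next
  case Circle
  show ?thesis
  proof (cases "I = {}")
    case False
    then obtain s where s: "s \<in> I" by blast
    have no: "\<bar>t - s\<bar> \<le> 2" if t: "t \<in> I" for t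
    proof -
      have "min s t \<in> I" "max s t \<in> I" using s t by (auto simp: min_def max_def)
      then have "{min s t<..<max s t} \<subseteq> I" using mem_is_interval_1_I[OF I(1), of "min s t" "max s t"] by auto
      then have "inj_on (param Circle) {min s t<..<max s t}" using inj Circle inj_on_subset by blast
      from circle_injective_width[OF this] show ?thesis by (auto simp: min_def max_def split: if_splits)
    qed
    have "I \<subseteq> {s - 2..s + 2}" using no by (force simp: abs_le_iff)
    then show ?thesis by blast
  qed auto
qed

lemma measure_up_to_finite:
  assumes "U \<in> lmeasurable" "finite F" "S - U \<subseteq> F" "U - S \<subseteq> F"
  shows "measure lebesgue S = measure lebesgue U"
proof (rule measure_negligible_symdiff[OF assms(1)])
  have "U - S \<union> (S - U) \<subseteq> F" using assms by auto
  then show "negligible (U - S \<union> (S - U))" using assms(2) negligible_finite negligible_subset by blast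
qed

text \<open>
  On the circle, \<^const>\<open>len\<close> measures the arc in the fundamental domain \<open>[0, 1)\<close>. After subtracting the
  integer part \<open>q\<close> of \<open>a\<close>, the interval starts in \<open>[0, 1)\<close>, has length at most 1 by injectivity, and is
  cut at most once, at the point 1.
\<close>

lemma len_param:
  assumes S: "endpoints S a b" "S \<subseteq> pdom N" and inj: "inj_on (param N) S"
  shows "len N (param N ` S) = b - a"
proof (cases N)
  case (Interval A B)
  then have "{t \<in> fund_dom N. param N t \<in> param N ` S} = S" using S(2) by auto
  then have "len N (param N ` S) = measure lebesgue S" by (simp add: len_def)
  also have "\<dots> = measure lebesgue {a<..<b}"
    using S(1) by (intro measure_up_to_finite[where F = "{a, b}"]) (auto simp: endpoints_def)
  finally show ?thesis using S(1) by (simp add: endpoints_def)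
next
  case Circle
  have sub: "{a<..<b} \<subseteq> S" "S \<subseteq> {a..b}" "a < b" using S(1) by (auto simp: endpoints_def)
  have ba: "b - a \<le> 1" using inj sub(1) Circle inj_on_subset circle_injective_width by blast
  define q where "q = \<lfloor>a\<rfloor>"
  define a' b' where "a' = a - of_int q" and "b' = b - of_int q"
  have a': "0 \<le> a'" "a' < 1" "a' < b'" "b' \<le> a' + 1" "b' < 2"
  proof -
    have "of_int q \<le> a" "a < of_int q + 1" unfolding q_def by linarith+
    then show "0 \<le> a'" "a' < 1" "a' < b'" "b' \<le> a' + 1" "b' < 2" using sub(3) ba by (auto simp: a'_def b'_def)
  qed
  define P where "P = {t \<in> {0..<1}. param Circle t \<in> param Circle ` S}"
  have P1: "t \<in> P" if "0 \<le> t" "t < 1" "t + of_int j \<in> S" for t j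
    using that param_circle_shift[of t j] by (auto simp: P_def intro!: image_eqI[of _ _ "t + of_int j"])
  have P2: "0 \<le> t \<and> t < 1 \<and> (t \<in> {a'..b'} \<or> t + 1 \<in> {a'..b'})" if "t \<in> P" for t
  proof -
    obtain s where s: "s \<in> S" "param Circle t = param Circle s" and t: "0 \<le> t" "t < 1" using \<open>t \<in> P\<close> by (auto simp: P_def)
    obtain i :: int where i: "s = t + of_int i" using param_eq_int[of Circle s t] s(2) by auto
    have "a' \<le> t + of_int (i - q)" "t + of_int (i - q) \<le> b'" using s(1) sub(2) i by (auto simp: a'_def b'_def)
    then have "of_int (i - q) > (-1 :: real)" "of_int (i - q) < (2 :: real)" using t a' by linarith+
    then have "i - q = 0 \<or> i - q = 1" by linarith
    then show ?thesis using t \<open>a' \<le> t + of_int (i - q)\<close> \<open>t + of_int (i - q) \<le> b'\<close> by auto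
  qed
  have mem: "t + of_int q \<in> S" if "a' < t" "t < b'" for t
    using that sub(1) by (auto simp: a'_def b'_def)
  have mem1: "t + of_int (q + 1) \<in> S" if "a' < t + 1" "t + 1 < b'" for t
    using that sub(1) by (auto simp: a'_def b'_def)
  have "len N (param N ` S) = measure lebesgue P" by (simp add: len_def P_def Circle)
  also have "\<dots> = b' - a'"
  proof (cases "b' \<le> 1")
    case True
    have "measure lebesgue P = measure lebesgue {a'<..<b'}"
    proof (rule measure_up_to_finite[where F = "{0, a', b'}"])
      show "P - {a'<..<b'} \<subseteq> {0, a', b'}" using P2 True a' by force
      show "{a'<..<b'} - P \<subseteq> {0, a', b'}" using P1[OF _ _ mem] True a' by auto
    qed auto
    then show ?thesis using a' by simp
  next
    case False
    have "measure lebesgue P = measure lebesgue ({a'<..<1} \<union> {0<..<b' - 1})"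
    proof (rule measure_up_to_finite[where F = "{0, a', b' - 1}"])
      show "P - ({a'<..<1} \<union> {0<..<b' - 1}) \<subseteq> {0, a', b' - 1}" using P2 False a' by force
      show "({a'<..<1} \<union> {0<..<b' - 1}) - P \<subseteq> {0, a', b' - 1}"
        using P1[OF _ _ mem] P1[OF _ _ mem1] False a' by auto
    qed auto
    also have "\<dots> = measure lebesgue {a'<..<1} + measure lebesgue {0<..<b' - 1}"
    proof -
      have e: "{a'<..<1} \<inter> {0<..<b' - 1} = {}" using a' by auto
      have "measure lebesgue ({a'<..<1} \<union> {0<..<b' - 1}) =
          measure lebesgue {a'<..<1} + measure lebesgue {0<..<b' - 1} - measure lebesgue ({a'<..<1} \<inter> {0<..<b' - 1})"
        by (rule measure_Un3) auto
      then show ?thesis unfolding e by simp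
    qed
    finally show ?thesis using a' False by simp
  qed
  finally show ?thesis by (simp add: a'_def b'_def)
qed

definition left_part :: "real set \<Rightarrow> real set \<Rightarrow> real set" where
  "left_part I K = {t\<in>I. \<forall>s\<in>K. t < s}"

definition right_part :: "real set \<Rightarrow> real set \<Rightarrow> real set" where
  "right_part I K = {t\<in>I. \<forall>s\<in>K. s < t}"

text \<open>
  A connected subset of \<open>T - h ` K\<close> corresponds to an interval missing \<open>K\<close> and so stays on one side of
  \<open>K\<close>.
\<close>

lemma components_interval_diff:
  fixes h :: "real \<Rightarrow> 'a::t2_space"
  assumes hom: "homeomorphism I T h q" and I: "is_interval I"
    and K: "K \<subseteq> I" "is_interval K" "K \<noteq> {}"
  shows "components (T - h ` K) = {h ` left_part I K, h ` right_part I K} - {{}}"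
proof -
  define L R where "L = {t\<in>I. \<forall>s\<in>K. t < s}" and "R = {t\<in>I. \<forall>s\<in>K. s < t}"
  have parts: "left_part I K = L" "right_part I K = R" by (simp_all add: L_def R_def left_part_def right_part_def)
  have hq: "\<And>t. t \<in> I \<Longrightarrow> q (h t) = t" "\<And>z. z \<in> T \<Longrightarrow> h (q z) = z" "h ` I = T" "q ` T = I"
    "continuous_on I h" "continuous_on T q" using hom by (auto simp: homeomorphism_def)
  have LR: "I - K = L \<union> R"
  proof
    show "I - K \<subseteq> L \<union> R"
    proof
      fix t assume t: "t \<in> I - K"
      have "(\<forall>s\<in>K. t < s) \<or> (\<forall>s\<in>K. s < t)"
      proof (rule ccontr)
        assume "\<not> ?thesis"
        then obtain s s' where "s \<in> K" "s' \<in> K" "s \<le> t" "t \<le> s'" by (meson not_less)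
        then have "t \<in> K" using K(2) by (meson mem_is_interval_1_I)
        then show False using t by simp
      qed
      then show "t \<in> L \<union> R" using t by (auto simp: L_def R_def)
    qed
  qed (auto simp: L_def R_def)
  have TK: "T - h ` K = h ` (I - K)"
    using inj_on_image_set_diff[OF inj_on_inverseI[of I q h], OF hq(1), of I K] hq(3) K(1) by auto
  have conv: "connected (h ` P)" if P: "P = L \<or> P = R" for P
  proof (rule connected_continuous_image)
    have PI: "P \<subseteq> I" using P by (auto simp: L_def R_def)
    show "continuous_on P h" using hq(5) PI by (rule continuous_on_subset)
    have "is_interval P"
      unfolding is_interval_1
    proof (intro ballI allI impI)
      fix u v x assume uv: "u \<in> P" "v \<in> P" "u \<le> x \<and> x \<le> v"
      then have "x \<in> I" using mem_is_interval_1_I[OF I, of u v x] PI by blast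
      then show "x \<in> P" using P uv unfolding L_def R_def by force
    qed
    then show "connected P" by (simp add: is_interval_connected_1)
  qed
  have one_side: "C \<subseteq> h ` L \<or> C \<subseteq> h ` R" if C: "connected C" "C \<subseteq> T - h ` K" for C
  proof -
    have CT: "C \<subseteq> T" using C by auto
    have "connected (q ` C)"
      using C(1) hq(6) CT by (intro connected_continuous_image) (auto intro: continuous_on_subset)
    then have qC: "is_interval (q ` C)" by (simp add: is_interval_connected_1)
    have qsub: "q ` C \<subseteq> L \<union> R"
    proof
      fix t assume "t \<in> q ` C"
      then obtain z where z: "z \<in> C" "t = q z" by blast
      then have "z \<in> h ` (I - K)" using C(2) TK by blast
      then obtain x where "x \<in> I - K" "z = h x" by blast
      then have "t = x" using hq(1)[of x] z(2) by simp
      then show "t \<in> L \<union> R" using LR \<open>x \<in> I - K\<close> by blast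
    qed
    have "q ` C \<subseteq> L \<or> q ` C \<subseteq> R"
    proof (rule ccontr)
      assume "\<not> ?thesis"
      then obtain s t where st: "s \<in> q ` C" "s \<in> L" "t \<in> q ` C" "t \<in> R" using qsub by blast
      obtain k where k: "k \<in> K" using K(3) by blast
      have "s < k" "k < t" using st k by (auto simp: L_def R_def)
      then have "k \<in> q ` C" using qC st by (meson less_imp_le mem_is_interval_1_I)
      then show False using qsub k by (auto simp: L_def R_def)
    qed
    moreover have "C = h ` q ` C" using hq(2) CT by (force simp: image_image)
    ultimately show ?thesis by blast
  qed
  have disj: "h ` L \<inter> h ` R = {}"
  proof -
    have "L \<inter> R = {}" using K(3) by (force simp: L_def R_def)
    moreover have "inj_on h I" using hq(1) by (rule inj_on_inverseI)
    ultimately show ?thesis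
      by (metis (no_types, lifting) L_def R_def image_empty inj_on_image_Int mem_Collect_eq subsetI)
  qed
  have subs: "h ` L \<subseteq> T - h ` K" "h ` R \<subseteq> T - h ` K" unfolding TK LR by auto
  show ?thesis
    unfolding parts
  proof
    show "components (T - h ` K) \<subseteq> {h ` L, h ` R} - {{}}"
    proof
      fix C assume "C \<in> components (T - h ` K)"
      then have C: "C \<noteq> {}" "C \<subseteq> T - h ` K" "connected C" "\<And>D. D \<noteq> {} \<Longrightarrow> C \<subseteq> D \<Longrightarrow> D \<subseteq> T - h ` K \<Longrightarrow> connected D \<Longrightarrow> D = C"
        unfolding in_components_maximal by auto
      show "C \<in> {h ` L, h ` R} - {{}}" using one_side[OF C(3,2)] C(1) C(4)[of "h ` L"] C(4)[of "h ` R"] conv[of L] conv[of R] subs by blast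
    qed
    have mx: "h ` P \<in> components (T - h ` K)" if P: "P = L \<or> P = R" "h ` P \<noteq> {}" for P
      unfolding in_components_maximal
    proof (intro conjI allI impI, goal_cases)
      case 1 then show ?case using P by simp
    next
      case 2 then show ?case using P subs by blast
    next
      case 3 then show ?case using P conv by blast
    next
      case (4 D)
      then have "D \<subseteq> h ` L \<or> D \<subseteq> h ` R" using one_side by blast
      then show ?case using 4 P disj by blast
    qed
    then show "{h ` L, h ` R} - {{}} \<subseteq> components (T - h ` K)" by blast
  qed
qed

text \<open>
  The parametrisation has continuous local sections: \<open>Re\<close> for an interval, and a shifted argument
  near each point of the circle.
\<close>

lemma continuous_on_via_param:
  assumes S: "S \<subseteq> points N" and u: "continuous_on (preim N S) (\<lambda>t. u (param N t))"
  shows "continuous_on S u"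
proof (cases N)
  case (Interval a b)
  have "continuous_on S (\<lambda>z. u (param N (Re z)))"
  proof (rule continuous_on_compose2[OF u])
    show "Re ` S \<subseteq> preim N S" using S Interval by (auto simp: preim_def points_def)
  qed (intro continuous_intros)
  moreover have "u (param N (Re z)) = u z" if "z \<in> S" for z using that S Interval by (auto simp: points_def)
  ultimately show ?thesis by (simp cong: continuous_on_cong)
next
  case Circle
  show ?thesis
    unfolding continuous_on_eq_continuous_within
  proof
    fix z0 assume z0: "z0 \<in> S"
    then obtain t0 where t0: "z0 = cis (2 * pi * t0)" using S Circle by (auto simp: points_def)
    define \<sigma> where "\<sigma> = (\<lambda>z. t0 + Arg (z / z0) / (2 * pi))"
    have z0n: "z0 \<noteq> 0" using t0 by auto
    have \<sigma>: "param N (\<sigma> z) = z" if "z \<in> S" for z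
    proof -
      obtain t where t: "z = cis (2 * pi * t)" using \<open>z \<in> S\<close> S Circle by (auto simp: points_def)
      have "z / z0 = cis (2 * pi * t - 2 * pi * t0)" unfolding t t0 by (simp add: cis_divide)
      then have n: "norm (z / z0) = 1" "z / z0 \<noteq> 0" by auto
      have "param N (\<sigma> z) = cis (2 * pi * t0 + Arg (z / z0))" by (simp add: Circle \<sigma>_def distrib_left)
      also have "\<dots> = z0 * cis (Arg (z / z0))" by (simp add: t0 cis_mult)
      also have "cis (Arg (z / z0)) = z / z0" using n by (simp add: cis_Arg sgn_div_norm)
      finally show ?thesis using z0n by simp
    qed
    have \<sigma>S: "\<sigma> ` S \<subseteq> preim N S" using \<sigma> by (auto simp: preim_def Circle)
    have "continuous (at 1) Arg" by (rule continuous_at_Arg) (auto simp: complex_nonpos_Reals_iff)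
    then have "isCont Arg (z0 / z0)" using z0n by simp
    moreover have "isCont (\<lambda>z. z / z0) z0" using z0n by (intro isCont_divide) auto
    ultimately have "isCont (\<lambda>z. Arg (z / z0)) z0" by (rule isCont_o2[rotated])
    then have "continuous (at z0 within S) (\<lambda>z. Arg (z / z0))" by (rule continuous_at_imp_continuous_at_within)
    then have c\<sigma>: "continuous (at z0 within S) \<sigma>"
      unfolding \<sigma>_def by (intro continuous_add continuous_divide continuous_const) auto
    have "continuous (at (\<sigma> z0) within preim N S) (\<lambda>t. u (param N t))"
      using u \<sigma>S z0 by (auto simp: continuous_on_eq_continuous_within)
    then have "continuous (at (\<sigma> z0) within \<sigma> ` S) (\<lambda>t. u (param N t))"
      using \<sigma>S continuous_within_subset by blast
    then have "continuous (at z0 within S) (\<lambda>z. u (param N (\<sigma> z)))"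
      by (rule continuous_within_compose2[OF c\<sigma>])
    then show "continuous (at z0 within S) u"
      by (rule continuous_transform_within[OF _ zero_less_one z0]) (simp add: \<sigma>)
  qed
qed

section \<open>Iteration on the line\<close>

text \<open>
  By the mean value theorem \<open>H\<close> is injective on the closed interval.
\<close>

lemma nonzero_derivative_monotone:
  assumes cont: "continuous_on {a..b} (H :: real \<Rightarrow> real)"
    and der: "\<And>t. a < t \<Longrightarrow> t < b \<Longrightarrow> (H has_real_derivative H' t) (at t) \<and> H' t \<noteq> 0"
  shows "strict_mono_on {a..b} H \<or> strict_antimono_on {a..b} H"
proof -
  have neq: "H s \<noteq> H t" if st: "a \<le> s" "s < t" "t \<le> b" for s t
  proof -
    have "continuous_on {s..t} H" using cont by (rule continuous_on_subset) (use st in auto)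
    moreover have "H differentiable (at x)" if "s < x" "x < t" for x
      using der[of x] that st by (auto simp: real_differentiable_def)
    ultimately obtain l z where z: "s < z" "z < t" "(H has_real_derivative l) (at z)" "H t - H s = (t - s) * l"
      using MVT[of s t H] st(2) by blast
    have "(H has_real_derivative H' z) (at z)" "H' z \<noteq> 0" using der[of z] z st by auto
    then have "l \<noteq> 0" using DERIV_unique[OF z(3), of "H' z"] by simp
    then have "(t - s) * l \<noteq> 0" using st by simp
    then have "H t - H s \<noteq> 0" using z(4) by simp
    then show ?thesis by auto
  qed
  have "inj_on H {a..b}"
  proof (rule inj_onI)
    fix s t assume "s \<in> {a..b}" "t \<in> {a..b}" "H s = H t"
    then show "s = t" using neq[of s t] neq[of t s] by (cases s t rule: linorder_cases) auto
  qed
  then show ?thesis using injective_eq_monotone_map[of "{a..b}" H] cont by (simp add: is_interval_cc)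
qed

lemma endpoints_within:
  assumes "endpoints S s t" "S \<subseteq> {a..b}" shows "a \<le> s" "s < t" "t \<le> b"
proof -
  have "s < t" "{s<..<t} \<subseteq> {a..b}" using assms by (auto simp: endpoints_def)
  then show "a \<le> s" "s < t" "t \<le> b" by (simp_all add: greaterThanLessThan_subseteq_atLeastAtMost_iff)
qed

lemma monotone_image_endpoints:
  assumes cont: "continuous_on {a..b} (H :: real \<Rightarrow> real)"
    and mono: "strict_mono_on {a..b} H \<or> strict_antimono_on {a..b} H"
    and S: "endpoints S s t" "S \<subseteq> {a..b}"
  shows "endpoints (H ` S) (min (H s) (H t)) (max (H s) (H t))"
proof -
  note st = endpoints_within[OF S]
  have S': "{s<..<t} \<subseteq> S" "S \<subseteq> {s..t}" using S by (auto simp: endpoints_def)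
  have contst: "continuous_on {s..t} H" using cont by (rule continuous_on_subset) (use st in auto)
  from mono show ?thesis
  proof
    assume m: "strict_mono_on {a..b} H"
    have less: "H x < H y" if "a \<le> x" "x < y" "y \<le> b" for x y using m that by (auto simp: monotone_on_def)
    have le: "H x \<le> H y" if "a \<le> x" "x \<le> y" "y \<le> b" for x y using less[of x y] that by (cases "x = y") auto
    have "{H s<..<H t} \<subseteq> H ` S"
    proof
      fix y assume y: "y \<in> {H s<..<H t}"
      then obtain x where x: "s \<le> x" "x \<le> t" "H x = y" using IVT'[of H s y t] contst st by auto
      then have "x \<in> {s<..<t}" using y by (auto simp: less_le)
      then show "y \<in> H ` S" using x S' by blast
    qed
    moreover have "H ` S \<subseteq> {H s..H t}"
    proof
      fix y assume "y \<in> H ` S"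
      then obtain x where x: "x \<in> S" "y = H x" by blast
      then have "s \<le> x" "x \<le> t" using S'(2) by auto
      then show "y \<in> {H s..H t}" using le[of s x] le[of x t] st x(2) by auto
    qed
    ultimately show ?thesis using less[OF st] by (simp add: endpoints_def min_def max_def)
  next
    assume m: "strict_antimono_on {a..b} H"
    have less: "H y < H x" if "a \<le> x" "x < y" "y \<le> b" for x y using m that by (auto simp: monotone_on_def)
    have le: "H y \<le> H x" if "a \<le> x" "x \<le> y" "y \<le> b" for x y using less[of x y] that by (cases "x = y") auto
    have "{H t<..<H s} \<subseteq> H ` S"
    proof
      fix y assume y: "y \<in> {H t<..<H s}"
      then obtain x where x: "s \<le> x" "x \<le> t" "H x = y" using IVT2'[of H t y s] contst st by auto
      then have "x \<in> {s<..<t}" using y by (auto simp: less_le)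
      then show "y \<in> H ` S" using x S' by blast
    qed
    moreover have "H ` S \<subseteq> {H t..H s}"
    proof
      fix y assume "y \<in> H ` S"
      then obtain x where x: "x \<in> S" "y = H x" by blast
      then have "s \<le> x" "x \<le> t" using S'(2) by auto
      then show "y \<in> {H t..H s}" using le[of s x] le[of x t] st x(2) by auto
    qed
    ultimately show ?thesis using less[OF st] by (simp add: endpoints_def min_def max_def)
  qed
qed

lemma iterate_in: "(\<And>t. t \<in> P \<Longrightarrow> G t \<in> P) \<Longrightarrow> t \<in> P \<Longrightarrow> (G ^^ k) t \<in> P"
  by (induction k) auto

lemma iterate_derivative:
  fixes G :: "real \<Rightarrow> real"
  assumes GP: "\<And>t. t \<in> P \<Longrightarrow> G t \<in> P"
    and dG: "\<And>t. t \<in> P \<Longrightarrow> (G has_real_derivative G' t) (at t within P)" and t: "t \<in> P"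
  shows "((G ^^ k) has_real_derivative (\<Prod>j<k. G' ((G ^^ j) t))) (at t within P)"
proof (induction k)
  case 0
  then show ?case by (simp add: id_def)
next
  case (Suc k)
  have "(G has_real_derivative G' ((G ^^ k) t)) (at ((G ^^ k) t) within (G ^^ k) ` P)"
    by (rule DERIV_subset[OF dG]) (use iterate_in[OF GP] t in auto)
  from DERIV_image_chain[OF this Suc] show ?case by (simp add: mult.commute o_def)
qed

lemma iterate_monotone:
  fixes G :: "real \<Rightarrow> real"
  assumes GP: "\<And>t. t \<in> P \<Longrightarrow> G t \<in> P"
    and dG: "\<And>t. t \<in> P \<Longrightarrow> (G has_real_derivative G' t) (at t within P)"
    and ab: "{a..b} \<subseteq> P"
    and nz: "\<And>j t. j < k \<Longrightarrow> a < t \<Longrightarrow> t < b \<Longrightarrow> G' ((G ^^ j) t) \<noteq> 0"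
  shows "continuous_on {a..b} (G ^^ k)"
    "strict_mono_on {a..b} (G ^^ k) \<or> strict_antimono_on {a..b} (G ^^ k)"
proof -
  have D: "((G ^^ k) has_real_derivative (\<Prod>j<k. G' ((G ^^ j) t))) (at t within {a..b})" if "t \<in> {a..b}" for t
    by (rule DERIV_subset[OF iterate_derivative[OF GP dG]]) (use ab that in auto)
  show c: "continuous_on {a..b} (G ^^ k)" using D by (rule DERIV_continuous_on)
  show "strict_mono_on {a..b} (G ^^ k) \<or> strict_antimono_on {a..b} (G ^^ k)"
  proof (rule nonzero_derivative_monotone[OF c])
    fix t assume t: "a < t" "t < b"
    have "((G ^^ k) has_real_derivative (\<Prod>j<k. G' ((G ^^ j) t))) (at t)"
      using D[of t] t by (simp add: at_within_Icc_at)
    moreover have "(\<Prod>j<k. G' ((G ^^ j) t)) \<noteq> 0" using nz t by simp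
    ultimately show "((G ^^ k) has_real_derivative (\<Prod>j<k. G' ((G ^^ j) t))) (at t) \<and> (\<Prod>j<k. G' ((G ^^ j) t)) \<noteq> 0" by blast
  qed
qed

lemma log_cr_nonneg:
  assumes "a < c" "c < d" "d < b" shows "0 \<le> log_cr a c d b"
proof -
  have "(b - a) * (d - c) + (c - a) * (b - d) = (d - a) * (b - c)" by (simp add: algebra_simps)
  moreover have "0 < (c - a) * (b - d)" "0 < (b - a) * (d - c)" using assms by auto
  ultimately have "1 \<le> (d - a) * (b - c) / ((b - a) * (d - c))" by (subst le_divide_eq_1_pos) auto
  then show ?thesis unfolding log_cr_def by (rule ln_ge_zero)
qed

text \<open>
  The one-step estimates multiply. The endpoints are sorted by \<open>min\<close> and \<open>max\<close> because an iterate may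
  reverse the orientation.
\<close>

lemma log_cr_iterate:
  fixes G :: "real \<Rightarrow> real"
  assumes P: "is_interval P" and GP: "\<And>t. t \<in> P \<Longrightarrow> G t \<in> P"
    and dG: "\<And>t. t \<in> P \<Longrightarrow> (G has_real_derivative G' t) (at t within P)"
    and ab: "{a..b} \<subseteq> P" and ord: "a < c" "c < d" "d < b"
    and nz: "\<And>j t. j < m \<Longrightarrow> a < t \<Longrightarrow> t < b \<Longrightarrow> G' ((G ^^ j) t) \<noteq> 0"
    and dist: "\<And>j. j < m \<Longrightarrow> distortion_le G G' (min ((G ^^ j) a) ((G ^^ j) b)) (max ((G ^^ j) a) ((G ^^ j) b)) (exp (w j))"
  shows "log_cr ((G ^^ m) a) ((G ^^ m) c) ((G ^^ m) d) ((G ^^ m) b) \<le> exp (sum w {..<m}) * log_cr a c d b"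
  using nz dist
proof (induction m)
  case 0
  then show ?case by simp
next
  case (Suc k)
  define H where "H = G ^^ k"
  define \<alpha> \<beta> where "\<alpha> = min (H a) (H b)" and "\<beta> = max (H a) (H b)"
  have IH: "log_cr (H a) (H c) (H d) (H b) \<le> exp (sum w {..<k}) * log_cr a c d b"
    unfolding H_def by (rule Suc.IH) (use Suc.prems in auto)
  have H: "continuous_on {a..b} H" "strict_mono_on {a..b} H \<or> strict_antimono_on {a..b} H"
    unfolding H_def by (rule iterate_monotone[OF GP dG ab, where k = k]; use Suc.prems(1) in auto)+
  have "endpoints (H ` {a<..<b}) \<alpha> \<beta>"
    unfolding \<alpha>_def \<beta>_def by (rule monotone_image_endpoints[OF H]) (use ord in \<open>auto simp: endpoints_def\<close>)
  then have im: "{\<alpha><..<\<beta>} \<subseteq> H ` {a<..<b}" "\<alpha> < \<beta>" by (auto simp: endpoints_def)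
  have HP: "H t \<in> P" if "t \<in> {a..b}" for t unfolding H_def using iterate_in[of P G t k] GP ab that by blast
  have "\<alpha> \<in> P" "\<beta> \<in> P" using HP[of a] HP[of b] ord by (auto simp: \<alpha>_def \<beta>_def min_def max_def)
  then have sub: "{\<alpha>..\<beta>} \<subseteq> P" using mem_is_interval_1_I[OF P, of \<alpha> \<beta>] by auto
  have dGw: "(G has_real_derivative G' t) (at t within {\<alpha>..\<beta>})" if "t \<in> {\<alpha>..\<beta>}" for t
    by (rule DERIV_subset[OF dG]) (use sub that in auto)
  have dGi: "(G has_real_derivative G' t) (at t)" if "\<alpha> < t" "t < \<beta>" for t
    using dGw[of t] that by (simp add: at_within_Icc_at)
  have Gnz: "G' t \<noteq> 0" if t: "\<alpha> < t" "t < \<beta>" for t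
  proof -
    obtain s where "a < s" "s < b" "t = H s" using im(1) t by fastforce
    then show ?thesis using Suc.prems(1)[of k s] by (simp add: H_def)
  qed
  have Gc: "continuous_on {\<alpha>..\<beta>} G" using dGw by (rule DERIV_continuous_on)
  have Gm: "strict_mono_on {\<alpha>..\<beta>} G \<or> strict_antimono_on {\<alpha>..\<beta>} G"
    using dGi Gnz by (intro nonzero_derivative_monotone[OF Gc]) auto
  have dk: "distortion_le G G' \<alpha> \<beta> (exp (w k))" using Suc.prems(2)[of k] by (simp add: H_def \<alpha>_def \<beta>_def)
  have step: "log_cr (G p) (G q) (G r) (G s) \<le> exp (w k) * log_cr p q r s"
    if "p = \<alpha>" "s = \<beta>" "p < q" "q < r" "r < s" for p q r s
    using Gm
  proof
    assume "strict_mono_on {\<alpha>..\<beta>} G"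
    then show ?thesis using log_cr_step_increasing[OF that(3-5), where g = G and g' = G'] Gc dGi dk that(1,2) by simp
  next
    assume "strict_antimono_on {\<alpha>..\<beta>} G"
    then show ?thesis using log_cr_step_decreasing[OF that(3-5), where g = G and g' = G'] Gc dGi dk that(1,2) by simp
  qed
  have "log_cr (G (H a)) (G (H c)) (G (H d)) (G (H b)) \<le> exp (w k) * log_cr (H a) (H c) (H d) (H b)"
    using H(2)
  proof
    assume "strict_mono_on {a..b} H"
    then have "H a < H c" "H c < H d" "H d < H b" using ord by (auto simp: monotone_on_def)
    then show ?thesis by (intro step) (auto simp: \<alpha>_def \<beta>_def)
  next
    assume "strict_antimono_on {a..b} H"
    then have "H b < H d" "H d < H c" "H c < H a" using ord by (auto simp: monotone_on_def)
    then have "log_cr (G (H b)) (G (H d)) (G (H c)) (G (H a)) \<le> exp (w k) * log_cr (H b) (H d) (H c) (H a)"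
      by (intro step) (auto simp: \<alpha>_def \<beta>_def)
    then show ?thesis by (simp add: log_cr_swap)
  qed
  also have "\<dots> \<le> exp (w k) * (exp (sum w {..<k}) * log_cr a c d b)" using IH by (intro mult_left_mono) auto
  finally show ?case by (simp add: H_def exp_add mult_ac)
qed

section \<open>Lifts\<close>

lemma pdom_interval: "is_interval (pdom N)"
  by (cases N) auto

lemma preim_points: "preim N (points N) = pdom N"
  by (auto simp: preim_def points_def)

lemma smooth_real_jet:
  assumes "smooth_real_on U F" shows "jet_on U (\<lambda>k. nderiv U k F)"
  using assms unfolding smooth_real_on_def jet_on_def
  by (simp add: has_real_derivative_iff_has_vector_derivative vector_derivative_works)

lemma derivative_cong_on:
  assumes "(f has_real_derivative D) (at t within U)" "t \<in> U" "\<And>s. s \<in> U \<Longrightarrow> f s = g s"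
  shows "(g has_real_derivative D) (at t within U)"
  by (rule has_field_derivative_transform_within[OF assms(1) zero_less_one assms(2)]) (use assms(3) in auto)

lemma jet_unique_up_to_constant:
  assumes j: "jet_on U E" "jet_on U E'" and U: "\<And>t. t \<in> U \<Longrightarrow> at t within U \<noteq> bot"
    and eq: "\<And>t. t \<in> U \<Longrightarrow> E 0 t = E' 0 t + c" and t: "t \<in> U"
  shows "E (Suc k) t = E' (Suc k) t"
proof -
  have step: "E (Suc k) t = E' (Suc k) t"
    if t: "t \<in> U" and e: "\<And>s. s \<in> U \<Longrightarrow> E k s = E' k s + e" for k t e
  proof -
    have "((\<lambda>t. E' k t + e) has_real_derivative E' (Suc k) t) (at t within U)"
      using j(2) t by (auto simp: jet_on_def intro!: derivative_eq_intros)
    then have "(E k has_real_derivative E' (Suc k) t) (at t within U)"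
      by (rule derivative_cong_on[OF _ t]) (use e in auto)
    moreover have "(E k has_real_derivative E (Suc k) t) (at t within U)" using j(1) t by (auto simp: jet_on_def)
    ultimately show ?thesis
      using vector_derivative_unique_within[OF U[OF t]] by (auto simp: has_real_derivative_iff_has_vector_derivative)
  qed
  have "\<forall>t\<in>U. E (Suc k) t = E' (Suc k) t"
  proof (induction k)
    case 0
    show ?case using step[OF _ eq] by blast
  next
    case (Suc k)
    then show ?case using step[of _ "Suc k" 0] by auto
  qed
  then show ?thesis using t by blast
qed

text \<open>
  The difference is continuous and takes integer values.
\<close>

lemma lifts_differ_by_constant:
  assumes U: "connected U" and F: "continuous_on U F" "continuous_on U F'"
    and eq: "\<And>t. t \<in> U \<Longrightarrow> param N (F t) = param N (F' t)"
  shows "\<exists>c. \<forall>t\<in>U. F t = F' t + c"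
proof -
  have int: "\<exists>j::int. F t - F' t = of_int j" if t: "t \<in> U" for t
  proof -
    obtain j :: int where "F t = F' t + of_int j" using param_eq_int[OF eq[OF t]] by blast
    then show ?thesis by (intro exI[of _ j]) simp
  qed
  have "(\<lambda>t. F t - F' t) constant_on U"
  proof (rule continuous_discrete_range_constant[OF U])
    show "continuous_on U (\<lambda>t. F t - F' t)" using F by (intro continuous_intros)
    fix x assume x: "x \<in> U"
    have "1 \<le> norm ((F y - F' y) - (F x - F' x))" if y: "y \<in> U" "F y - F' y \<noteq> F x - F' x" for y
    proof -
      obtain i j :: int where "F y - F' y = of_int i" "F x - F' x = of_int j" using int[OF x] int[OF y(1)] by blast
      then have "(F y - F' y) - (F x - F' x) = of_int (i - j)" "i - j \<noteq> 0" using y(2) by auto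
      then show ?thesis by (simp only: real_norm_def flip: of_int_abs)
    qed
    then show "\<exists>e>0. \<forall>y. y \<in> U \<and> F y - F' y \<noteq> F x - F' x \<longrightarrow> e \<le> norm ((F y - F' y) - (F x - F' x))"
      by (intro exI[of _ 1]) auto
  qed
  then obtain c where "\<forall>t\<in>U. F t - F' t = c" by (auto simp: constant_on_def)
  then show ?thesis by (intro exI[of _ c]) (auto simp: algebra_simps)
qed

lemma lift_jet:
  assumes "smooth_lift N S f F" shows "jet_on (preim N S) (\<lambda>k. nderiv (preim N S) k F)"
  using assms smooth_real_jet unfolding smooth_lift_def by blast

lemma lift_jet_points:
  assumes "smooth_lift N (points N) f F" shows "jet_on (pdom N) (\<lambda>k. nderiv (pdom N) k F)"
  using lift_jet[OF assms] by (simp add: preim_points)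

lemma lift_derivative:
  assumes "smooth_lift N (points N) f F" "t \<in> pdom N"
  shows "(F has_real_derivative nderiv (pdom N) 1 F t) (at t within pdom N)"
proof -
  have "(nderiv (pdom N) 0 F has_real_derivative nderiv (pdom N) (Suc 0) F t) (at t within pdom N)"
    using lift_jet_points[OF assms(1)] assms(2) unfolding jet_on_def by blast
  then show ?thesis by simp
qed

lemma lift_continuous:
  assumes "smooth_lift N S f F" shows "continuous_on (preim N S) F"
  using jet_continuous[OF lift_jet[OF assms], of 0] by simp

text \<open>
  Translating a lift by an integer gives another lift, which differs from it by a constant.
\<close>

lemma circle_jet_periodic:
  assumes F: "smooth_lift Circle (points Circle) f F"
  shows "nderiv UNIV (Suc k) F (t + of_int j) = nderiv UNIV (Suc k) F t"
    "\<exists>c. \<forall>t. F (t + of_int j) = F t + c"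
proof -
  define E where "E = (\<lambda>k. nderiv UNIV k F)"
  have jet: "jet_on UNIV E" unfolding E_def using lift_jet_points[OF F] by simp
  have cF: "continuous_on UNIV F" using lift_continuous[OF F] by (simp add: preim_points)
  have pF: "param Circle (F t) = f (param Circle t)" for t using F by (simp add: smooth_lift_def preim_points)
  have "\<exists>c. \<forall>t\<in>UNIV. F (t + of_int j) = F t + c"
  proof (rule lifts_differ_by_constant[where N = Circle])
    show "continuous_on UNIV (\<lambda>t. F (t + of_int j))"
      by (rule continuous_on_compose2[OF cF]) (auto intro!: continuous_intros)
    fix t :: real
    show "param Circle (F (t + of_int j)) = param Circle (F t)" using pF param_circle_shift[of t j] by simp
  qed (use cF in auto)
  then show c: "\<exists>c. \<forall>t. F (t + of_int j) = F t + c" by simp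
  then obtain c where c: "\<And>t. F (t + of_int j) = F t + c" by blast
  have jet': "jet_on UNIV (\<lambda>k t. E k (t + of_int j))"
    unfolding jet_on_def
  proof (intro allI ballI)
    fix k t
    have "(E k has_real_derivative E (Suc k) (t + of_int j)) (at (t + of_int j))" using jet by (simp add: jet_on_def)
    then show "((\<lambda>t. E k (t + of_int j)) has_real_derivative E (Suc k) (t + of_int j)) (at t)"
      by (simp add: DERIV_shift)
  qed
  have "E (Suc k) (t + of_int j) = E (Suc k) t"
    by (rule jet_unique_up_to_constant[OF jet' jet, where c = c]) (auto simp: E_def c)
  then show "nderiv UNIV (Suc k) F (t + of_int j) = nderiv UNIV (Suc k) F t" by (simp add: E_def)
qed

lemma pdom_limit_point:
  assumes "N = Circle \<or> (\<exists>a b. a < b \<and> N = Interval a b)" "t \<in> pdom N"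
  shows "at t within pdom N \<noteq> bot"
  using assms by (auto simp: trivial_limit_within islimpt_Icc)

text \<open>
  The lift of \<open>f\<close> used in \<^const>\<open>Cinf_ball\<close> may depend on \<open>g\<close>. All lifts of \<open>f\<close> have the same
  derivatives of positive order, so a single lift \<open>F0\<close> serves for the whole ball; order 0 is the
  reason for the condition \<open>1 \<le> k\<close>.
\<close>

lemma ball_jets:
  assumes N: "N = Circle \<or> (\<exists>a b. a < b \<and> N = Interval a b)"
    and g: "g \<in> Cinf_ball N f r e" and F0: "smooth_lift N (points N) f F0"
  shows "\<exists>G. smooth_lift N (points N) g G \<and>
    (\<forall>t\<in>pdom N. \<forall>k. 1 \<le> k \<and> k \<le> r \<longrightarrow> \<bar>nderiv (pdom N) k G t - nderiv (pdom N) k F0 t\<bar> < e)"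
proof -
  obtain F G where F: "smooth_lift N (points N) f F" and G: "smooth_lift N (points N) g G"
    and close: "\<forall>k\<le>r. \<forall>t\<in>pdom N. \<bar>nderiv (pdom N) k F t - nderiv (pdom N) k G t\<bar> < e"
    using g by (auto simp: Cinf_ball_def)
  have conn: "connected (pdom N)" using pdom_interval is_interval_connected_1 by blast
  obtain c where c: "\<forall>t\<in>pdom N. F t = F0 t + c"
    using lifts_differ_by_constant[OF conn, of F F0 N] lift_continuous[OF F] lift_continuous[OF F0] F F0
    by (auto simp: smooth_lift_def preim_points)
  have "nderiv (pdom N) (Suc k) F t = nderiv (pdom N) (Suc k) F0 t" if "t \<in> pdom N" for k t
    by (rule jet_unique_up_to_constant[where c = c, OF lift_jet_points[OF F] lift_jet_points[OF F0]])
       (use c that pdom_limit_point[OF N] in auto)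
  then have eq: "nderiv (pdom N) k F t = nderiv (pdom N) k F0 t" if "t \<in> pdom N" "1 \<le> k" for k t
    using that by (cases k) auto
  have "\<bar>nderiv (pdom N) k G t - nderiv (pdom N) k F0 t\<bar> < e" if "t \<in> pdom N" "1 \<le> k" "k \<le> r" for k t
    using close[rule_format, OF that(3,1)] eq[OF that(1,2)] by (simp add: abs_minus_commute)
  then show ?thesis using G by blast
qed

lemma lift_iterate:
  assumes G: "smooth_lift N (points N) g G" and t: "t \<in> pdom N"
  shows "(G ^^ k) t \<in> pdom N \<and> param N ((G ^^ k) t) = (g ^^ k) (param N t)"
  using G t by (induction k) (auto simp: smooth_lift_def preim_points)

text \<open>
  Composing a lift of the smooth inverse of \<open>g ^^ m\<close> with a lift of \<open>g ^^ m\<close> gives the identity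
  up to a constant, so the derivative of the iterate, which is a product along the orbit, does not vanish.
\<close>

lemma diffeo_iterate_derivative_nonzero:
  assumes G: "smooth_lift N (points N) g G" and diff: "diffeo_onto_image N T (g ^^ m)"
    and I: "{a<..<b} \<subseteq> pdom N" "param N ` {a<..<b} \<subseteq> T" and t: "a < t" "t < b" and k: "k < m"
  shows "nderiv (pdom N) 1 G ((G ^^ k) t) \<noteq> 0"
proof -
  define E where "E = (\<lambda>k. nderiv (pdom N) k G)"
  define h where "h = g ^^ m"
  have dG: "(G has_real_derivative E 1 s) (at s within pdom N)" if "s \<in> pdom N" for s
    using lift_derivative[OF G that] by (simp add: E_def)
  have GP: "\<And>s. s \<in> pdom N \<Longrightarrow> G s \<in> pdom N" using G by (simp add: smooth_lift_def preim_points)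
  define J where "J = {a<..<b}"
  have J: "open J" "J \<subseteq> pdom N" "connected J" "t \<in> J" "J \<subseteq> preim N T" using I t by (auto simp: J_def preim_def)
  obtain F where F: "smooth_lift N T h F" using diff by (auto simp: diffeo_onto_image_def smooth_on_def h_def)
  obtain F2 where F2: "smooth_lift N (h ` T) (inv_into T h) F2" using diff by (auto simp: diffeo_onto_image_def smooth_on_def h_def)
  have inj: "inj_on h T" using diff by (simp add: diffeo_onto_image_def h_def)
  have FJ: "F s \<in> preim N (h ` T)" "param N (F s) = h (param N s)" if "s \<in> J" for s
  proof -
    have "s \<in> preim N T" using that J by auto
    then have "F s \<in> pdom N" "param N (F s) = h (param N s)" "param N s \<in> T" using F by (auto simp: smooth_lift_def preim_def)
    then show "F s \<in> preim N (h ` T)" "param N (F s) = h (param N s)" by (auto simp: preim_def)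
  qed
  have cF: "continuous_on J F" using lift_continuous[OF F] J(5) by (rule continuous_on_subset)
  have Hder: "((G ^^ m) has_real_derivative (\<Prod>j<m. E 1 ((G ^^ j) s))) (at s)" if s: "s \<in> J" for s
  proof -
    have "((G ^^ m) has_real_derivative (\<Prod>j<m. E 1 ((G ^^ j) s))) (at s within pdom N)"
      by (rule iterate_derivative[OF GP dG]) (use s J in auto)
    then have "((G ^^ m) has_real_derivative (\<Prod>j<m. E 1 ((G ^^ j) s))) (at s within J)" using J(2) by (rule DERIV_subset)
    then show ?thesis using at_within_open[OF s J(1)] by simp
  qed
  have cH: "continuous_on J (G ^^ m)"
    using Hder by (meson DERIV_isCont continuous_at_imp_continuous_on)
  obtain c where c: "\<forall>s\<in>J. (G ^^ m) s = F s + c"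
    using lifts_differ_by_constant[OF J(3) cH cF, of N] FJ(2) lift_iterate[OF G] J(2) by (metis h_def subsetD)
  have F2F: "param N (F2 (F s)) = param N s" if s: "s \<in> J" for s
  proof -
    have "param N (F2 (F s)) = inv_into T h (param N (F s))" using F2 FJ(1)[OF s] by (simp add: smooth_lift_def)
    also have "\<dots> = inv_into T h (h (param N s))" using FJ(2)[OF s] by simp
    also have "\<dots> = param N s" using inj s J(5) by (intro inv_into_f_f) (auto simp: preim_def)
    finally show ?thesis .
  qed
  have "continuous_on J (\<lambda>s. F2 (F s))"
    by (rule continuous_on_compose2[OF lift_continuous[OF F2] cF]) (use FJ in auto)
  then obtain c' where c': "\<forall>s\<in>J. F2 (F s) = s + c'"
    using lifts_differ_by_constant[OF J(3), of "\<lambda>s. F2 (F s)" "\<lambda>s. s" N] F2F by auto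
  \<comment> \<open>derivative of the \<open>m\<close>-th iterate, inverted by the derivative of \<open>F2\<close>\<close>
  define p where "p = (\<Prod>j<m. E 1 ((G ^^ j) t))"
  have "((\<lambda>s. (G ^^ m) s - c) has_real_derivative p) (at t within J)"
    using DERIV_diff[OF Hder[OF J(4)] DERIV_const[of c]] by (auto simp: p_def intro: has_field_derivative_at_within)
  then have dF: "(F has_real_derivative p) (at t within J)"
    by (rule derivative_cong_on[OF _ J(4)]) (use c in auto)
  define D2 where "D2 = nderiv (preim N (h ` T)) 1 F2 (F t)"
  have "(F2 has_real_derivative D2) (at (F t) within preim N (h ` T))"
  proof -
    have "(nderiv (preim N (h ` T)) 0 F2 has_real_derivative nderiv (preim N (h ` T)) (Suc 0) F2 (F t)) (at (F t) within preim N (h ` T))"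
      using lift_jet[OF F2] FJ(1)[OF J(4)] unfolding jet_on_def by blast
    then show ?thesis by (simp add: D2_def)
  qed
  then have "(F2 has_real_derivative D2) (at (F t) within F ` J)" by (rule DERIV_subset) (use FJ in auto)
  from DERIV_image_chain[OF this dF] have "((\<lambda>s. F2 (F s)) has_real_derivative D2 * p) (at t within J)" by (simp add: o_def)
  then have "((\<lambda>s. s + c') has_real_derivative D2 * p) (at t within J)"
    by (rule derivative_cong_on[OF _ J(4)]) (use c' in auto)
  then have "((\<lambda>s. s + c') has_real_derivative D2 * p) (at t)" using at_within_open[OF J(4,1)] by simp
  moreover have "((\<lambda>s. s + c') has_real_derivative 1) (at t)" by (auto intro!: derivative_eq_intros)
  ultimately have "D2 * p = 1" by (rule DERIV_unique)
  then have "p \<noteq> 0" by auto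
  then have "E 1 ((G ^^ k) t) \<noteq> 0" using k by (auto simp: p_def)
  then show ?thesis by (simp add: E_def)
qed

section \<open>Cross-ratios along an orbit\<close>

lemma interval_in_infinite:
  assumes "interval_in N S" shows "infinite S" "connected S" "S \<subseteq> points N"
proof -
  obtain I q where I: "I \<subseteq> pdom N" "is_interval I" "interior I \<noteq> {}" "homeomorphism I S (param N) q"
    using assms by (auto simp: interval_in_def)
  have S: "S = param N ` I" "continuous_on I (param N)" "inj_on (param N) I"
    using I(4) by (auto simp: homeomorphism_def intro: inj_on_inverseI)
  have "infinite I" using I(3) empty_interior_finite by blast
  then show "infinite S" using S finite_imageD by blast
  show "connected S" unfolding S(1) using S(2) I(2) is_interval_connected_1 connected_continuous_image by blast
  show "S \<subseteq> points N" using S(1) I(1) by (auto simp: points_def)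
qed

text \<open>
  In the parameter the two components of \<open>T - J\<close> are the parts of \<open>I\<close> on the two sides of \<open>K\<close>.
  They are intervals by hypothesis, hence infinite, which gives \<open>a < c\<close> and \<open>d < b\<close>.
\<close>

lemma interval_pair_coordinates:
  assumes T: "interval_in N T" and J: "interval_in N J" "J \<subseteq> T"
    and comp: "card (components (T - J)) = 2" "\<forall>C\<in>components (T - J). interval_in N C"
  shows "\<exists>I q K a c d b. homeomorphism I T (param N) q \<and> is_interval I \<and> I \<subseteq> pdom N \<and> endpoints I a b \<and>
    K \<subseteq> I \<and> is_interval K \<and> J = param N ` K \<and> endpoints K c d \<and>
    endpoints (left_part I K) a c \<and> endpoints (right_part I K) d b"
proof -
  obtain I q where I: "I \<subseteq> pdom N" "is_interval I" "interior I \<noteq> {}" "homeomorphism I T (param N) q"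
    using T by (auto simp: interval_in_def)
  have hq: "\<And>t. t \<in> I \<Longrightarrow> q (param N t) = t" "\<And>z. z \<in> T \<Longrightarrow> param N (q z) = z" "param N ` I = T" "q ` T = I"
    "continuous_on T q" using I(4) by (auto simp: homeomorphism_def)
  have inj: "inj_on (param N) I" using hq(1) by (rule inj_on_inverseI)
  obtain l u where lu: "I \<subseteq> {l..u}" using param_injective_bounded[OF I(2,1) inj] by blast
  have two: "\<exists>s t. s \<in> A \<and> t \<in> A \<and> s < t" if "infinite A" for A :: "real set"
  proof -
    obtain s where s: "s \<in> A" using \<open>infinite A\<close> infinite_imp_nonempty by blast
    have "A - {s} \<noteq> {}" using infinite_remove[OF \<open>infinite A\<close>] infinite_imp_nonempty by blast
    then obtain t where "t \<in> A" "t \<noteq> s" by blast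
    then show ?thesis using s by (metis linorder_neqE_linordered_idom)
  qed
  have "infinite I" using interval_in_infinite(1)[OF T] hq(3) by auto
  then obtain a b where ab: "endpoints I a b" using endpoints_exist[OF I(2) lu] two by metis
  define K where "K = q ` J"
  have KJ: "J = param N ` K" using hq(2) J(2) by (force simp: K_def image_image)
  have KI: "K \<subseteq> I" using hq(4) J(2) by (auto simp: K_def)
  have "connected K" unfolding K_def
    using interval_in_infinite(2)[OF J(1)] continuous_on_subset[OF hq(5) J(2)] by (intro connected_continuous_image)
  then have Kint: "is_interval K" by (simp add: is_interval_connected_1)
  have Kinf: "infinite K" using interval_in_infinite(1)[OF J(1)] KJ by auto
  then obtain c d where cd: "endpoints K c d" using endpoints_exist[OF Kint subset_trans[OF KI lu]] two by metis
  have K0: "K \<noteq> {}" using Kinf by auto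
  define L R where "L = left_part I K" and "R = right_part I K"
  have comps: "components (T - J) = {param N ` L, param N ` R} - {{}}"
    using components_interval_diff[OF I(4,2) KI Kint K0] by (simp add: KJ L_def R_def)
  have ne: "param N ` L \<noteq> {}" "param N ` R \<noteq> {}"
  proof -
    have "card (components (T - J)) \<le> 1" if e: "param N ` L = {} \<or> param N ` R = {}"
    proof -
      have "components (T - J) \<subseteq> {param N ` L} \<or> components (T - J) \<subseteq> {param N ` R}" using comps e by blast
      then show ?thesis using card_mono[of "{param N ` L}" "components (T - J)"] card_mono[of "{param N ` R}" "components (T - J)"]
        by auto
    qed
    then show "param N ` L \<noteq> {}" "param N ` R \<noteq> {}" using comp(1) by linarith+
  qed
  then have inf: "infinite L" "infinite R" using comps comp(2) interval_in_infinite(1) by auto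
  have cdK: "{c<..<d} \<subseteq> K" "K \<subseteq> {c..d}" "c < d" using cd by (auto simp: endpoints_def)
  have abI: "{a<..<b} \<subseteq> I" "I \<subseteq> {a..b}" "a < b" using ab by (auto simp: endpoints_def)
  have cdab: "a \<le> c" "d \<le> b" using endpoints_within[OF cd, of a b] KI abI by auto
  have Lsub: "L \<subseteq> {a..c}"
  proof
    fix t assume t: "t \<in> L"
    have "t \<le> c"
    proof (rule ccontr)
      assume "\<not> t \<le> c"
      then have "min t ((c + d) / 2) \<in> K" using cdK by (intro subsetD[OF cdK(1)]) (auto simp: min_def)
      then show False using t by (force simp: L_def left_part_def)
    qed
    then show "t \<in> {a..c}" using t abI by (auto simp: L_def left_part_def)
  qed
  have Rsub: "R \<subseteq> {d..b}"
  proof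
    fix t assume t: "t \<in> R"
    have "d \<le> t"
    proof (rule ccontr)
      assume "\<not> d \<le> t"
      then have "max t ((c + d) / 2) \<in> K" using cdK by (intro subsetD[OF cdK(1)]) (auto simp: max_def)
      then show False using t by (force simp: R_def right_part_def)
    qed
    then show "t \<in> {d..b}" using t abI by (auto simp: R_def right_part_def)
  qed
  have "a \<noteq> c"
  proof
    assume "a = c"
    then have "L \<subseteq> {c}" using Lsub by auto
    then show False using inf(1) finite_subset by blast
  qed
  moreover have "d \<noteq> b"
  proof
    assume "d = b"
    then have "R \<subseteq> {d}" using Rsub by auto
    then show False using inf(2) finite_subset by blast
  qed
  ultimately have ac: "a < c" "d < b" using cdab by auto
  have "{a<..<c} \<subseteq> L" using abI cdK cdab by (force simp: L_def left_part_def)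
  moreover have "{d<..<b} \<subseteq> R" using abI cdK cdab by (force simp: R_def right_part_def)
  ultimately have "endpoints L a c" "endpoints R d b" using ac Lsub Rsub by (auto simp: endpoints_def)
  then show ?thesis using I ab KI Kint KJ cd unfolding L_def R_def by blast
qed

lemma log_cr_monotone:
  fixes H :: "real \<Rightarrow> real"
  assumes mono: "strict_mono_on {a..b} H \<or> strict_antimono_on {a..b} H" and ord: "a < c" "c < d" "d < b"
  defines "D \<equiv> \<bar>H b - H a\<bar> * \<bar>H d - H c\<bar> / (\<bar>H c - H a\<bar> * \<bar>H b - H d\<bar>)"
  shows "0 < D" "log_cr (H a) (H c) (H d) (H b) = ln (1 + 1 / D)"
proof -
  have base: "0 < (s - p) * (r - q) / ((q - p) * (s - r)) \<and> log_cr p q r s = ln (1 + 1 / ((s - p) * (r - q) / ((q - p) * (s - r))))"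
    if "p < q" "q < r" "r < s" for p q r s :: real
  proof -
    have pos: "0 < (s - p) * (r - q)" "0 < (q - p) * (s - r)" using that by auto
    have "(r - p) * (s - q) = (s - p) * (r - q) + (q - p) * (s - r)" by (simp add: algebra_simps)
    then have "(r - p) * (s - q) / ((s - p) * (r - q)) = 1 + 1 / ((s - p) * (r - q) / ((q - p) * (s - r)))"
      using that by (simp add: add_divide_distrib)
    then show ?thesis using pos by (simp add: log_cr_def)
  qed
  have "0 < D \<and> log_cr (H a) (H c) (H d) (H b) = ln (1 + 1 / D)"
    using mono
  proof
    assume "strict_mono_on {a..b} H"
    then have o: "H a < H c" "H c < H d" "H d < H b" using ord by (auto elim!: monotone_onD)
    have "D = (H b - H a) * (H d - H c) / ((H c - H a) * (H b - H d))" using o by (simp add: D_def)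
    then show ?thesis using base[OF o] by simp
  next
    assume "strict_antimono_on {a..b} H"
    then have o: "H b < H d" "H d < H c" "H c < H a" using ord by (auto elim!: monotone_onD)
    have "D = (H a - H b) * (H c - H d) / ((H d - H b) * (H a - H c))" using o by (simp add: D_def mult.commute)
    then show ?thesis using base[OF o] by (simp add: log_cr_swap)
  qed
  then show "0 < D" "log_cr (H a) (H c) (H d) (H b) = ln (1 + 1 / D)" by auto
qed

text \<open>
  With \<open>H\<close> the identity this computes the cross-ratio of a pair of intervals, with \<open>H\<close> an iterate of a
  lift that of their images. The inverse \<open>q\<close> must be continuous: otherwise a half-open interval could
  wrap once around the circle, and the two outer intervals would merge into one component.
\<close>

lemma cross_ratio_coordinates:
  assumes hom: "homeomorphism I T h q" and I: "is_interval I" "endpoints I a b"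
    and K: "K \<subseteq> I" "is_interval K" "endpoints K c d"
    and LR: "endpoints (left_part I K) a c" "endpoints (right_part I K) d b"
    and H: "\<And>t. t \<in> I \<Longrightarrow> H t \<in> pdom N \<and> h t = param N (H t)"
    and cont: "continuous_on {a..b} H" and mono: "strict_mono_on {a..b} H \<or> strict_antimono_on {a..b} H"
  shows "cross_ratio N T (h ` K) = \<bar>H b - H a\<bar> * \<bar>H d - H c\<bar> / (\<bar>H c - H a\<bar> * \<bar>H b - H d\<bar>)"
proof -
  have inj: "inj_on h I" and TI: "T = h ` I" using hom by (auto simp: homeomorphism_def intro: inj_on_inverseI)
  have Iab: "I \<subseteq> {a..b}" using I(2) by (simp add: endpoints_def)
  have len: "len N (h ` S) = \<bar>H t - H s\<bar>" if S: "S \<subseteq> I" "endpoints S s t" for S s t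
  proof -
    have e: "endpoints (H ` S) (min (H s) (H t)) (max (H s) (H t))"
      by (rule monotone_image_endpoints[OF cont mono S(2)]) (use S Iab in auto)
    have hS: "h ` S = param N ` H ` S" using H S(1) by (force simp: image_image)
    have "inj_on (param N) (H ` S)"
    proof (rule inj_onI)
      fix x y assume xy: "x \<in> H ` S" "y \<in> H ` S" "param N x = param N y"
      then obtain p q where pq: "p \<in> S" "q \<in> S" "x = H p" "y = H q" by blast
      then have "p \<in> I" "q \<in> I" using S(1) by auto
      then have "h p = h q" using H[of p] H[of q] xy(3) pq by simp
      then show "x = y" using inj pq S(1) by (auto dest: inj_onD)
    qed
    then have "len N (h ` S) = max (H s) (H t) - min (H s) (H t)"
      unfolding hS using H S(1) by (intro len_param[OF e]) auto
    then show ?thesis by (simp add: max_def min_def)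
  qed
  have sub: "left_part I K \<subseteq> I" "right_part I K \<subseteq> I" by (auto simp: left_part_def right_part_def)
  have K0: "K \<noteq> {}" "left_part I K \<noteq> {}" "right_part I K \<noteq> {}"
    using K(3) LR by (auto simp: endpoints_def dest!: subset_empty[THEN iffD1])
  have comps: "components (T - h ` K) = {h ` left_part I K, h ` right_part I K}"
    using components_interval_diff[OF hom I(1) K(1,2) K0(1)] K0 by simp
  have ne: "h ` left_part I K \<noteq> h ` right_part I K"
  proof
    assume "h ` left_part I K = h ` right_part I K"
    then have "left_part I K = right_part I K" using inj_on_image_eq_iff[OF inj sub] by simp
    moreover have "left_part I K \<inter> right_part I K = {}" using K0(1) by (force simp: left_part_def right_part_def)
    ultimately show False using K0 by simp
  qed
  have "len N T = \<bar>H b - H a\<bar>" "len N (h ` K) = \<bar>H d - H c\<bar>"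
    "len N (h ` left_part I K) = \<bar>H c - H a\<bar>" "len N (h ` right_part I K) = \<bar>H b - H d\<bar>"
    using len[OF order_refl I(2)] len[OF K(1,3)] len[OF sub(1) LR(1)] len[OF sub(2) LR(2)] TI by auto
  then show ?thesis unfolding cross_ratio_def comps using ne by simp
qed

lemma lift_composition_continuous:
  assumes "smooth_on N S h" shows "continuous_on (preim N S) (\<lambda>t. h (param N t))"
proof -
  obtain F where F: "smooth_lift N S h F" using assms by (auto simp: smooth_on_def)
  have "continuous_on (preim N S) (\<lambda>t. param N (F t))"
    by (rule continuous_on_compose2[OF param_continuous[of UNIV] lift_continuous[OF F]]) auto
  then show ?thesis using F by (simp add: smooth_lift_def cong: continuous_on_cong)
qed

lemma diffeo_homeomorphism:
  assumes "diffeo_onto_image N T h" "T \<subseteq> points N" "h ` T \<subseteq> points N"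
  shows "homeomorphism T (h ` T) h (inv_into T h)"
proof (rule homeomorphismI)
  show "continuous_on T h" "continuous_on (h ` T) (inv_into T h)"
    using assms by (auto simp: diffeo_onto_image_def intro!: continuous_on_via_param lift_composition_continuous)
qed (use assms in \<open>auto simp: diffeo_onto_image_def inv_into_into f_inv_into_f\<close>)

text \<open>
  Indices whose parameter intervals share the point \<open>z\<close> have sets \<open>A i\<close> sharing the point \<open>p z\<close>.
\<close>

lemma orbit_overlap:
  assumes mult: "intersection_multiplicity m A \<le> n"
    and sub: "\<And>i z. i < m \<Longrightarrow> X i < z \<Longrightarrow> z < Y i \<Longrightarrow> p z \<in> A i"
  shows "overlap_le {..<m} X Y n"
  unfolding overlap_le_def
proof
  fix z
  define K where "K = {i\<in>{..<m}. X i < z \<and> z < Y i}"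
  have "p z \<in> (\<Inter>k\<in>K. A k)" using sub by (auto simp: K_def)
  then have "card K \<in> {card K | K. K \<subseteq> {..<m} \<and> (\<Inter>k\<in>K. A k) \<noteq> {}}" by (auto simp: K_def)
  moreover have "finite {card K | K. K \<subseteq> {..<m} \<and> (\<Inter>k\<in>K. A k) \<noteq> {}}"
    by (rule finite_subset[of _ "card ` Pow {..<m}"]) auto
  ultimately have "card K \<le> intersection_multiplicity m A" unfolding intersection_multiplicity_def by (intro Max_ge)
  then show "card {i\<in>{..<m}. X i < z \<and> z < Y i} \<le> n" using mult by (simp add: K_def)
qed

lemma distortion_budgetD:
  fixes S :: "nat set"
  assumes "distortion_budget E \<alpha> \<beta> C" "finite S" "overlap_le S X Y n"
    "\<forall>i\<in>S. \<alpha> \<le> X i \<and> X i < Y i \<and> Y i \<le> \<beta> \<and> (\<forall>t. X i < t \<and> t < Y i \<longrightarrow> E 1 t \<noteq> 0)"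
  shows "\<exists>c. (\<forall>i\<in>S. 0 \<le> c i \<and> distortion_le (E 0) (E 1) (X i) (Y i) (exp (c i))) \<and> sum c S \<le> C * real n"
  using assms unfolding distortion_budget_def by blast

text \<open>
  A compact interval that contains, up to an integer translation, every parameter interval in question:
  on the circle an interval of length at most 1 can be moved so as to start in \<open>[0, 1)\<close>.
\<close>

fun base_interval :: "curve \<Rightarrow> real \<times> real" where
  "base_interval (Interval a b) = (a, b)"
| "base_interval Circle = (0, 2)"

text \<open>
  The intervals of the orbit, as parameter intervals, inherit the multiplicity bound and are free of
  critical points. On the circle they have length at most 1, because \<open>g ^^ k\<close> is injective on \<open>T\<close>, and
  are moved into \<open>[0, 2]\<close>; the distortion is unchanged by periodicity.
\<close>

lemma orbit_distortion_budget:
  assumes G: "smooth_lift N (points N) g G" and diff: "diffeo_onto_image N T (g ^^ m)"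
    and hom: "homeomorphism I T (param N) q" and I: "I \<subseteq> pdom N" "endpoints I a b"
    and mult: "intersection_multiplicity m (\<lambda>k. (g ^^ k) ` T) \<le> n"
    and budget: "distortion_budget (\<lambda>k. nderiv (pdom N) k G) (fst (base_interval N)) (snd (base_interval N)) C"
    and ab: "{a..b} \<subseteq> pdom N"
  shows "\<exists>w. (\<forall>k<m. distortion_le G (nderiv (pdom N) 1 G) (min ((G ^^ k) a) ((G ^^ k) b)) (max ((G ^^ k) a) ((G ^^ k) b)) (exp (w k)))
     \<and> sum w {..<m} \<le> C * real n"
proof -
  define E where "E = (\<lambda>k. nderiv (pdom N) k G)"
  have E0: "E 0 = G" by (simp add: E_def)
  have dG: "(G has_real_derivative E 1 s) (at s within pdom N)" if "s \<in> pdom N" for s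
    using lift_derivative[OF G that] by (simp add: E_def)
  have GP: "\<And>s. s \<in> pdom N \<Longrightarrow> G s \<in> pdom N" using G by (simp add: smooth_lift_def preim_points)
  have abI: "{a<..<b} \<subseteq> I" "a < b" using I(2) by (auto simp: endpoints_def)
  have TI: "T = param N ` I" and injI: "inj_on (param N) I" using hom by (auto simp: homeomorphism_def intro: inj_on_inverseI)
  have nz: "E 1 ((G ^^ k) t) \<noteq> 0" if "k < m" "a < t" "t < b" for k t
    unfolding E_def by (rule diffeo_iterate_derivative_nonzero[OF G diff _ _ that(2,3,1)]) (use abI I TI in auto)
  have im: "{min ((G ^^ k) a) ((G ^^ k) b)<..<max ((G ^^ k) a) ((G ^^ k) b)} \<subseteq> (G ^^ k) ` {a<..<b}"
    "min ((G ^^ k) a) ((G ^^ k) b) < max ((G ^^ k) a) ((G ^^ k) b)" if k: "k < m" for k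
  proof -
    have "continuous_on {a..b} (G ^^ k)" "strict_mono_on {a..b} (G ^^ k) \<or> strict_antimono_on {a..b} (G ^^ k)"
      by (rule iterate_monotone[OF GP dG ab, where k = k]; use nz k in auto)+
    then have "endpoints ((G ^^ k) ` {a<..<b}) (min ((G ^^ k) a) ((G ^^ k) b)) (max ((G ^^ k) a) ((G ^^ k) b))"
      by (rule monotone_image_endpoints) (use abI in \<open>auto simp: endpoints_def\<close>)
    then show "{min ((G ^^ k) a) ((G ^^ k) b)<..<max ((G ^^ k) a) ((G ^^ k) b)} \<subseteq> (G ^^ k) ` {a<..<b}"
      "min ((G ^^ k) a) ((G ^^ k) b) < max ((G ^^ k) a) ((G ^^ k) b)" by (auto simp: endpoints_def)
  qed
  define X Y where "X = (\<lambda>k. min ((G ^^ k) a) ((G ^^ k) b))" and "Y = (\<lambda>k. max ((G ^^ k) a) ((G ^^ k) b))"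
  have XY: "X k < Y k" "\<And>z. X k < z \<Longrightarrow> z < Y k \<Longrightarrow> \<exists>t. a < t \<and> t < b \<and> z = (G ^^ k) t" if "k < m" for k
    using im[OF that] by (fastforce simp: X_def Y_def)+
  have XYP: "X k \<in> pdom N" "Y k \<in> pdom N" for k
  proof -
    have "a \<in> pdom N" "b \<in> pdom N" using ab abI(2) by auto
    then have "(G ^^ k) a \<in> pdom N" "(G ^^ k) b \<in> pdom N" using iterate_in[of "pdom N" G _ k] GP by blast+
    then show "X k \<in> pdom N" "Y k \<in> pdom N" by (auto simp: X_def Y_def min_def max_def)
  qed
  have inT: "param N z \<in> (g ^^ k) ` T" if k: "k < m" and z: "X k < z" "z < Y k" for k z
  proof -
    obtain t where t: "a < t" "t < b" "z = (G ^^ k) t" using XY(2)[OF k z] by blast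
    then have "t \<in> I" "t \<in> pdom N" using abI I(1) by auto
    then show ?thesis using lift_iterate[OF G, of t k] t(3) TI by auto
  qed
  have dEnz: "E 1 z \<noteq> 0" if k: "k < m" and z: "X k < z" "z < Y k" for k z
    using XY(2)[OF k z] nz[OF k] by auto
  show ?thesis
  proof (cases N)
    case (Interval A B)
    have "overlap_le {..<m} X Y n" by (rule orbit_overlap[OF mult inT])
    moreover have "\<forall>i\<in>{..<m}. A \<le> X i \<and> X i < Y i \<and> Y i \<le> B \<and> (\<forall>t. X i < t \<and> t < Y i \<longrightarrow> E 1 t \<noteq> 0)"
      using XY(1) XYP dEnz Interval by auto
    ultimately obtain w where "\<forall>i\<in>{..<m}. 0 \<le> w i \<and> distortion_le (E 0) (E 1) (X i) (Y i) (exp (w i))" "sum w {..<m} \<le> C * real n"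
      using distortion_budgetD[OF budget[folded E_def], of "{..<m}" X Y n] Interval by auto
    then show ?thesis by (intro exI[of _ w]) (auto simp: X_def Y_def E_def)
  next
    case Circle
    define j where "j = (\<lambda>k. \<lfloor>X k\<rfloor>)"
    define X' Y' where "X' = (\<lambda>k. X k - of_int (j k))" and "Y' = (\<lambda>k. Y k - of_int (j k))"
    have per: "E (Suc k) (t + of_int i) = E (Suc k) t" for k t i
      using circle_jet_periodic(1)[OF G[unfolded Circle]] by (simp add: E_def Circle)
    have width: "Y k - X k \<le> 1" if k: "k < m" for k
    proof (rule circle_injective_width)
      show "inj_on (param Circle) {X k<..<Y k}"
      proof (rule inj_onI)
        fix x y assume xy: "x \<in> {X k<..<Y k}" "y \<in> {X k<..<Y k}" "param Circle x = param Circle y"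
        obtain s where s: "a < s" "s < b" "x = (G ^^ k) s" using XY(2)[OF k] xy(1) by auto
        obtain t where t: "a < t" "t < b" "y = (G ^^ k) t" using XY(2)[OF k] xy(2) by auto
        have st: "s \<in> I" "t \<in> I" using s t abI by auto
        have "(g ^^ k) (param N s) = (g ^^ k) (param N t)"
          using lift_iterate[OF G, of s k] lift_iterate[OF G, of t k] st I(1) xy(3) s(3) t(3) Circle by auto
        then have "(g ^^ (m - k)) ((g ^^ k) (param N s)) = (g ^^ (m - k)) ((g ^^ k) (param N t))" by simp
        then have "(g ^^ m) (param N s) = (g ^^ m) (param N t)"
          using k by (metis comp_apply funpow_add le_add_diff_inverse2 less_imp_le)
        then have "param N s = param N t" using diff st TI by (auto simp: diffeo_onto_image_def dest: inj_onD)
        then have "s = t" using injI st by (auto dest: inj_onD)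
        then show "x = y" using s t by simp
      qed
    qed
    have X'b: "0 \<le> X' k" "X' k < 1" for k unfolding X'_def j_def by linarith+
    have "overlap_le {..<m} X' Y' n"
    proof (rule orbit_overlap[OF mult])
      fix i z assume i: "i < m" and z: "X' i < z" "z < Y' i"
      then have "param N (z + of_int (j i)) \<in> (g ^^ i) ` T" by (intro inT) (auto simp: X'_def Y'_def)
      then show "param N z \<in> (g ^^ i) ` T" using param_circle_shift Circle by simp
    qed
    moreover have "\<forall>i\<in>{..<m}. 0 \<le> X' i \<and> X' i < Y' i \<and> Y' i \<le> 2 \<and> (\<forall>t. X' i < t \<and> t < Y' i \<longrightarrow> E 1 t \<noteq> 0)"
    proof (intro ballI conjI allI impI; (elim conjE)?)
      fix i assume i: "i \<in> {..<m}"
      show "0 \<le> X' i" by (rule X'b)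
      show "X' i < Y' i" using XY(1)[of i] i by (simp add: X'_def Y'_def)
      show "Y' i \<le> 2" using width[of i] X'b(2)[of i] i by (simp add: X'_def Y'_def)
      fix t assume t: "X' i < t" "t < Y' i"
      then have "E 1 (t + of_int (j i)) \<noteq> 0" using i by (intro dEnz[of i]) (auto simp: X'_def Y'_def)
      then show "E 1 t \<noteq> 0" using per[of 0 t "j i"] by simp
    qed
    ultimately obtain w where w: "\<forall>i\<in>{..<m}. 0 \<le> w i \<and> distortion_le (E 0) (E 1) (X' i) (Y' i) (exp (w i))" "sum w {..<m} \<le> C * real n"
      using distortion_budgetD[OF budget[folded E_def], of "{..<m}" X' Y' n] Circle by auto
    have "distortion_le G (E 1) (X k) (Y k) (exp (w k))" if k: "k < m" for k
      unfolding distortion_le_def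
    proof (intro allI impI, elim conjE)
      fix s t assume st: "X k < s" "s < t" "t < Y k"
      obtain c where c: "\<And>t. G (t + of_int (- j k)) = G t + c" using circle_jet_periodic(2)[OF G[unfolded Circle]] by blast
      have "E 1 (s - of_int (j k)) * E 1 (t - of_int (j k)) * ((t - of_int (j k)) - (s - of_int (j k)))\<^sup>2
         \<le> exp (w k) * (E 0 (t - of_int (j k)) - E 0 (s - of_int (j k)))\<^sup>2"
        using w(1) k st by (intro distortion_leD[of _ _ "X' k" "Y' k"]) (auto simp: X'_def Y'_def)
      moreover have "E 1 (u - of_int (j k)) = E 1 u" "E 0 (u - of_int (j k)) = G u + c" for u
        using per[of 0 u "- j k"] c[of u] E0 by auto
      ultimately show "E 1 s * E 1 t * (t - s)\<^sup>2 \<le> exp (w k) * (G t - G s)\<^sup>2" by simp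
    qed
    then show ?thesis using w(2) by (intro exI[of _ w]) (auto simp: X_def Y_def E_def)
  qed
qed

lemma cross_ratio_iterate:
  assumes G: "smooth_lift N (points N) g G"
    and T: "interval_in N T" and J: "interval_in N J" "J \<subseteq> T"
    and comp: "card (components (T - J)) = 2" "\<forall>C\<in>components (T - J). interval_in N C"
    and diff: "diffeo_onto_image N T (g ^^ m)"
    and mult: "intersection_multiplicity m (\<lambda>k. (g ^^ k) ` T) \<le> n"
    and budget: "distortion_budget (\<lambda>k. nderiv (pdom N) k G) (fst (base_interval N)) (snd (base_interval N)) C"
  shows "0 < cross_ratio N T J" "0 < cross_ratio N ((g ^^ m) ` T) ((g ^^ m) ` J)"
    "ln (1 + 1 / cross_ratio N ((g ^^ m) ` T) ((g ^^ m) ` J)) \<le> exp (C * real n) * ln (1 + 1 / cross_ratio N T J)"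
proof -
  obtain I q K a c d b where hom: "homeomorphism I T (param N) q" and I: "is_interval I" "I \<subseteq> pdom N" "endpoints I a b"
    and K: "K \<subseteq> I" "is_interval K" "J = param N ` K" "endpoints K c d"
    and LR: "endpoints (left_part I K) a c" "endpoints (right_part I K) d b"
    using interval_pair_coordinates[OF T J comp] by blast
  have ord: "a < c" "c < d" "d < b" using LR K(4) by (auto simp: endpoints_def)
  have abI: "{a<..<b} \<subseteq> I" "I \<subseteq> {a..b}" using I(3) by (auto simp: endpoints_def)
  have "closed (pdom N)" by (cases N) auto
  then have "closure {a<..<b} \<subseteq> pdom N" using abI I(2) by (intro closure_minimal) auto
  then have ab: "{a..b} \<subseteq> pdom N" using ord by simp
  define G' where "G' = nderiv (pdom N) 1 G"
  define H where "H = G ^^ m"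
  have dG: "(G has_real_derivative G' s) (at s within pdom N)" if "s \<in> pdom N" for s
    using lift_derivative[OF G that] by (simp add: G'_def)
  have GP: "\<And>s. s \<in> pdom N \<Longrightarrow> G s \<in> pdom N" using G by (simp add: smooth_lift_def preim_points)
  have TI: "T = param N ` I" using hom by (auto simp: homeomorphism_def)
  have nz: "G' ((G ^^ k) t) \<noteq> 0" if "k < m" "a < t" "t < b" for k t
    unfolding G'_def by (rule diffeo_iterate_derivative_nonzero[OF G diff _ _ that(2,3,1)]) (use abI I TI in auto)
  have H: "continuous_on {a..b} H" "strict_mono_on {a..b} H \<or> strict_antimono_on {a..b} H"
    unfolding H_def by (rule iterate_monotone[OF GP dG ab, where k = m]; use nz in auto)+
  have HI: "H t \<in> pdom N \<and> ((g ^^ m) \<circ> param N) t = param N (H t)" if "t \<in> I" for t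
    using lift_iterate[OF G, of t m] that I(2) by (auto simp: H_def)
  obtain w where w: "\<And>k. k < m \<Longrightarrow> distortion_le G G' (min ((G ^^ k) a) ((G ^^ k) b)) (max ((G ^^ k) a) ((G ^^ k) b)) (exp (w k))"
      "sum w {..<m} \<le> C * real n"
    using orbit_distortion_budget[OF G diff hom I(2,3) mult budget ab] unfolding G'_def by blast
  have "log_cr (H a) (H c) (H d) (H b) \<le> exp (sum w {..<m}) * log_cr a c d b"
    unfolding H_def by (rule log_cr_iterate[OF pdom_interval GP dG ab ord nz w(1)])
  also have "\<dots> \<le> exp (C * real n) * log_cr a c d b" using w(2) log_cr_nonneg[OF ord] by (intro mult_right_mono) auto
  finally have main: "log_cr (H a) (H c) (H d) (H b) \<le> exp (C * real n) * log_cr a c d b" .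
  have gT: "(g ^^ m) ` T \<subseteq> points N"
    using HI TI by (force simp: points_def)
  have hom': "homeomorphism I ((g ^^ m) ` T) ((g ^^ m) \<circ> param N) (q \<circ> inv_into T (g ^^ m))"
    using homeomorphism_compose[OF hom diffeo_homeomorphism[OF diff interval_in_infinite(3)[OF T] gT]] .
  have idmono: "strict_mono_on {a..b} (\<lambda>t. t) \<or> strict_antimono_on {a..b} (\<lambda>t::real. t)" by (auto simp: monotone_on_def)
  have cr0: "cross_ratio N T J = \<bar>b - a\<bar> * \<bar>d - c\<bar> / (\<bar>c - a\<bar> * \<bar>b - d\<bar>)"
    unfolding K(3) using I(2) by (intro cross_ratio_coordinates[where H = "\<lambda>t. t", OF hom I(1,3) K(1,2,4) LR _ _ idmono]) auto
  have gJ: "(g ^^ m) ` J = ((g ^^ m) \<circ> param N) ` K" by (simp add: K(3) image_comp)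
  have cr1: "cross_ratio N ((g ^^ m) ` T) ((g ^^ m) ` J) = \<bar>H b - H a\<bar> * \<bar>H d - H c\<bar> / (\<bar>H c - H a\<bar> * \<bar>H b - H d\<bar>)"
    unfolding gJ by (rule cross_ratio_coordinates[where H = H, OF hom' I(1,3) K(1,2,4) LR HI H])
  note l0 = log_cr_monotone[OF idmono ord] and l1 = log_cr_monotone[OF H(2) ord]
  show "0 < cross_ratio N T J" using l0(1) cr0 by simp
  show "0 < cross_ratio N ((g ^^ m) ` T) ((g ^^ m) ` J)" using l1(1) cr1 by simp
  show "ln (1 + 1 / cross_ratio N ((g ^^ m) ` T) ((g ^^ m) ` J)) \<le> exp (C * real n) * ln (1 + 1 / cross_ratio N T J)"
    using main l0(2) l1(2) unfolding cr0 cr1 by simp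
qed

section \<open>The theorem\<close>

text \<open>
  Every point is regular or non-flat. The derivatives in \<^const>\<open>Dn\<close> are taken at a chosen parameter value
  \<open>s\<close>, which differs from \<open>t\<close> by a period.
\<close>

lemma some_derivative_nonzero:
  assumes f: "f \<in> Cinf N" and nonflat: "\<forall>c. critical_point N f c \<longrightarrow> non_flat N f c"
    and t: "t \<in> pdom N"
  shows "\<exists>d\<ge>1. nderiv (pdom N) d (SOME F. smooth_lift N (points N) f F) t \<noteq> 0"
proof -
  define F where "F = (SOME F. smooth_lift N (points N) f F)"
  have F: "smooth_lift N (points N) f F"
    using f unfolding F_def Cinf_def smooth_on_def by (intro someI_ex[of "smooth_lift N (points N) f"]) blast
  define c s where "c = param N t" and "s = (SOME s. s \<in> pdom N \<and> param N s = c)"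
  have s: "s \<in> pdom N \<and> param N s = c"
    unfolding s_def by (rule someI[of _ t]) (use t c_def in auto)
  have c: "c \<in> points N" using t by (auto simp: c_def points_def)
  have eq: "nderiv (pdom N) d F s = nderiv (pdom N) d F t" if d: "d \<ge> 1" for d
  proof (cases N)
    case (Interval a b)
    then have "s = t" using s by (simp add: c_def)
    then show ?thesis by simp
  next
    case Circle
    obtain j :: int where "s = t + of_int j" using param_eq_int[of N s t] s by (auto simp: c_def)
    moreover obtain k where "d = Suc k" using d by (cases d) auto
    ultimately show ?thesis using circle_jet_periodic(1)[OF F[unfolded Circle], of k t j] Circle by simp
  qed
  have Dn: "Dn N d f c = nderiv (pdom N) d F s" for d by (simp add: Dn_def F_def s_def)
  have "\<exists>d\<ge>1. Dn N d f c \<noteq> 0"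
  proof (cases "Dn N 1 f c = 0")
    case True
    then have "non_flat N f c" using nonflat c by (simp add: critical_point_def)
    then obtain d where "d \<ge> 2" "Dn N d f c \<noteq> 0" unfolding non_flat_def by blast
    then show ?thesis by (intro exI[of _ d]) auto
  qed auto
  then show ?thesis using Dn eq by (auto simp: F_def)
qed

lemma gauge_tendsto_zero:
  assumes "0 < q"
  shows "((\<lambda>\<epsilon>::real. 1 / (exp (q * ln (1 + 1 / \<epsilon>)) - 1) + \<epsilon>) \<longlongrightarrow> 0) (at_right 0)"
proof -
  have "filterlim (\<lambda>\<epsilon>::real. 1 + inverse \<epsilon>) at_top (at_right 0)"
    by (rule filterlim_tendsto_add_at_top[OF tendsto_const filterlim_inverse_at_top_right])
  then have "filterlim (\<lambda>\<epsilon>::real. ln (1 + 1 / \<epsilon>)) at_top (at_right 0)"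
    using filterlim_compose[OF ln_at_top] by (simp add: inverse_eq_divide)
  then have "filterlim (\<lambda>\<epsilon>::real. q * ln (1 + 1 / \<epsilon>)) at_top (at_right 0)"
    by (rule filterlim_tendsto_pos_mult_at_top[OF tendsto_const assms])
  then have "filterlim (\<lambda>\<epsilon>::real. exp (q * ln (1 + 1 / \<epsilon>))) at_top (at_right 0)"
    by (rule filterlim_compose[OF exp_at_top])
  then have "filterlim (\<lambda>\<epsilon>::real. - 1 + exp (q * ln (1 + 1 / \<epsilon>))) at_top (at_right 0)"
    by (rule filterlim_tendsto_add_at_top[OF tendsto_const])
  then have "((\<lambda>\<epsilon>::real. inverse (- 1 + exp (q * ln (1 + 1 / \<epsilon>)))) \<longlongrightarrow> 0) (at_right 0)"
    by (rule tendsto_inverse_0_at_top)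
  then have "((\<lambda>\<epsilon>::real. inverse (- 1 + exp (q * ln (1 + 1 / \<epsilon>))) + \<epsilon>) \<longlongrightarrow> 0 + 0) (at_right 0)"
    by (intro tendsto_add tendsto_ident_at)
  then show ?thesis by (simp add: inverse_eq_divide)
qed

theorem theorem4p5:
  fixes N :: curve and f :: "complex \<Rightarrow> complex"
  assumes "N = Circle \<or> (\<exists>a b. a < b \<and> N = Interval a b)"
    and "f \<in> Cinf N"
    and "\<forall>c. critical_point N f c \<longrightarrow> non_flat N f c"
  shows "\<exists>(\<F> :: (complex \<Rightarrow> complex) set) (\<rho> :: real \<Rightarrow> nat \<Rightarrow> real).
    openin (Cinf_topology N) \<F> \<and> f \<in> \<F> \<and>
    (\<forall>g\<in>\<F>. \<forall>(n :: nat) (m :: nat) T J.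
       interval_in N T \<and> interval_in N J \<and> J \<subseteq> T \<and>
       card (components (T - J)) = 2 \<and> (\<forall>C\<in>components (T - J). interval_in N C) \<and>
       diffeo_onto_image N T (g ^^ m) \<and>
       intersection_multiplicity m (\<lambda>k. (g ^^ k) ` T) \<le> n \<longrightarrow>
       cross_ratio N T J < \<rho> (cross_ratio N ((g ^^ m) ` T) ((g ^^ m) ` J)) n) \<and>
    (\<forall>n. ((\<lambda>\<epsilon>. \<rho> \<epsilon> n) \<longlongrightarrow> 0) (at_right 0))"
proof -
  define F where "F = (SOME F. smooth_lift N (points N) f F)"
  have F: "smooth_lift N (points N) f F"
    using assms(2) unfolding F_def Cinf_def smooth_on_def by (intro someI_ex[of "smooth_lift N (points N) f"]) blast
  define A B where "A = fst (base_interval N)" and "B = snd (base_interval N)"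
  have AB: "A < B" "{A..B} \<subseteq> pdom N" using assms(1) by (cases N; auto simp: A_def B_def)+
  have "jet_on {A..B} (\<lambda>k. nderiv (pdom N) k F)"
    by (rule jet_on_subset[OF lift_jet_points[OF F] AB(2)])
  then have "\<exists>r e C. 0 < e \<and> (\<forall>E. jet_on {A..B} E \<and>
      (\<forall>s\<in>{A..B}. \<forall>k. 1 \<le> k \<and> k \<le> r \<longrightarrow> \<bar>E k s - nderiv (pdom N) k F s\<bar> < e) \<longrightarrow> distortion_budget E A B C)"
    by (rule uniform_distortion_budget[OF _ AB(1)])
       (use AB(2) some_derivative_nonzero[OF assms(2,3), folded F_def] in blast)
  then obtain r e C where e: "0 < e"
    and budget: "\<forall>E. jet_on {A..B} E \<and>
      (\<forall>s\<in>{A..B}. \<forall>k. 1 \<le> k \<and> k \<le> r \<longrightarrow> \<bar>E k s - nderiv (pdom N) k F s\<bar> < e) \<longrightarrow> distortion_budget E A B C"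
    by (elim exE conjE) (rule that)
  \<comment> \<open>solves \<open>ln (1 + 1 / D\<^sub>1) \<le> exp (C * n) * ln (1 + 1 / D\<^sub>0)\<close> for \<open>D\<^sub>0\<close>; the summand \<open>\<epsilon>\<close> makes the inequality strict\<close>
  define \<rho> where "\<rho> = (\<lambda>\<epsilon> n. 1 / (exp (exp (- C * real n) * ln (1 + 1 / \<epsilon>)) - 1) + \<epsilon>)"
  have bound: "cross_ratio N T J < \<rho> (cross_ratio N ((g ^^ m) ` T) ((g ^^ m) ` J)) n"
    if g: "g \<in> Cinf_ball N f r e" and TJ: "interval_in N T" "interval_in N J" "J \<subseteq> T"
      "card (components (T - J)) = 2" "\<forall>C\<in>components (T - J). interval_in N C"
      and diff: "diffeo_onto_image N T (g ^^ m)" and mult: "intersection_multiplicity m (\<lambda>k. (g ^^ k) ` T) \<le> n"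
    for g n m T J
  proof -
    obtain G where G: "smooth_lift N (points N) g G"
      and close: "\<forall>t\<in>pdom N. \<forall>k. 1 \<le> k \<and> k \<le> r \<longrightarrow> \<bar>nderiv (pdom N) k G t - nderiv (pdom N) k F t\<bar> < e"
      using ball_jets[OF assms(1) g F] by blast
    have "jet_on {A..B} (\<lambda>k. nderiv (pdom N) k G)"
      by (rule jet_on_subset[OF lift_jet_points[OF G] AB(2)])
    then have bud: "distortion_budget (\<lambda>k. nderiv (pdom N) k G) (fst (base_interval N)) (snd (base_interval N)) C"
      unfolding A_def[symmetric] B_def[symmetric] 
      by (intro budget[rule_format] conjI) (use close AB(2) in blast)+
    define D0 D1 where "D0 = cross_ratio N T J" and "D1 = cross_ratio N ((g ^^ m) ` T) ((g ^^ m) ` J)"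
    have D: "0 < D0" "0 < D1" "ln (1 + 1 / D1) \<le> exp (C * real n) * ln (1 + 1 / D0)"
      unfolding D0_def D1_def using cross_ratio_iterate[OF G TJ diff mult bud] by auto
    define y where "y = exp (- C * real n) * ln (1 + 1 / D1)"
    have "y \<le> exp (- C * real n) * (exp (C * real n) * ln (1 + 1 / D0))"
      unfolding y_def using D(3) by (intro mult_left_mono) auto
    also have "\<dots> = ln (1 + 1 / D0)" by (simp flip: mult.assoc exp_add)
    finally have yl: "y \<le> ln (1 + 1 / D0)" .
    have "0 < 1 + 1 / D0" using D(1) by (simp add: add_pos_pos)
    then have "exp y \<le> 1 + 1 / D0" using yl by (simp only: ln_ge_iff)
    moreover have "0 < y" unfolding y_def using D(2) by (intro mult_pos_pos ln_gt_zero) auto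
    then have "1 < exp y" by simp
    ultimately have "D0 \<le> 1 / (exp y - 1)" using D(1) by (simp add: field_simps)
    also have "\<dots> < \<rho> D1 n" using D(2) by (simp add: \<rho>_def y_def)
    finally show ?thesis by (simp add: D0_def D1_def)
  qed
  have "openin (Cinf_topology N) (Cinf_ball N f r e)"
    unfolding Cinf_topology_def using assms(2) e by (intro topology_generated_by_Basis) blast
  moreover have "f \<in> Cinf_ball N f r e" unfolding Cinf_ball_def using assms(2) F e
    by (intro CollectI conjI exI[of _ F]) auto
  moreover have "\<forall>n. ((\<lambda>\<epsilon>. \<rho> \<epsilon> n) \<longlongrightarrow> 0) (at_right 0)"
    unfolding \<rho>_def by (intro allI gauge_tendsto_zero) simp
  ultimately show ?thesis using bound by (intro exI[of _ "Cinf_ball N f r e"] exI[of _ \<rho>]) blast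
qed

end
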